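(* Let $\mu>1$. For any integer $n\ge2$ and any $m\in\mathbb{Z}_+$, the function $$\psi^{(n,m)}=\sum_{\alpha\in\mathbb{Z}}(-1)^\alpha g^{(n,m)}_{\alpha-1}\,\varphi^{(n,m+1)}(\cdot-2^{-(m+1)}\alpha),\qquad g^{(n,m)}_\alpha=\int_{\mathbb{R}}\varphi^{(n,m)}(x)\,\varphi^{(n,m+1)}(x+2^{-(m+1)}\alpha)\,dx,$$ is the unique minimally supported wavelet generating the wavelet space $W^{(n,m)}$.
   Context: $\mathbb{Z}_+=\{0,1,2,\dots\}$; the Fourier transform is $\widehat f(\omega)=\int_{\mathbb{R}} f(x)e^{-i\omega x}\,dx$; $\overline{\mathrm{span}}$ is the closed linear span in $L_2(\mathbb{R})$. Masks: fix a real parameter $\mu>1$. For an integer $n\ge 2$, let $a^{(n,0)}_0=a^{(n,0)}_1=\tfrac12$ and $a^{(n,0)}_\alpha=0$ otherwise; for $m\ge 1$ let $$a^{(n,m)}_\alpha=\frac{1}{2^{n+1+m^{-\mu}}}\left[\binom{n+1}{\alpha}+4\bigl(2^{m^{-\mu}}-1\bigr)\binom{n-1}{\alpha-1}\right],\quad 0\le\alpha\le n+1,$$ and $a^{(n,m)}_\alpha=0$ otherwise (with $\binom{p}{q}=0$ if $q<0$ or $q>p$). The symbols are $A^{(n,m)}(z)=\sum_\alpha a^{(n,m)}_\alpha z^\alpha$. Refinable functions: for $m\in\mathbb{Z}_+$, $\varphi^{(n,m)}\in L_2(\mathbb{R})$ is the compactly supported function with $\widehat{\varphi}^{(n,m)}(\omega)=\prod_{k=m}^{\infty}A^{(n,k)}\bigl(e^{-i\omega/2^{k+1}}\bigr)$.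 Its support is $[0,\frac n2+1]$ for $m=0$ and $[0,2^{-m}(n+1)]$ for $m>0$; hence the sum defining $\psi^{(n,m)}$ is finite (it runs over $-n\le\alpha\le n+1$ for $m=0$ and $-2n\le\alpha\le n+1$ for $m>0$). Spaces: $V^{(n,m)}=\overline{\mathrm{span}}\{\varphi^{(n,m)}(\cdot-2^{-m}\alpha):\alpha\in\mathbb{Z}\}$, so $V^{(n,m)}\subset V^{(n,m+1)}$, and $W^{(n,m)}$ is the orthogonal complement of $V^{(n,m)}$ in $V^{(n,m+1)}$. A wavelet generating $W^{(n,m)}$ is a function $\psi\in W^{(n,m)}$ with $W^{(n,m)}=\overline{\mathrm{span}}\{\psi(\cdot-2^{-m}\alpha):\alpha\in\mathbb{Z}\}$; minimally supported means compactly supported with support of least length among such wavelets. *)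

theory Defs
  imports "HOL-Analysis.Analysis" "HOL-Library.Function_Algebras"
begin

text \<open>Elements of the complex Hilbert space \<open>L\<^sub>2\<close> are represented by Borel functions rather than by
  classes modulo null sets. The sets \<open>L2\<close>, \<open>closed_span S\<close>, \<open>V \<phi> m\<close> and \<open>W \<phi> m\<close> below contain with a
  function all Borel functions that are almost everywhere equal to it.\<close>

definition L2 :: "(real \<Rightarrow> complex) set" where
  "L2 = {f \<in> borel_measurable borel. integrable lborel (\<lambda>x. (cmod (f x))\<^sup>2)}"

definition l2_norm :: "(real \<Rightarrow> complex) \<Rightarrow> real" where
  "l2_norm f = sqrt (LINT x|lborel. (cmod (f x))\<^sup>2)"

definition l2_inner :: "(real \<Rightarrow> complex) \<Rightarrow> (real \<Rightarrow> complex) \<Rightarrow> complex" where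
  "l2_inner f g = (LINT x|lborel. f x * cnj (g x))"

interpretation cfun: vector_space "\<lambda>(c::complex) (f::real \<Rightarrow> complex) x. c * f x"
  by unfold_locales (auto simp: fun_eq_iff algebra_simps)

definition closed_span :: "(real \<Rightarrow> complex) set \<Rightarrow> (real \<Rightarrow> complex) set" where
  "closed_span S = {f \<in> L2. \<forall>\<epsilon>>0. \<exists>g\<in>cfun.span S. l2_norm (\<lambda>x. f x - g x) < \<epsilon>}"

text \<open>The support of a function that is only determined almost everywhere.\<close>

definition ess_support :: "(real \<Rightarrow> complex) \<Rightarrow> real set" where
  "ess_support f = - \<Union>{U. open U \<and> (AE x in lborel. x \<in> U \<longrightarrow> f x = 0)}"

definition fourier :: "(real \<Rightarrow> complex) \<Rightarrow> real \<Rightarrow> complex" where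
  "fourier f \<omega> = (LINT x|lborel. f x * cis (- (\<omega> * x)))"

text \<open>The case distinction on \<open>\<alpha> = 0\<close> is needed because \<open>\<alpha> - 1\<close> is truncated on \<^typ>\<open>nat\<close>, while the
  binomial coefficient with lower entry \<open>-1\<close> is zero.\<close>

definition mask :: "real \<Rightarrow> nat \<Rightarrow> nat \<Rightarrow> nat \<Rightarrow> real" where
  "mask \<mu> n m \<alpha> =
    (if m = 0 then (if \<alpha> \<le> 1 then 1 / 2 else 0)
     else if \<alpha> \<le> n + 1 then
       1 / 2 powr (real n + 1 + real m powr - \<mu>) *
         (real ((n + 1) choose \<alpha>) +
          4 * (2 powr (real m powr - \<mu>) - 1) *
            (if \<alpha> = 0 then 0 else real ((n - 1) choose (\<alpha> - 1))))
     else 0)"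

text \<open>The summation range contains the support of the mask, also for \<open>m = 0\<close>.\<close>

definition mask_symbol :: "real \<Rightarrow> nat \<Rightarrow> nat \<Rightarrow> complex \<Rightarrow> complex" where
  "mask_symbol \<mu> n m z = (\<Sum>\<alpha>\<le>n + 1. of_real (mask \<mu> n m \<alpha>) * z ^ \<alpha>)"

text \<open>The product over \<open>k \<ge> m\<close> is written with the shifted index \<open>m + k\<close>, \<open>k \<ge> 0\<close>. The three
  conditions determine the function up to a null set.\<close>

definition refinable_function :: "real \<Rightarrow> nat \<Rightarrow> nat \<Rightarrow> (real \<Rightarrow> complex) \<Rightarrow> bool" where
  "refinable_function \<mu> n m f \<longleftrightarrow>
     f \<in> L2 \<and> compact (ess_support f) \<and>
     (\<forall>\<omega>. fourier f \<omega> = (\<Prod>k. mask_symbol \<mu> n (m + k) (cis (- (\<omega> / 2 ^ (m + k + 1))))))"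

text \<open>In what follows \<open>\<phi> m\<close> is the generator at level \<open>m\<close>.\<close>

definition shifts :: "nat \<Rightarrow> (real \<Rightarrow> complex) \<Rightarrow> (real \<Rightarrow> complex) set" where
  "shifts m f = range (\<lambda>\<alpha>::int. \<lambda>x. f (x - of_int \<alpha> / 2 ^ m))"

definition V :: "(nat \<Rightarrow> real \<Rightarrow> complex) \<Rightarrow> nat \<Rightarrow> (real \<Rightarrow> complex) set" where
  "V \<phi> m = closed_span (shifts m (\<phi> m))"

definition W :: "(nat \<Rightarrow> real \<Rightarrow> complex) \<Rightarrow> nat \<Rightarrow> (real \<Rightarrow> complex) set" where
  "W \<phi> m = {f \<in> V \<phi> (m + 1). \<forall>g \<in> V \<phi> m. l2_inner f g = 0}"

definition generating_wavelet :: "(nat \<Rightarrow> real \<Rightarrow> complex) \<Rightarrow> nat \<Rightarrow> (real \<Rightarrow> complex) \<Rightarrow> bool" where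
  "generating_wavelet \<phi> m f \<longleftrightarrow> f \<in> W \<phi> m \<and> W \<phi> m = closed_span (shifts m f)"

text \<open>The length of the support is the length of the smallest interval containing it, that is, its
  diameter.\<close>

definition min_supported_wavelet :: "(nat \<Rightarrow> real \<Rightarrow> complex) \<Rightarrow> nat \<Rightarrow> (real \<Rightarrow> complex) \<Rightarrow> bool" where
  "min_supported_wavelet \<phi> m f \<longleftrightarrow>
     generating_wavelet \<phi> m f \<and> compact (ess_support f) \<and>
     (\<forall>h. generating_wavelet \<phi> m h \<and> compact (ess_support h) \<longrightarrow>
        diameter (ess_support f) \<le> diameter (ess_support h))"

definition gcoeff :: "(nat \<Rightarrow> real \<Rightarrow> complex) \<Rightarrow> nat \<Rightarrow> int \<Rightarrow> complex" where
  "gcoeff \<phi> m \<alpha> = (LINT x|lborel. \<phi> m x * \<phi> (m + 1) (x + of_int \<alpha> / 2 ^ (m + 1)))"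

text \<open>For compactly supported generators only finitely many coefficients are nonzero, so that the
  sum over all integers is a finite one.\<close>

definition psi :: "(nat \<Rightarrow> real \<Rightarrow> complex) \<Rightarrow> nat \<Rightarrow> real \<Rightarrow> complex" where
  "psi \<phi> m x =
     (\<Sum>\<^sub>\<infinity>\<alpha>::int. (-1) powi \<alpha> * gcoeff \<phi> m (\<alpha> - 1) * \<phi> (m + 1) (x - of_int \<alpha> / 2 ^ (m + 1)))"

end

theory Submission
  imports Defs "HOL-Probability.Probability" "HOL-Computational_Algebra.Fundamental_Theorem_Algebra"
begin

text \<open>Consider two consecutive refinement levels and write \<open>T\<close> for the translation by the lattice constant of
the finer one, so that \<open>T\<^sup>2\<close> belongs to the coarser one. Everything below happens in the time
domain and is about polynomials in \<open>T\<close> applied to compactly supported functions; the Fourier transform is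
only used to recognise the given generators.

\<^emph>\<open>The generators.\<close> Every mask polynomial is \<open>(1 + z) / 2\<close> times a factor with
nonnegative coefficients, value \<open>1\<close> at \<open>1\<close> and only negative real roots. The cascade
algorithm for these factors computes distribution functions of longer and longer sums of nonnegative random variables,
so it decreases and converges at every point. The difference quotients of the limits are bounded, compactly supported
and refinable, and their Fourier transforms are the prescribed products; by uniqueness of Fourier transforms they are
the given generators (\<open>refinable_function_eq_cascade_limit\<close>).

\<^emph>\<open>Roots.\<close> The autocorrelation symbol of a level arises from that of the next finer level by
multiplying with \<open>A(z) A(1/z)\<close>, where \<open>A\<close> is the mask polynomial, and averaging over the two
square roots of the argument. If \<open>Re w > 0\<close>, a polynomial with nonpositive roots is at least as large at
\<open>w\<close> as at \<open>- w\<close>, and the mask polynomial is strictly larger, hence the average cannot vanish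
off the negative half-line. Starting from the constant symbol of a box function and passing to the limit, all roots of
the autocorrelation symbols are nonpositive (\<open>limit_autocorr_nonzero\<close>). The wavelet has the symbol
\<open>- z G(- z)\<close>, where \<open>G(z) = A(1/z) \<Phi>(z)\<close> is the symbol of the coefficients
\<open>g\<close> and \<open>\<Phi>\<close> the autocorrelation symbol of the finer level. So its roots other than
\<open>0\<close> are positive, while those of the mask are negative (\<open>psi_symbol\<close>).

\<^emph>\<open>The wavelet space.\<close> The alternating signs make \<open>psi\<close> orthogonal to the coarse
generator. By Cramer's rule a determinant \<open>D(T\<^sup>2)\<close> maps the fine generator into the span of the
coarse translates of the coarse generator and of \<open>psi\<close>, and \<open>D\<close> is not zero because the mask
vanishes at \<open>- 1\<close> and the symbol of \<open>psi\<close> does not. In a closed translation invariant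
subspace one may divide by any nonzero polynomial in \<open>T\<close>, whatever its roots
(\<open>closed_span_divide_shift_poly\<close>). So the fine space is spanned by the coarse generator and
\<open>psi\<close>, and \<open>psi\<close> generates the wavelet space (\<open>W_eq_closed_span\<close>).

\<^emph>\<open>Minimality.\<close> No linear factor \<open>T - c\<close> with \<open>c \<noteq> 0\<close> in the
translation of its own level divides a generator: on finer levels \<open>c\<close> is replaced by a
\<open>2\<^sup>k\<close>-th root close to \<open>1\<close>, and there a functional with positive real part on the
generator gives a contradiction (\<open>not_shift_divisible_limit_cfun\<close>). No \<open>T\<^sup>2 - c\<close> with
\<open>c \<noteq> 0\<close> divides \<open>psi\<close>, since its symbol would vanish at both square roots of
\<open>c\<close>, which cannot both be positive. A compactly supported element \<open>h\<close> of the wavelet space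
satisfies a relation \<open>p(T\<^sup>2) h = r(T\<^sup>2) psi\<close> with \<open>p \<noteq> 0\<close>; dividing it by
the roots of \<open>p\<close> shows that \<open>h\<close> is a finite combination of translates of \<open>psi\<close>.
Each further translate lengthens the support, so a minimally supported wavelet is a multiple of a single translate.\<close>

section \<open>Translations and the Hilbert space of square-integrable functions\<close>

definition translate :: "real \<Rightarrow> (real \<Rightarrow> 'a) \<Rightarrow> real \<Rightarrow> 'a" where
  "translate s f = (\<lambda>x. f (x - s))"

lemma translate_apply [simp]: "translate s f x = f (x - s)"
  by (simp add: translate_def)

lemma translate_translate [simp]: "translate s (translate t f) = translate (s + t) f"
  by (simp add: translate_def fun_eq_iff algebra_simps)

lemma translate_0 [simp]: "translate 0 f = f"
  by (simp add: translate_def)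

lemma borel_measurable_translate [measurable]:
  fixes f :: "real \<Rightarrow> 'a::topological_space"
  shows "f \<in> borel_measurable borel \<Longrightarrow> translate s f \<in> borel_measurable borel"
  unfolding translate_def by (rule measurable_compose[of _ borel borel]) auto

lemma borel_measurable_cnj [measurable]:
  "f \<in> borel_measurable M \<Longrightarrow> (\<lambda>x. cnj (f x)) \<in> borel_measurable M"
  by (rule measurable_compose[OF _ borel_measurable_continuous_onI]) (auto intro: continuous_intros)

lemma integral_shift:
  fixes f :: "real \<Rightarrow> 'a::{banach, second_countable_topology}"
  shows "(LINT x|lborel. f (x - s)) = (LINT x|lborel. f x)"
  using lborel_integral_real_affine[of 1 f "-s"] by simp

lemma integrable_shift:
  fixes f :: "real \<Rightarrow> 'a::{banach, second_countable_topology}"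
  shows "integrable lborel (\<lambda>x. f (x - s)) \<longleftrightarrow> integrable lborel f"
  using lborel_integrable_real_affine_iff[of 1 f "-s"] by simp

lemma AE_shift:
  fixes P :: "real \<Rightarrow> bool"
  assumes "AE x in lborel. P x"
  shows "AE x in lborel. P (x - s)"
proof -
  from assms obtain N where N: "{x \<in> space lborel. \<not> P x} \<subseteq> N" "emeasure lborel N = 0" "N \<in> sets lborel"
    by (rule AE_E)
  have "AE x in lborel. x \<notin> N" using N by (intro AE_not_in) auto
  moreover have "Measurable.pred borel (\<lambda>x. x \<notin> N)" using N by measurable
  ultimately have "AE x in lborel. - s + 1 * x \<notin> N"
    by (intro AE_borel_affine) auto
  then show ?thesis
  proof (rule AE_mp, intro AE_I2 impI)
    fix x assume "- s + 1 * x \<notin> N"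
    then show "P (x - s)" using N(1) by auto
  qed
qed

definition norm_sq :: "(real \<Rightarrow> complex) \<Rightarrow> real" where
  "norm_sq f = (LINT x|lborel. (cmod (f x))\<^sup>2)"

lemma norm_sq_nonneg [simp]: "norm_sq f \<ge> 0"
  by (simp add: norm_sq_def)

lemma l2_norm_norm_sq: "l2_norm f = sqrt (norm_sq f)"
  by (simp add: l2_norm_def norm_sq_def)

lemma L2_measurable: "f \<in> L2 \<Longrightarrow> f \<in> borel_measurable borel"
  by (simp add: L2_def)

lemma L2_square_integrable: "f \<in> L2 \<Longrightarrow> integrable lborel (\<lambda>x. (cmod (f x))\<^sup>2)"
  by (simp add: L2_def)

lemma integrable_dominated:
  fixes f :: "real \<Rightarrow> 'a::{banach, second_countable_topology}" and g :: "real \<Rightarrow> real"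
  assumes "integrable lborel g" "f \<in> borel_measurable borel" "\<And>x. norm (f x) \<le> g x"
  shows "integrable lborel f"
proof (rule Bochner_Integration.integrable_bound[OF assms(1)])
  show "AE x in lborel. norm (f x) \<le> norm (g x)"
    using assms(3) by (intro AE_I2) (simp add: order_trans[OF _ abs_ge_self])
qed (use assms(2) in simp)

lemma cmod_add_sq_le: "(cmod (a + b))\<^sup>2 \<le> 2 * (cmod a)\<^sup>2 + 2 * (cmod b)\<^sup>2"
proof -
  have "(cmod (a + b))\<^sup>2 \<le> (cmod a + cmod b)\<^sup>2"
    by (intro power_mono norm_triangle_ineq) auto
  also have "\<dots> \<le> 2 * (cmod a)\<^sup>2 + 2 * (cmod b)\<^sup>2"
    using sum_squares_bound[of "cmod a" "cmod b"] by (simp add: power2_sum)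
  finally show ?thesis .
qed

lemma L2_add:
  assumes "f \<in> L2" "g \<in> L2"
  shows "(\<lambda>x. f x + g x) \<in> L2"
proof -
  note [measurable] = assms[THEN L2_measurable]
  have "integrable lborel (\<lambda>x. (cmod (f x + g x))\<^sup>2)"
  proof (rule integrable_dominated)
    show "integrable lborel (\<lambda>x. 2 * (cmod (f x))\<^sup>2 + 2 * (cmod (g x))\<^sup>2)"
      using assms[THEN L2_square_integrable] by simp
  qed (simp_all add: cmod_add_sq_le)
  then show ?thesis by (simp add: L2_def)
qed

lemma L2_of_real_bounded:
  assumes "integrable lborel f" "\<And>x. 0 \<le> f x" "\<And>x. f x \<le> c"
  shows "(\<lambda>x. complex_of_real (f x)) \<in> L2"
proof -
  have [measurable]: "f \<in> borel_measurable borel" using assms(1) by auto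
  have "integrable lborel (\<lambda>x. (f x)\<^sup>2)"
  proof (rule integrable_dominated)
    show "integrable lborel (\<lambda>x. c * f x)" using assms(1) by simp
    show "norm ((f x)\<^sup>2) \<le> c * f x" for x
      using assms(2,3)[of x] by (simp add: power2_eq_square mult_right_mono)
  qed simp
  then show ?thesis by (simp add: L2_def)
qed

lemma L2_cmult: "f \<in> L2 \<Longrightarrow> (\<lambda>x. c * f x) \<in> L2"
  by (auto simp: L2_def norm_mult power_mult_distrib intro!: borel_measurable_times)

lemma L2_zero: "(\<lambda>x. 0) \<in> L2"
  by (simp add: L2_def)

lemma L2_diff:
  assumes "f \<in> L2" "g \<in> L2"
  shows "(\<lambda>x. f x - g x) \<in> L2"
  using L2_add[OF assms(1) L2_cmult[OF assms(2), of "-1"]] by simp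

lemma L2_sum: "(\<And>i. i \<in> I \<Longrightarrow> f i \<in> L2) \<Longrightarrow> (\<lambda>x. \<Sum>i\<in>I. f i x) \<in> L2"
  by (induction I rule: infinite_finite_induct) (auto intro: L2_add L2_zero)

lemma L2_translate: "f \<in> L2 \<Longrightarrow> translate s f \<in> L2"
  using integrable_shift[of "\<lambda>x. (cmod (f x))\<^sup>2" s]
  by (auto simp: L2_def translate_def)

lemma norm_sq_translate [simp]: "norm_sq (translate s f) = norm_sq f"
  using integral_shift[of "\<lambda>x. (cmod (f x))\<^sup>2" s] by (simp add: norm_sq_def)

lemma norm_sq_add_le:
  assumes "f \<in> L2" "g \<in> L2"
  shows "norm_sq (\<lambda>x. f x + g x) \<le> 2 * norm_sq f + 2 * norm_sq g"
proof -
  have "norm_sq (\<lambda>x. f x + g x) \<le> (LINT x|lborel. 2 * (cmod (f x))\<^sup>2 + 2 * (cmod (g x))\<^sup>2)"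
    unfolding norm_sq_def
    using L2_square_integrable[OF L2_add[OF assms]] assms[THEN L2_square_integrable]
    by (intro integral_mono) (auto simp: cmod_add_sq_le)
  also have "\<dots> = 2 * norm_sq f + 2 * norm_sq g"
    using assms[THEN L2_square_integrable] by (simp add: norm_sq_def)
  finally show ?thesis .
qed

lemma norm_sq_cmult: "norm_sq (\<lambda>x. c * f x) = (cmod c)\<^sup>2 * norm_sq f"
  by (simp add: norm_sq_def norm_mult power_mult_distrib)

lemma norm_sq_cong_AE:
  assumes "f \<in> L2" "g \<in> L2" "AE x in lborel. f x = g x"
  shows "norm_sq f = norm_sq g"
  unfolding norm_sq_def using assms L2_measurable
  by (intro integral_cong_AE) (auto simp: borel_measurable_power)

lemma norm_sq_eq_0:
  assumes "f \<in> L2" "norm_sq f = 0"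
  shows "AE x in lborel. f x = 0"
  using integral_nonneg_eq_0_iff_AE[OF L2_square_integrable[OF assms(1)]] assms(2)
  by (auto simp: norm_sq_def)

lemma L2_inner_integrable:
  assumes "f \<in> L2" "g \<in> L2"
  shows "integrable lborel (\<lambda>x. f x * cnj (g x))"
proof -
  note [measurable] = assms[THEN L2_measurable]
  have "cmod (f x * cnj (g x)) \<le> (cmod (f x))\<^sup>2 + (cmod (g x))\<^sup>2" for x
  proof -
    have "2 * (cmod (f x) * cmod (g x)) \<le> (cmod (f x))\<^sup>2 + (cmod (g x))\<^sup>2"
      using sum_squares_bound[of "cmod (f x)" "cmod (g x)"] by simp
    moreover have "cmod (f x) * cmod (g x) \<ge> 0" by simp
    ultimately show ?thesis unfolding norm_mult complex_mod_cnj by linarith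
  qed
  note pointwise = this
  show ?thesis
    by (rule integrable_dominated[of "\<lambda>x. (cmod (f x))\<^sup>2 + (cmod (g x))\<^sup>2"])
       (use pointwise assms[THEN L2_square_integrable] in simp_all)
qed

lemma l2_inner_add_left:
  assumes "f \<in> L2" "g \<in> L2" "k \<in> L2"
  shows "l2_inner (\<lambda>x. f x + g x) k = l2_inner f k + l2_inner g k"
  using assms by (simp add: l2_inner_def distrib_right L2_inner_integrable)

lemma l2_inner_cmult_left: "l2_inner (\<lambda>x. c * f x) k = c * l2_inner f k"
  by (simp add: l2_inner_def mult.assoc)

lemma l2_inner_cnj: "l2_inner f g = cnj (l2_inner g f)"
  using Bochner_Integration.integral_cnj[of lborel "\<lambda>x. g x * cnj (f x)"] by (simp add: l2_inner_def mult.commute)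

lemma l2_inner_diff_left:
  assumes "f \<in> L2" "g \<in> L2" "k \<in> L2"
  shows "l2_inner (\<lambda>x. f x - g x) k = l2_inner f k - l2_inner g k"
  using assms by (simp add: l2_inner_def left_diff_distrib L2_inner_integrable)

lemma l2_inner_sum_left:
  assumes "\<And>i. i \<in> I \<Longrightarrow> f i \<in> L2" "k \<in> L2"
  shows "l2_inner (\<lambda>x. \<Sum>i\<in>I. f i x) k = (\<Sum>i\<in>I. l2_inner (f i) k)"
  using assms by (simp add: l2_inner_def sum_distrib_right L2_inner_integrable)

lemma l2_inner_zero [simp]: "l2_inner (\<lambda>x. 0) k = 0" "l2_inner k (\<lambda>x. 0) = 0"
  by (auto simp: l2_inner_def)

lemma l2_inner_add_right:
  assumes "f \<in> L2" "g \<in> L2" "k \<in> L2"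
  shows "l2_inner k (\<lambda>x. f x + g x) = l2_inner k f + l2_inner k g"
  using l2_inner_add_left[OF assms] by (metis complex_cnj_add l2_inner_cnj)

lemma l2_inner_cmult_right: "l2_inner k (\<lambda>x. c * f x) = cnj c * l2_inner k f"
  using l2_inner_cmult_left[of c f k] by (metis complex_cnj_mult l2_inner_cnj)

lemma l2_inner_diff_right:
  assumes "f \<in> L2" "g \<in> L2" "k \<in> L2"
  shows "l2_inner k (\<lambda>x. f x - g x) = l2_inner k f - l2_inner k g"
  using l2_inner_diff_left[OF assms] by (metis complex_cnj_diff l2_inner_cnj)

lemma l2_inner_translate [simp]: "l2_inner (translate s f) (translate s g) = l2_inner f g"
  using integral_shift[of "\<lambda>x. f x * cnj (g x)" s] by (simp add: l2_inner_def)

lemma l2_inner_self: "l2_inner f f = of_real (norm_sq f)"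
proof -
  have "f x * cnj (f x) = of_real ((cmod (f x))\<^sup>2)" for x
    by (metis complex_norm_square)
  then show ?thesis by (simp add: l2_inner_def norm_sq_def del: of_real_power)
qed

lemma l2_inner_cong_AE:
  assumes "f \<in> L2" "f' \<in> L2" "g \<in> L2" "g' \<in> L2"
    "AE x in lborel. f x = f' x" "AE x in lborel. g x = g' x"
  shows "l2_inner f g = l2_inner f' g'"
proof -
  note [measurable] = assms(1-4)[THEN L2_measurable]
  have "AE x in lborel. f x * cnj (g x) = f' x * cnj (g' x)"
    using assms(5,6) by eventually_elim auto
  then show ?thesis unfolding l2_inner_def by (intro integral_cong_AE) auto
qed

text \<open>A weighted Cauchy--Schwarz inequality without square roots. For fixed \<open>f\<close> a large weight \<open>t\<close>
  makes the first term small, and then a small norm of \<open>g\<close> the second.\<close>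

lemma l2_inner_weighted_bound:
  assumes "f \<in> L2" "g \<in> L2" "t > 0"
  shows "cmod (l2_inner f g) \<le> norm_sq f / t + t * norm_sq g"
proof -
  note [measurable] = assms(1,2)[THEN L2_measurable]
  note sq = assms(1,2)[THEN L2_square_integrable]
  have pointwise: "cmod (f x * cnj (g x)) \<le> (cmod (f x))\<^sup>2 / t + t * (cmod (g x))\<^sup>2" for x
  proof -
    have "2 * (cmod (f x) / sqrt t) * (sqrt t * cmod (g x))
        \<le> (cmod (f x) / sqrt t)\<^sup>2 + (sqrt t * cmod (g x))\<^sup>2"
      by (rule sum_squares_bound)
    moreover have "(cmod (f x) / sqrt t) * (sqrt t * cmod (g x)) = cmod (f x) * cmod (g x)"
      using assms(3) by simp
    ultimately have "2 * (cmod (f x) * cmod (g x)) \<le> (cmod (f x))\<^sup>2 / t + t * (cmod (g x))\<^sup>2"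
      using assms(3) by (simp add: power_divide power_mult_distrib)
    moreover have "cmod (f x) * cmod (g x) \<ge> 0" by simp
    ultimately show ?thesis unfolding norm_mult complex_mod_cnj by linarith
  qed
  have "cmod (l2_inner f g) \<le> (LINT x|lborel. cmod (f x * cnj (g x)))"
    unfolding l2_inner_def by (rule integral_norm_bound)
  also have "\<dots> \<le> (LINT x|lborel. (cmod (f x))\<^sup>2 / t + t * (cmod (g x))\<^sup>2)"
    using sq L2_inner_integrable[OF assms(1,2)] pointwise
    by (intro integral_mono) auto
  also have "\<dots> = norm_sq f / t + t * norm_sq g"
    using sq by (simp add: norm_sq_def)
  finally show ?thesis .
qed

section \<open>Closed linear spans\<close>

lemma cfun_span_L2:
  assumes "S \<subseteq> L2" "f \<in> cfun.span S"
  shows "f \<in> L2"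
  using assms(2)
proof (induction rule: cfun.span_induct_alt)
  case base
  then show ?case using L2_zero by (simp add: zero_fun_def)
next
  case (step c x y)
  then show ?case
    using L2_add[OF L2_cmult[of x c] ] assms(1) by (auto simp: plus_fun_def)
qed

lemma span_add: "f \<in> cfun.span S \<Longrightarrow> g \<in> cfun.span S \<Longrightarrow> (\<lambda>x. f x + g x) \<in> cfun.span S"
  using cfun.span_add[of f S g] by (simp add: plus_fun_def)

lemma span_cmult: "f \<in> cfun.span S \<Longrightarrow> (\<lambda>x. c * f x) \<in> cfun.span S"
  using cfun.span_scale[of f S c] by simp

lemma span_zero: "(\<lambda>x. 0) \<in> cfun.span S"
  using cfun.span_zero[of S] by (simp add: zero_fun_def)

lemma closed_span_iff:
  "f \<in> closed_span S \<longleftrightarrow>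
    f \<in> L2 \<and> (\<forall>\<epsilon>>0. \<exists>g\<in>cfun.span S. norm_sq (\<lambda>x. f x - g x) < \<epsilon>)"
proof -
  have "(\<forall>\<epsilon>>0. \<exists>g\<in>cfun.span S. l2_norm (\<lambda>x. f x - g x) < \<epsilon>) \<longleftrightarrow>
        (\<forall>\<epsilon>>0. \<exists>g\<in>cfun.span S. norm_sq (\<lambda>x. f x - g x) < \<epsilon>)" (is "?A \<longleftrightarrow> ?B")
  proof
    assume A: ?A
    show ?B
    proof (intro allI impI)
      fix \<epsilon> :: real assume "\<epsilon> > 0"
      then have "sqrt \<epsilon> > 0" by simp
      with A obtain g where "g \<in> cfun.span S" "sqrt (norm_sq (\<lambda>x. f x - g x)) < sqrt \<epsilon>"
        unfolding l2_norm_norm_sq by blast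
      then show "\<exists>g\<in>cfun.span S. norm_sq (\<lambda>x. f x - g x) < \<epsilon>" by auto
    qed
  next
    assume B: ?B
    show ?A
    proof (intro allI impI)
      fix \<epsilon> :: real assume e: "\<epsilon> > 0"
      then have "\<epsilon>\<^sup>2 > 0" by simp
      with B obtain g where g: "g \<in> cfun.span S" "norm_sq (\<lambda>x. f x - g x) < \<epsilon>\<^sup>2"
        by blast
      have "l2_norm (\<lambda>x. f x - g x) < \<epsilon>"
        using real_sqrt_less_mono[OF g(2)] e by (simp add: l2_norm_norm_sq)
      with g(1) show "\<exists>g\<in>cfun.span S. l2_norm (\<lambda>x. f x - g x) < \<epsilon>" by blast
    qed
  qed
  then show ?thesis by (simp add: closed_span_def)
qed

lemma closed_span_L2: "f \<in> closed_span S \<Longrightarrow> f \<in> L2"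
  by (simp add: closed_span_def)

lemma closed_span_base:
  assumes "f \<in> S" "f \<in> L2"
  shows "f \<in> closed_span S"
  unfolding closed_span_iff
proof (intro conjI allI impI)
  fix \<epsilon> :: real assume "\<epsilon> > 0"
  with assms show "\<exists>g\<in>cfun.span S. norm_sq (\<lambda>x. f x - g x) < \<epsilon>"
    by (intro bexI[of _ f] cfun.span_base) (auto simp: norm_sq_def)
qed (use assms in auto)

lemma closed_span_zero: "(\<lambda>x. 0) \<in> closed_span S"
  unfolding closed_span_iff
proof (intro conjI allI impI L2_zero)
  fix \<epsilon> :: real assume "\<epsilon> > 0"
  then show "\<exists>g\<in>cfun.span S. norm_sq (\<lambda>x. 0 - g x) < \<epsilon>"
    by (intro bexI[OF _ span_zero]) (auto simp: norm_sq_def)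
qed

lemma closed_span_add:
  assumes S: "S \<subseteq> L2" and f: "f \<in> closed_span S" and g: "g \<in> closed_span S"
  shows "(\<lambda>x. f x + g x) \<in> closed_span S"
  unfolding closed_span_iff
proof (intro conjI allI impI)
  show "(\<lambda>x. f x + g x) \<in> L2" using f g by (intro L2_add closed_span_L2)
  fix \<epsilon> :: real assume "\<epsilon> > 0"
  then have "\<epsilon> / 4 > 0" by simp
  with f g obtain u v where u: "u \<in> cfun.span S" "norm_sq (\<lambda>x. f x - u x) < \<epsilon> / 4"
    and v: "v \<in> cfun.span S" "norm_sq (\<lambda>x. g x - v x) < \<epsilon> / 4"
    unfolding closed_span_iff by meson
  have "norm_sq (\<lambda>x. (f x - u x) + (g x - v x)) \<le> 2 * norm_sq (\<lambda>x. f x - u x) + 2 * norm_sq (\<lambda>x. g x - v x)"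
    using f g u v S by (intro norm_sq_add_le L2_diff closed_span_L2 cfun_span_L2)
  also have "\<dots> < \<epsilon>" using u v by simp
  finally show "\<exists>w\<in>cfun.span S. norm_sq (\<lambda>x. f x + g x - w x) < \<epsilon>"
    by (intro bexI[OF _ span_add[OF u(1) v(1)]]) (simp add: algebra_simps)
qed

lemma closed_span_cmult:
  assumes f: "f \<in> closed_span S"
  shows "(\<lambda>x. c * f x) \<in> closed_span S"
  unfolding closed_span_iff
proof (intro conjI allI impI)
  show "(\<lambda>x. c * f x) \<in> L2" using f by (intro L2_cmult closed_span_L2)
  fix \<epsilon> :: real assume "\<epsilon> > 0"
  then have "\<epsilon> / ((cmod c)\<^sup>2 + 1) > 0"
    by (intro divide_pos_pos) (auto intro: add_nonneg_pos)
  with f obtain u where u: "u \<in> cfun.span S" "norm_sq (\<lambda>x. f x - u x) < \<epsilon> / ((cmod c)\<^sup>2 + 1)"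
    unfolding closed_span_iff by meson
  have "norm_sq (\<lambda>x. c * (f x - u x)) \<le> ((cmod c)\<^sup>2 + 1) * norm_sq (\<lambda>x. f x - u x)"
    unfolding norm_sq_cmult by (intro mult_right_mono) auto
  also have "\<dots> < \<epsilon>"
    using u(2) by (simp add: pos_less_divide_eq mult.commute add_nonneg_pos)
  finally show "\<exists>w\<in>cfun.span S. norm_sq (\<lambda>x. c * f x - w x) < \<epsilon>"
    by (intro bexI[OF _ span_cmult[OF u(1), of c]]) (simp add: algebra_simps)
qed

lemma closed_span_diff:
  assumes "S \<subseteq> L2" "f \<in> closed_span S" "g \<in> closed_span S"
  shows "(\<lambda>x. f x - g x) \<in> closed_span S"
  using closed_span_add[OF assms(1,2) closed_span_cmult[OF assms(3), of "-1"]] by simp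

lemma closed_span_sum:
  assumes "S \<subseteq> L2" "\<And>i. i \<in> I \<Longrightarrow> f i \<in> closed_span S"
  shows "(\<lambda>x. \<Sum>i\<in>I. f i x) \<in> closed_span S"
  using assms(2)
  by (induction I rule: infinite_finite_induct) (auto simp: closed_span_zero closed_span_add[OF assms(1)])

lemma closed_span_limit:
  assumes S: "S \<subseteq> L2" and f: "f \<in> L2"
    and approx: "\<And>\<epsilon>. \<epsilon> > 0 \<Longrightarrow> \<exists>g\<in>closed_span S. norm_sq (\<lambda>x. f x - g x) < \<epsilon>"
  shows "f \<in> closed_span S"
  unfolding closed_span_iff
proof (intro conjI allI impI f)
  fix \<epsilon> :: real assume "\<epsilon> > 0"
  then have e: "\<epsilon> / 4 > 0" by simp
  with approx obtain g where g: "g \<in> closed_span S" "norm_sq (\<lambda>x. f x - g x) < \<epsilon> / 4"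
    by blast
  then obtain u where u: "u \<in> cfun.span S" "norm_sq (\<lambda>x. g x - u x) < \<epsilon> / 4"
    using e unfolding closed_span_iff by meson
  have "norm_sq (\<lambda>x. (f x - g x) + (g x - u x)) \<le> 2 * norm_sq (\<lambda>x. f x - g x) + 2 * norm_sq (\<lambda>x. g x - u x)"
    using f closed_span_L2[OF g(1)] cfun_span_L2[OF S u(1)] by (intro norm_sq_add_le L2_diff)
  also have "\<dots> < \<epsilon>" using u g by simp
  finally show "\<exists>w\<in>cfun.span S. norm_sq (\<lambda>x. f x - w x) < \<epsilon>"
    by (intro bexI[OF _ u(1)]) (simp add: algebra_simps)
qed

lemma closed_span_cong_AE:
  assumes "S \<subseteq> L2" "f \<in> closed_span S" "g \<in> L2" "AE x in lborel. f x = g x"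
  shows "g \<in> closed_span S"
proof (rule closed_span_limit[OF assms(1,3)])
  fix \<epsilon> :: real assume "\<epsilon> > 0"
  have "norm_sq (\<lambda>x. g x - f x) = norm_sq (\<lambda>x. 0)"
    using assms(3,4) closed_span_L2[OF assms(2)] by (intro norm_sq_cong_AE L2_diff L2_zero) auto
  also have "\<dots> < \<epsilon>" using \<open>\<epsilon> > 0\<close> by (simp add: norm_sq_def)
  finally show "\<exists>h\<in>closed_span S. norm_sq (\<lambda>x. g x - h x) < \<epsilon>"
    using assms(2) by blast
qed

lemma closed_span_mono:
  assumes S: "S \<subseteq> L2" "S' \<subseteq> L2" and sub: "S \<subseteq> closed_span S'"
  shows "closed_span S \<subseteq> closed_span S'"
proof
  have span: "g \<in> closed_span S'" if "g \<in> cfun.span S" for g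
    using that
  proof (induction rule: cfun.span_induct_alt)
    case base
    then show ?case using closed_span_zero by (simp add: zero_fun_def)
  next
    case (step c x y)
    then show ?case
      using closed_span_add[OF S(2) closed_span_cmult[of x S' c]] sub by (auto simp: plus_fun_def)
  qed
  fix f assume f: "f \<in> closed_span S"
  show "f \<in> closed_span S'"
  proof (rule closed_span_limit[OF S(2) closed_span_L2[OF f]])
    fix \<epsilon> :: real assume "\<epsilon> > 0"
    then show "\<exists>g\<in>closed_span S'. norm_sq (\<lambda>x. f x - g x) < \<epsilon>"
      using f span unfolding closed_span_iff[of f S] by blast
  qed
qed

lemma span_translate:
  assumes "f \<in> cfun.span S" "\<And>g. g \<in> S \<Longrightarrow> translate s g \<in> S"
  shows "translate s f \<in> cfun.span S"
  using assms(1)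
proof (induction rule: cfun.span_induct_alt)
  case base
  then show ?case using span_zero by (simp add: zero_fun_def translate_def)
next
  case (step c x y)
  have "(\<lambda>t. c * translate s x t + translate s y t) \<in> cfun.span S"
    using step.IH cfun.span_base[OF assms(2)[OF step.hyps(1)]] by (intro span_add span_cmult)
  then show ?case by (simp add: translate_def plus_fun_def)
qed

lemma closed_span_translate:
  assumes f: "f \<in> closed_span S" and inv: "\<And>g. g \<in> S \<Longrightarrow> translate s g \<in> S"
  shows "translate s f \<in> closed_span S"
  unfolding closed_span_iff
proof (intro conjI allI impI)
  show "translate s f \<in> L2" using f by (intro L2_translate closed_span_L2)
  fix \<epsilon> :: real assume "\<epsilon> > 0"
  with f obtain g where g: "g \<in> cfun.span S" "norm_sq (\<lambda>x. f x - g x) < \<epsilon>"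
    unfolding closed_span_iff by meson
  have "norm_sq (\<lambda>x. translate s f x - translate s g x) = norm_sq (\<lambda>x. f x - g x)"
    using norm_sq_translate[of s "\<lambda>x. f x - g x"] by (simp add: translate_def)
  then have less: "norm_sq (\<lambda>x. translate s f x - translate s g x) < \<epsilon>"
    using g(2) by simp
  have mem: "translate s g \<in> cfun.span S"
    using g(1) inv by (rule span_translate)
  show "\<exists>w\<in>cfun.span S. norm_sq (\<lambda>x. translate s f x - w x) < \<epsilon>"
    by (rule bexI[of "\<lambda>g. norm_sq (\<lambda>x. translate s f x - g x) < \<epsilon>", OF less mem])
qed

lemma orthogonal_closed_span:
  assumes S: "S \<subseteq> L2" and f: "f \<in> L2" and orth: "\<And>g. g \<in> S \<Longrightarrow> l2_inner f g = 0"
    and h: "h \<in> closed_span S"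
  shows "l2_inner f h = 0"
proof -
  have "g \<in> L2 \<and> l2_inner f g = 0" if "g \<in> cfun.span S" for g
    using that
  proof (induction rule: cfun.span_induct_alt)
    case base
    then show ?case by (simp add: zero_fun_def L2_zero)
  next
    case (step c x y)
    then have "x \<in> L2" "y \<in> L2" using S by auto
    then show ?case
      using step orth L2_add[OF L2_cmult[of x c], of y]
        l2_inner_add_right[OF L2_cmult[of x c] _ f, of y]
      by (simp add: plus_fun_def l2_inner_cmult_right)
  qed
  note span = conjunct2[OF this]
  have "cmod (l2_inner f h) \<le> \<epsilon>" if "\<epsilon> > 0" for \<epsilon> :: real
  proof -
    define t where "t = (norm_sq f + 1) / (\<epsilon> / 2)"
    have t: "t > 0" using that by (simp add: t_def add_nonneg_pos)
    then have "\<epsilon> / 2 / t > 0" using that by simp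
    then obtain g where g: "g \<in> cfun.span S" "norm_sq (\<lambda>x. h x - g x) < \<epsilon> / 2 / t"
      using h unfolding closed_span_iff by meson
    have gL: "g \<in> L2" using g S cfun_span_L2 by auto
    have hL: "h \<in> L2" using h closed_span_L2 by auto
    have "l2_inner f h = l2_inner f (\<lambda>x. h x - g x)"
      using l2_inner_diff_right[OF hL gL f] span[OF g(1)] by simp
    also have "cmod \<dots> \<le> norm_sq f / t + t * norm_sq (\<lambda>x. h x - g x)"
      using f gL hL t by (intro l2_inner_weighted_bound L2_diff)
    also have "norm_sq f / t \<le> \<epsilon> / 2"
      using that t by (simp add: t_def field_simps add_nonneg_pos)
    also have "t * norm_sq (\<lambda>x. h x - g x) \<le> \<epsilon> / 2"
      using g(2) t by (simp add: field_simps)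
    finally show ?thesis by simp
  qed
  then have "cmod (l2_inner f h) \<le> 0" by (rule field_le_epsilon) simp
  then show ?thesis by simp
qed

text \<open>This is how equations between elements of a closed span are proved: by comparing inner products with the generators.\<close>

lemma closed_span_orthogonal_zero:
  assumes "S \<subseteq> L2" "f \<in> closed_span S" "\<And>g. g \<in> S \<Longrightarrow> l2_inner f g = 0"
  shows "AE x in lborel. f x = 0"
proof -
  have "l2_inner f f = 0"
    by (rule orthogonal_closed_span[OF assms(1) closed_span_L2[OF assms(2)] assms(3) assms(2)])
  then show ?thesis
    using assms(2) norm_sq_eq_0 closed_span_L2 by (auto simp: l2_inner_self)
qed

section \<open>Polynomials in a translation operator\<close>

text \<open>The action of \<open>p(T)\<close> on \<open>f\<close>, where \<open>T\<close> is the translation by \<open>s\<close>.\<close>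

definition shift_poly :: "real \<Rightarrow> 'a::comm_ring_1 poly \<Rightarrow> (real \<Rightarrow> 'a) \<Rightarrow> real \<Rightarrow> 'a" where
  "shift_poly s p f x = (\<Sum>i\<le>degree p. coeff p i * f (x - real i * s))"

lemma shift_poly_altdef:
  assumes "degree p \<le> n"
  shows "shift_poly s p f x = (\<Sum>i\<le>n. coeff p i * f (x - real i * s))"
  unfolding shift_poly_def using assms
  by (intro sum.mono_neutral_left) (auto simp: coeff_eq_0)

lemma shift_poly_0 [simp]: "shift_poly s 0 f = (\<lambda>x. 0)"
  by (simp add: shift_poly_def fun_eq_iff)

text \<open>The recursion that Horner's scheme suggests; the ring laws follow from it by induction on the polynomial.\<close>

lemma shift_poly_pCons: "shift_poly s (pCons a p) f x = a * f x + shift_poly s p f (x - s)"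
proof -
  have "shift_poly s (pCons a p) f x = (\<Sum>i\<le>Suc (degree p). coeff (pCons a p) i * f (x - real i * s))"
    by (rule shift_poly_altdef) (simp add: degree_pCons_le)
  also have "\<dots> = a * f x + (\<Sum>i\<le>degree p. coeff p i * f (x - s - real i * s))"
    by (simp add: sum.atMost_Suc_shift algebra_simps del: sum.atMost_Suc)
  finally show ?thesis by (simp add: shift_poly_def)
qed

lemma shift_poly_const [simp]: "shift_poly s [:a:] f = (\<lambda>x. a * f x)"
  by (simp add: shift_poly_pCons fun_eq_iff)

lemma shift_poly_add: "shift_poly s (p + q) f x = shift_poly s p f x + shift_poly s q f x"
proof -
  define n where "n = max (degree p) (degree q)"
  have "degree p \<le> n" "degree q \<le> n" "degree (p + q) \<le> n"
    by (auto simp: n_def degree_add_le)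
  then show ?thesis by (simp add: shift_poly_altdef distrib_right sum.distrib)
qed

lemma shift_poly_smult: "shift_poly s (smult c p) f x = c * shift_poly s p f x"
proof -
  have "degree (smult c p) \<le> degree p" by (rule degree_smult_le)
  then show ?thesis by (simp add: shift_poly_altdef[of _ "degree p"] sum_distrib_left mult.assoc)
qed

lemma shift_poly_diff: "shift_poly s (p - q) f x = shift_poly s p f x - shift_poly s q f x"
  using shift_poly_add[of s "p - q" q f x] by simp

lemma shift_poly_mult: "shift_poly s (p * q) f = shift_poly s p (shift_poly s q f)"
proof (induction p)
  case (pCons a p)
  show ?case
    by (simp add: fun_eq_iff shift_poly_add shift_poly_smult shift_poly_pCons pCons.IH)
qed simp

lemma shift_poly_translate: "shift_poly s p (translate t f) = translate t (shift_poly s p f)"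
  by (simp add: shift_poly_def fun_eq_iff algebra_simps)

lemma shift_poly_fun_add: "shift_poly s p (\<lambda>x. f x + g x) x = shift_poly s p f x + shift_poly s p g x"
  by (simp add: shift_poly_def distrib_left sum.distrib)

lemma shift_poly_fun_diff: "shift_poly s p (\<lambda>x. f x - g x) x = shift_poly s p f x - shift_poly s p g x"
  by (simp add: shift_poly_def right_diff_distrib sum_subtractf)

lemma shift_poly_fun_cmult: "shift_poly s p (\<lambda>x. c * f x) x = c * shift_poly s p f x"
  by (simp add: shift_poly_def sum_distrib_left algebra_simps)

lemma shift_poly_pcompose_square: "shift_poly s (pcompose p (monom 1 2)) f = shift_poly (2 * s) p f"
proof (induction p)
  case (pCons a p)
  have square: "shift_poly s (monom 1 2 * p') f x = shift_poly s p' f (x - 2 * s)" for p' x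
    by (simp add: monom_altdef power2_eq_square shift_poly_pCons shift_poly_mult shift_poly_translate)
  show ?case
    by (simp add: fun_eq_iff pcompose_pCons shift_poly_add square pCons.IH)
       (simp add: shift_poly_pCons)
qed simp

lemma shift_poly_of_real:
  "shift_poly s (map_poly of_real p) (\<lambda>x. of_real (f x)) x =
    (of_real (shift_poly s p f x) :: 'a::{comm_ring_1, real_algebra_1})"
proof -
  have "degree (map_poly (of_real :: real \<Rightarrow> 'a) p) \<le> degree p"
    by (rule map_poly_degree_leq)
  from shift_poly_altdef[OF this, of s "\<lambda>x. of_real (f x)" x] show ?thesis
    by (simp add: coeff_map_poly shift_poly_def)
qed

lemma shift_poly_shift_left:
  "shift_poly s [:- c, 1:] f x = f (x - s) - c * f x"
  by (simp add: shift_poly_pCons)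

lemma poly_nonneg_coeffs_mult:
  fixes p q :: "real poly"
  assumes "\<And>i. coeff p i \<ge> 0" "\<And>i. coeff q i \<ge> 0"
  shows "coeff (p * q) i \<ge> 0"
  unfolding coeff_mult using assms by (intro sum_nonneg mult_nonneg_nonneg) auto

section \<open>Fourier transforms of translates\<close>

lemma fourier_integrable:
  assumes "integrable lborel f"
  shows "integrable lborel (\<lambda>x. f x * cis (- (\<omega> * x)))"
proof (rule Bochner_Integration.integrable_bound[OF assms])
  have [measurable]: "f \<in> borel_measurable borel"
    using assms by auto
  have "(\<lambda>x. cis (- (\<omega> * x))) \<in> borel_measurable borel"
    by (intro borel_measurable_continuous_onI continuous_intros)
  then show "(\<lambda>x. f x * cis (- (\<omega> * x))) \<in> borel_measurable lborel" by simp
qed (simp add: norm_mult)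

lemma fourier_shift: "fourier (\<lambda>x. f (x - s)) \<omega> = cis (- (\<omega> * s)) * fourier f \<omega>"
proof -
  have "fourier (\<lambda>x. f (x - s)) \<omega> = (LINT x|lborel. f (x - s) * cis (- (\<omega> * (x - s))) * cis (- (\<omega> * s)))"
    unfolding fourier_def by (simp add: mult.assoc cis_mult algebra_simps)
  also have "\<dots> = (LINT x|lborel. f x * cis (- (\<omega> * x)) * cis (- (\<omega> * s)))"
    by (rule integral_shift)
  finally show ?thesis by (simp add: fourier_def)
qed

lemma fourier_shift_poly:
  assumes "integrable lborel f"
  shows "fourier (shift_poly s p f) \<omega> = poly p (cis (- (\<omega> * s))) * fourier f \<omega>"
proof -
  have int: "integrable lborel (\<lambda>x. f (x - t) * cis (- (\<omega> * x)))" for t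
    using assms by (intro fourier_integrable) (simp add: integrable_shift)
  have "fourier (shift_poly s p f) \<omega> =
      (\<Sum>i\<le>degree p. coeff p i * fourier (\<lambda>x. f (x - real i * s)) \<omega>)"
    unfolding fourier_def shift_poly_def using int
    by (simp add: sum_distrib_right mult.assoc)
  also have "\<dots> = (\<Sum>i\<le>degree p. coeff p i * cis (- (\<omega> * s)) ^ i) * fourier f \<omega>"
  proof -
    have "cis (- (\<omega> * (real i * s))) = cis (- (\<omega> * s)) ^ i" for i
      by (simp add: Complex.DeMoivre algebra_simps)
    then show ?thesis by (simp add: fourier_shift sum_distrib_right mult.assoc)
  qed
  finally show ?thesis by (simp add: poly_altdef)
qed

lemma norm_cis_minus_1_le: "cmod (cis a - 1) \<le> \<bar>a\<bar>"
proof -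
  have "cmod (cis a - 1) = 2 * \<bar>sin (a / 2)\<bar>"
    by (simp add: cis_conv_exp dist_exp_i_1)
  then show ?thesis using abs_sin_x_le_abs_x[of "a / 2"] by simp
qed

lemma norm_cis_power_minus_1_le: "cmod (cis a ^ i - 1) \<le> real i * \<bar>a\<bar>"
  using norm_cis_minus_1_le[of "real i * a"] by (simp add: Complex.DeMoivre abs_mult)

section \<open>The cascade algorithm for factored masks\<close>

abbreviation cpoly :: "real poly \<Rightarrow> complex poly" where
  "cpoly \<equiv> map_poly complex_of_real"

lemma poly_cpoly_of_real: "poly (cpoly p) (of_real x) = of_real (poly p x)"
  by (simp add: poly_altdef degree_map_poly coeff_map_poly)

text \<open>The properties of the masks that the argument uses: \<open>q k\<close> is the mask of level \<open>k\<close> without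
  one factor \<open>(1 + z) / 2\<close>.\<close>

locale hurwitz_masks =
  fixes q :: "nat \<Rightarrow> real poly" and N :: nat
  assumes q_nonneg: "coeff (q k) i \<ge> 0"
    and q_one: "poly (q k) 1 = 1"
    and q_degree: "degree (q k) \<le> N"
    and q_roots: "poly (cpoly (q k)) z = 0 \<Longrightarrow> Im z = 0 \<and> Re z < 0"
begin

definition mask_poly :: "nat \<Rightarrow> real poly" where
  "mask_poly k = [:1/2, 1/2:] * q k"

lemma q_sum: "(\<Sum>i\<le>degree (q k). coeff (q k) i) = 1"
  using q_one[of k] by (simp add: poly_altdef)

lemma mask_poly_nonneg: "coeff (mask_poly k) i \<ge> 0"
  unfolding mask_poly_def
  by (rule poly_nonneg_coeffs_mult) (auto simp: q_nonneg coeff_pCons split: nat.split)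

lemma mask_poly_one: "poly (mask_poly k) 1 = 1"
  by (simp add: mask_poly_def q_one)

lemma mask_poly_degree: "degree (mask_poly k) \<le> N + 1"
  unfolding mask_poly_def
  by (rule order.trans[OF degree_mult_le]) (use q_degree[of k] in simp)

lemma mask_poly_sum: "(\<Sum>i\<le>degree (mask_poly k). coeff (mask_poly k) i) = 1"
  using mask_poly_one[of k] by (simp add: poly_altdef)

lemma shift_poly_mono:
  assumes "\<And>i. coeff p i \<ge> 0" "\<And>x. f x \<le> (g x :: real)"
  shows "shift_poly s p f x \<le> shift_poly s p g x"
  unfolding shift_poly_def using assms by (intro sum_mono mult_left_mono) auto

lemma shift_poly_q_const: "shift_poly s (q k) (\<lambda>x. c) x = c"
  using q_sum[of k] by (simp add: shift_poly_def flip: sum_distrib_right)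

text \<open>The first argument is the number of cascade steps, the second the coarsest level. The value is the distribution
  function of a sum of independent random variables on the grids of the levels \<open>m + 1, \<dots>, m + j\<close>
  whose distributions are given by the coefficients of \<open>q\<close>.\<close>

primrec cascade_cdf :: "nat \<Rightarrow> nat \<Rightarrow> real \<Rightarrow> real" where
  "cascade_cdf 0 m = (\<lambda>x. if x \<ge> 0 then 1 else 0)"
| "cascade_cdf (Suc j) m = shift_poly (1 / 2 ^ Suc m) (q m) (cascade_cdf j (Suc m))"

lemma cascade_cdf_nonneg: "cascade_cdf j m x \<ge> 0"
  by (induction j arbitrary: m x)
     (auto simp: shift_poly_def intro!: sum_nonneg mult_nonneg_nonneg q_nonneg)

lemma cascade_cdf_le_1: "cascade_cdf j m x \<le> 1"
proof (induction j arbitrary: m x)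
  case (Suc j)
  have "cascade_cdf (Suc j) m x \<le> shift_poly (1 / 2 ^ Suc m) (q m) (\<lambda>x. 1) x"
    unfolding cascade_cdf.simps using Suc by (intro shift_poly_mono q_nonneg)
  then show ?case by (simp add: shift_poly_q_const)
qed simp

lemma cascade_cdf_mono: "x \<le> y \<Longrightarrow> cascade_cdf j m x \<le> cascade_cdf j m y"
proof (induction j arbitrary: m x y)
  case (Suc j)
  show ?case unfolding cascade_cdf.simps shift_poly_def
    using Suc by (intro sum_mono mult_left_mono q_nonneg) auto
qed auto

lemma cascade_cdf_neg: "x < 0 \<Longrightarrow> cascade_cdf j m x = 0"
proof (induction j arbitrary: m x)
  case (Suc j)
  have "x - real i * (1 / 2 ^ Suc m) < 0" for i
  proof -
    have "real i * (1 / 2 ^ Suc m) \<ge> 0" by simp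
    then show ?thesis using Suc.prems by linarith
  qed
  then show ?case using Suc.IH by (simp add: shift_poly_def)
qed auto

lemma cascade_cdf_eq_1: "x \<ge> real N / 2 ^ m \<Longrightarrow> cascade_cdf j m x = 1"
proof (induction j arbitrary: m x)
  case 0
  moreover have "real N / 2 ^ m \<ge> 0" by simp
  ultimately have "x \<ge> 0" by linarith
  then show ?case by simp
next
  case (Suc j)
  have "cascade_cdf j (Suc m) (x - real i * (1 / 2 ^ Suc m)) = 1" if "i \<le> degree (q m)" for i
  proof (rule Suc.IH)
    have "real i \<le> real N" using that q_degree[of m] by simp
    then have "real i * (1 / 2 ^ Suc m) \<le> real N / 2 ^ Suc m"
      by (simp add: divide_right_mono)
    moreover have "real N / 2 ^ m = real N / 2 ^ Suc m + real N / 2 ^ Suc m" by simp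
    ultimately show "real N / 2 ^ Suc m \<le> x - real i * (1 / 2 ^ Suc m)"
      using Suc.prems by linarith
  qed
  then show ?case using q_sum[of m] by (simp add: shift_poly_def)
qed

text \<open>A further step adds a nonnegative random variable to the sum, which decreases the distribution function. This is why
  the cascade converges at every point.\<close>

lemma cascade_cdf_Suc_le: "cascade_cdf (Suc j) m x \<le> cascade_cdf j m x"
proof (induction j arbitrary: m x)
  case 0
  have "cascade_cdf (Suc 0) m x \<le> shift_poly (1 / 2 ^ Suc m) (q m) (\<lambda>_. cascade_cdf 0 m x) x"
    unfolding cascade_cdf.simps(2) shift_poly_def
  proof (intro sum_mono mult_left_mono q_nonneg)
    fix i
    have "x - real i * (1 / 2 ^ Suc m) \<le> x" by simp
    from cascade_cdf_mono[OF this, of 0 m] show "cascade_cdf 0 (Suc m) (x - real i * (1 / 2 ^ Suc m)) \<le> cascade_cdf 0 m x"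
      by simp
  qed
  then show ?case by (simp only: shift_poly_q_const)
next
  case (Suc j)
  have "shift_poly (1 / 2 ^ Suc m) (q m) (cascade_cdf (Suc j) (Suc m)) x
      \<le> shift_poly (1 / 2 ^ Suc m) (q m) (cascade_cdf j (Suc m)) x"
    by (intro shift_poly_mono q_nonneg Suc.IH)
  then show ?case by (metis cascade_cdf.simps(2))
qed

lemma cascade_cdf_measurable [measurable]: "cascade_cdf j m \<in> borel_measurable borel"
  by (intro borel_measurable_mono monoI cascade_cdf_mono)

definition limit_cdf :: "nat \<Rightarrow> real \<Rightarrow> real" where
  "limit_cdf m x = lim (\<lambda>j. cascade_cdf j m x)"

lemma cascade_cdf_tendsto: "(\<lambda>j. cascade_cdf j m x) \<longlonglongrightarrow> limit_cdf m x"
proof -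
  have "decseq (\<lambda>j. cascade_cdf j m x)" by (intro decseq_SucI cascade_cdf_Suc_le)
  then obtain L where "(\<lambda>j. cascade_cdf j m x) \<longlonglongrightarrow> L"
    by (rule decseq_convergent[where B = 0]) (simp_all add: cascade_cdf_nonneg)
  then show ?thesis unfolding limit_cdf_def by (metis limI)
qed

text \<open>The difference quotient at the coarsest scale is the convolution with a box function, which restores the factors
  \<open>(1 + z) / 2\<close> of the masks.\<close>

definition cascade_fun :: "nat \<Rightarrow> nat \<Rightarrow> real \<Rightarrow> real" where
  "cascade_fun j m x = 2 ^ m * (cascade_cdf j m x - cascade_cdf j m (x - 1 / 2 ^ m))"

definition limit_fun :: "nat \<Rightarrow> real \<Rightarrow> real" where
  "limit_fun m x = 2 ^ m * (limit_cdf m x - limit_cdf m (x - 1 / 2 ^ m))"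

lemma cascade_fun_tendsto: "(\<lambda>j. cascade_fun j m x) \<longlonglongrightarrow> limit_fun m x"
  unfolding cascade_fun_def limit_fun_def by (intro tendsto_intros cascade_cdf_tendsto)

lemma cascade_fun_measurable [measurable]: "cascade_fun j m \<in> borel_measurable borel"
  unfolding cascade_fun_def by measurable

lemma limit_fun_measurable [measurable]: "limit_fun m \<in> borel_measurable borel"
  by (rule borel_measurable_LIMSEQ_real[OF cascade_fun_tendsto]) simp

lemma cascade_fun_nonneg: "cascade_fun j m x \<ge> 0"
  by (simp add: cascade_fun_def cascade_cdf_mono)

lemma cascade_fun_le: "cascade_fun j m x \<le> 2 ^ m"
proof -
  have "cascade_cdf j m x - cascade_cdf j m (x - 1 / 2 ^ m) \<le> 1"
    using cascade_cdf_le_1[of j m x] cascade_cdf_nonneg[of j m "x - 1 / 2 ^ m"] by linarith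
  then show ?thesis by (simp add: cascade_fun_def)
qed

lemma cascade_fun_support:
  assumes "x \<notin> {0..<real (N + 1) / 2 ^ m}"
  shows "cascade_fun j m x = 0"
proof (cases "x < 0")
  case True
  moreover have "(1::real) / 2 ^ m \<ge> 0" by simp
  ultimately have "x - 1 / 2 ^ m < 0" by linarith
  then show ?thesis using True cascade_cdf_neg by (simp add: cascade_fun_def)
next
  case False
  then have "x \<ge> real N / 2 ^ m + 1 / 2 ^ m" using assms by (simp add: add_divide_distrib add.commute)
  moreover have "(1::real) / 2 ^ m \<ge> 0" by simp
  ultimately have "x \<ge> real N / 2 ^ m" "x - 1 / 2 ^ m \<ge> real N / 2 ^ m" by linarith+
  then show ?thesis by (simp add: cascade_fun_def cascade_cdf_eq_1)
qed

lemma limit_fun_nonneg: "limit_fun m x \<ge> 0"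
  by (rule LIMSEQ_le_const[OF cascade_fun_tendsto]) (auto simp: cascade_fun_nonneg)

lemma limit_fun_le: "limit_fun m x \<le> 2 ^ m"
  by (rule LIMSEQ_le_const2[OF cascade_fun_tendsto]) (auto simp: cascade_fun_le)

lemma limit_fun_support: "x \<notin> {0..<real (N + 1) / 2 ^ m} \<Longrightarrow> limit_fun m x = 0"
  using cascade_fun_tendsto[of m x] by (simp add: cascade_fun_support tendsto_const_iff LIMSEQ_const_iff)

text \<open>With \<open>s\<close> half the coarse lattice constant, \<open>1 - T\<^sup>2 = (1 + T)(1 - T)\<close>: the difference
  over the coarse lattice constant is the factor \<open>(1 + z) / 2\<close> of the mask applied to the difference over
  the fine one.\<close>

lemma cascade_fun_refine: "cascade_fun (Suc j) m = shift_poly (1 / 2 ^ Suc m) (mask_poly m) (cascade_fun j (Suc m))"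
proof
  fix x
  define s :: real where "s = 1 / 2 ^ Suc m"
  define G where "G = cascade_cdf j (Suc m)"
  have two_s: "1 / 2 ^ m = 2 * s" by (simp add: s_def)
  have half: "shift_poly s [:1/2, 1/2:] (cascade_fun j (Suc m)) = (\<lambda>x. 2 ^ m * (G x - translate (2 * s) G x))"
  proof -
    have "cascade_fun j (Suc m) = (\<lambda>x. 2 ^ Suc m * (G x - G (x - s)))"
      by (simp only: fun_eq_iff cascade_fun_def G_def s_def) simp
    then show ?thesis by (simp only: fun_eq_iff shift_poly_pCons) (simp add: algebra_simps)
  qed
  have "shift_poly s (mask_poly m) (cascade_fun j (Suc m)) x = shift_poly s (q m) (\<lambda>x. 2 ^ m * (G x - translate (2 * s) G x)) x"
    unfolding mask_poly_def mult.commute[of "[:1/2, 1/2:]"] shift_poly_mult half ..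
  also have "\<dots> = 2 ^ m * (shift_poly s (q m) G x - shift_poly s (q m) G (x - 2 * s))"
    unfolding shift_poly_fun_cmult shift_poly_fun_diff shift_poly_translate by simp
  also have "\<dots> = cascade_fun (Suc j) m x"
    unfolding cascade_fun_def two_s cascade_cdf.simps G_def s_def ..
  finally show "cascade_fun (Suc j) m x = shift_poly (1 / 2 ^ Suc m) (mask_poly m) (cascade_fun j (Suc m)) x"
    by (simp add: s_def)
qed

lemma limit_fun_refine: "limit_fun m = shift_poly (1 / 2 ^ Suc m) (mask_poly m) (limit_fun (Suc m))"
proof
  fix x
  have "(\<lambda>j. cascade_fun (Suc j) m x) \<longlonglongrightarrow> limit_fun m x"
    using cascade_fun_tendsto by (rule LIMSEQ_Suc)
  moreover have "(\<lambda>j. cascade_fun (Suc j) m x) \<longlonglongrightarrow> shift_poly (1 / 2 ^ Suc m) (mask_poly m) (limit_fun (Suc m)) x"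
    unfolding cascade_fun_refine shift_poly_def by (intro tendsto_intros cascade_fun_tendsto)
  ultimately show "limit_fun m x = shift_poly (1 / 2 ^ Suc m) (mask_poly m) (limit_fun (Suc m)) x"
    by (rule LIMSEQ_unique)
qed

abbreviation cascade_bound :: "nat \<Rightarrow> real \<Rightarrow> real" where
  "cascade_bound m x \<equiv> 2 ^ m * indicat_real {0..real (N + 1) / 2 ^ m} x"

lemma cascade_bound_integrable: "integrable lborel (cascade_bound m)"
  by (intro integrable_mult_right) (auto simp: emeasure_lborel_Icc_eq)

lemma cascade_fun_bound: "\<bar>cascade_fun j m x\<bar> \<le> cascade_bound m x"
  using cascade_fun_support[of x m j] cascade_fun_nonneg[of j m x] cascade_fun_le[of j m x]
  by (auto simp: indicator_def)

lemma limit_fun_bound: "\<bar>limit_fun m x\<bar> \<le> cascade_bound m x"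
  using limit_fun_support[of x m] limit_fun_nonneg[of m x] limit_fun_le[of m x]
  by (auto simp: indicator_def)

lemma cascade_fun_integrable: "integrable lborel (cascade_fun j m)"
  by (rule integrable_dominated[OF cascade_bound_integrable[of m]])
     (simp, simp only: real_norm_def cascade_fun_bound)

lemma limit_fun_integrable: "integrable lborel (limit_fun m)"
  by (rule integrable_dominated[OF cascade_bound_integrable[of m]])
     (simp, simp only: real_norm_def limit_fun_bound)


subsection \<open>The Fourier transform of the cascade limit\<close>

abbreviation cascade_cfun :: "nat \<Rightarrow> nat \<Rightarrow> real \<Rightarrow> complex" where
  "cascade_cfun j m \<equiv> \<lambda>x. complex_of_real (cascade_fun j m x)"

abbreviation limit_cfun :: "nat \<Rightarrow> real \<Rightarrow> complex" where
  "limit_cfun m \<equiv> \<lambda>x. complex_of_real (limit_fun m x)"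

lemma cascade_cfun_refine: "cascade_cfun (Suc j) m = shift_poly (1 / 2 ^ Suc m) (cpoly (mask_poly m)) (cascade_cfun j (Suc m))"
  by (simp only: fun_eq_iff cascade_fun_refine shift_poly_of_real) simp

lemma limit_cfun_refine: "limit_cfun m = shift_poly (1 / 2 ^ Suc m) (cpoly (mask_poly m)) (limit_cfun (Suc m))"
  by (subst limit_fun_refine) (simp only: fun_eq_iff shift_poly_of_real, simp)

lemma fourier_cascade_fun:
  "fourier (cascade_cfun j m) \<omega> =
    (\<Prod>i<j. poly (cpoly (mask_poly (m + i))) (cis (- (\<omega> / 2 ^ (m + i + 1))))) *
      fourier (cascade_cfun 0 (m + j)) \<omega>"
proof (induction j arbitrary: m)
  case (Suc j)
  have "fourier (cascade_cfun (Suc j) m) \<omega> =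
      poly (cpoly (mask_poly m)) (cis (- (\<omega> / 2 ^ Suc m))) * fourier (cascade_cfun j (Suc m)) \<omega>"
    unfolding cascade_cfun_refine using cascade_fun_integrable by (subst fourier_shift_poly) auto
  also note Suc.IH
  finally show ?case
    by (simp add: prod.lessThan_Suc_shift mult.assoc del: prod.lessThan_Suc)
qed simp

lemma cascade_fun_0: "cascade_fun 0 m x = 2 ^ m * indicat_real {0..<1 / 2 ^ m} x"
proof -
  have "x \<ge> 0" if "x \<ge> 1 / 2 ^ m"
    by (rule order_trans[OF _ that]) simp
  then show ?thesis by (auto simp: cascade_fun_def indicator_def)
qed

lemma cascade_fun_0_integral: "(LINT x|lborel. cascade_fun 0 m x) = 1"
  by (simp add: cascade_fun_0)

lemma fourier_cascade_fun_0_bound: "cmod (fourier (cascade_cfun 0 m) \<omega> - 1) \<le> \<bar>\<omega>\<bar> / 2 ^ m"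
proof -
  note int = cascade_fun_integrable[of 0 m]
  have cint: "integrable lborel (\<lambda>x. complex_of_real (cascade_fun 0 m x))"
    using int by simp
  have "fourier (cascade_cfun 0 m) \<omega> - 1 =
      (LINT x|lborel. of_real (cascade_fun 0 m x) * cis (- (\<omega> * x))) - (LINT x|lborel. of_real (cascade_fun 0 m x))"
    unfolding fourier_def integral_complex_of_real by (simp add: cascade_fun_0_integral)
  also have "\<dots> = (LINT x|lborel. of_real (cascade_fun 0 m x) * (cis (- (\<omega> * x)) - 1))"
    using cint fourier_integrable[OF cint]
    by (simp add: right_diff_distrib Bochner_Integration.integral_diff del: of_real_mult of_real_power)
  also have "cmod \<dots> \<le> (LINT x|lborel. cascade_fun 0 m x * (\<bar>\<omega>\<bar> / 2 ^ m))"
  proof (rule order_trans[OF integral_norm_bound], rule integral_mono)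
    show "integrable lborel (\<lambda>x. cmod (complex_of_real (cascade_fun 0 m x) * (cis (- (\<omega> * x)) - 1)))"
      using Bochner_Integration.integrable_diff[OF fourier_integrable[OF cint, of \<omega>] cint]
      by (intro integrable_norm) (simp add: right_diff_distrib)
    show "integrable lborel (\<lambda>x. cascade_fun 0 m x * (\<bar>\<omega>\<bar> / 2 ^ m))"
      using int by simp
    fix x
    show "cmod (complex_of_real (cascade_fun 0 m x) * (cis (- (\<omega> * x)) - 1)) \<le> cascade_fun 0 m x * (\<bar>\<omega>\<bar> / 2 ^ m)"
    proof (cases "x \<in> {0..<1 / 2 ^ m}")
      case True
      have "cmod (cis (- (\<omega> * x)) - 1) \<le> \<bar>\<omega> * x\<bar>"
        using norm_cis_minus_1_le[of "- (\<omega> * x)"] by simp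
      also have "\<dots> \<le> \<bar>\<omega>\<bar> * (1 / 2 ^ m)"
        unfolding abs_mult using True by (intro mult_left_mono) auto
      finally have "cmod (cis (- (\<omega> * x)) - 1) \<le> \<bar>\<omega>\<bar> * (1 / 2 ^ m)" .
      from mult_left_mono[OF this cascade_fun_nonneg[of 0 m x]] show ?thesis
        using cascade_fun_nonneg[of 0 m x] by (simp add: norm_mult)
    qed (simp add: cascade_fun_0)
  qed
  also have "\<dots> = \<bar>\<omega>\<bar> / 2 ^ m"
    by (simp add: cascade_fun_0_integral)
  finally show ?thesis .
qed

lemma fourier_cascade_fun_tendsto: "(\<lambda>j. fourier (cascade_cfun j m) \<omega>) \<longlonglongrightarrow> fourier (limit_cfun m) \<omega>"
  unfolding fourier_def
proof (rule integral_dominated_convergence)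
  show "integrable lborel (cascade_bound m)" by (rule cascade_bound_integrable)
  have [measurable]: "(\<lambda>x. cis (- (\<omega> * x))) \<in> borel_measurable borel"
    by (intro borel_measurable_continuous_onI continuous_intros)
  show "(\<lambda>x. complex_of_real (limit_fun m x) * cis (- (\<omega> * x))) \<in> borel_measurable lborel"
    by simp
  show "(\<lambda>x. complex_of_real (cascade_fun j m x) * cis (- (\<omega> * x))) \<in> borel_measurable lborel" for j
    by simp
  show "AE x in lborel. (\<lambda>j. complex_of_real (cascade_fun j m x) * cis (- (\<omega> * x)))
      \<longlonglongrightarrow> complex_of_real (limit_fun m x) * cis (- (\<omega> * x))"
    by (intro AE_I2 tendsto_intros cascade_fun_tendsto)
  show "AE x in lborel. cmod (complex_of_real (cascade_fun j m x) * cis (- (\<omega> * x))) \<le> cascade_bound m x" for j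
    using cascade_fun_bound[of j m] by (intro AE_I2) (simp add: norm_mult)
qed

text \<open>Convergence of the infinite product: the coefficients are a probability distribution on \<open>{0..N + 1}\<close>.\<close>

lemma mask_poly_near_1: "cmod (poly (cpoly (mask_poly k)) (cis a) - 1) \<le> real (N + 1) * \<bar>a\<bar>"
proof -
  have "poly (cpoly (mask_poly k)) z = (\<Sum>i\<le>degree (mask_poly k). of_real (coeff (mask_poly k) i) * z ^ i)" for z
    by (simp add: poly_altdef degree_map_poly coeff_map_poly)
  moreover have "(1::complex) = (\<Sum>i\<le>degree (mask_poly k). of_real (coeff (mask_poly k) i))"
    using mask_poly_sum[of k] by (metis of_real_1 of_real_sum)
  ultimately have "poly (cpoly (mask_poly k)) (cis a) - 1
      = (\<Sum>i\<le>degree (mask_poly k). of_real (coeff (mask_poly k) i) * (cis a ^ i - 1))"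
    by (simp add: right_diff_distrib sum_subtractf)
  also have "cmod \<dots> \<le> (\<Sum>i\<le>degree (mask_poly k). coeff (mask_poly k) i * (real (N + 1) * \<bar>a\<bar>))"
  proof (rule sum_norm_le)
    fix i assume "i \<in> {..degree (mask_poly k)}"
    then have "i \<le> N + 1" using mask_poly_degree[of k] by simp
    then have "real i * \<bar>a\<bar> \<le> real (N + 1) * \<bar>a\<bar>" by (intro mult_right_mono) auto
    with norm_cis_power_minus_1_le[of a i] have "cmod (cis a ^ i - 1) \<le> real (N + 1) * \<bar>a\<bar>" by linarith
    then show "cmod (of_real (coeff (mask_poly k) i) * (cis a ^ i - 1)) \<le> coeff (mask_poly k) i * (real (N + 1) * \<bar>a\<bar>)"
      using mask_poly_nonneg[of k i] by (simp add: norm_mult mult_left_mono del: of_nat_Suc of_nat_add)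
  qed
  also have "\<dots> = real (N + 1) * \<bar>a\<bar>"
    by (simp only: mask_poly_sum mult_1 flip: sum_distrib_right)
  finally show ?thesis .
qed

text \<open>The Fourier transform of the cascade is a partial product times the transform of a box of width
  \<open>2\<^sup>-\<^sup>(\<^sup>m\<^sup>+\<^sup>j\<^sup>)\<close>, which tends to \<open>1\<close>.\<close>

lemma fourier_limit_fun:
  "fourier (limit_cfun m) \<omega> = (\<Prod>k. poly (cpoly (mask_poly (m + k))) (cis (- (\<omega> / 2 ^ (m + k + 1)))))"
proof -
  define P where "P k = poly (cpoly (mask_poly (m + k))) (cis (- (\<omega> / 2 ^ (m + k + 1))))" for k
  have "convergent_prod P"
  proof (intro abs_convergent_prod_imp_convergent_prod summable_imp_abs_convergent_prod)
    have "norm (norm (P k - 1)) \<le> real (N + 1) * \<bar>\<omega>\<bar> * (1 / 2) ^ k" for k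
    proof -
      have "norm (P k - 1) \<le> real (N + 1) * (\<bar>\<omega>\<bar> / 2 ^ (m + k + 1))"
        using mask_poly_near_1[of "m + k" "- (\<omega> / 2 ^ (m + k + 1))"] by (simp add: P_def)
      also have "\<dots> \<le> real (N + 1) * (\<bar>\<omega>\<bar> / 2 ^ k)"
        by (intro mult_left_mono divide_left_mono power_increasing) auto
      finally show ?thesis by (simp add: power_divide)
    qed
    then show "summable (\<lambda>k. norm (P k - 1))"
      by (intro summable_comparison_test'[where N = 0, OF summable_mult[OF summable_geometric]]) auto
  qed
  then have "(\<lambda>j. \<Prod>i\<le>j. P i) \<longlonglongrightarrow> prodinf P"
    by (rule convergent_prod_LIMSEQ)
  then have "(\<lambda>j. \<Prod>i<Suc j. P i) \<longlonglongrightarrow> prodinf P"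
    by (simp only: lessThan_Suc_atMost)
  then have P: "(\<lambda>j. \<Prod>i<j. P i) \<longlonglongrightarrow> prodinf P"
    by (rule LIMSEQ_imp_Suc)
  have "(\<lambda>j. fourier (cascade_cfun 0 (m + j)) \<omega> - 1) \<longlonglongrightarrow> 0"
  proof (rule Lim_null_comparison)
    show "\<forall>\<^sub>F j in sequentially. norm (fourier (cascade_cfun 0 (m + j)) \<omega> - 1) \<le> \<bar>\<omega>\<bar> * (1 / 2) ^ j"
    proof (intro always_eventually allI)
      fix j
      have "norm (fourier (cascade_cfun 0 (m + j)) \<omega> - 1) \<le> \<bar>\<omega>\<bar> / 2 ^ (m + j)"
        by (rule fourier_cascade_fun_0_bound)
      also have "\<dots> \<le> \<bar>\<omega>\<bar> / 2 ^ j"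
        by (intro divide_left_mono power_increasing) auto
      finally show "norm (fourier (cascade_cfun 0 (m + j)) \<omega> - 1) \<le> \<bar>\<omega>\<bar> * (1 / 2) ^ j"
        by (simp add: power_divide)
    qed
    show "(\<lambda>j. \<bar>\<omega>\<bar> * (1 / 2) ^ j) \<longlonglongrightarrow> 0"
      using tendsto_mult_right_zero[OF LIMSEQ_realpow_zero[of "1/2"], of "\<bar>\<omega>\<bar>"] by simp
  qed
  then have "(\<lambda>j. fourier (cascade_cfun 0 (m + j)) \<omega>) \<longlonglongrightarrow> 1"
    by (simp add: LIM_zero_iff)
  from tendsto_mult[OF P this] have "(\<lambda>j. fourier (cascade_cfun j m) \<omega>) \<longlonglongrightarrow> prodinf P"
    by (simp add: fourier_cascade_fun[of _ m] P_def)
  with fourier_cascade_fun_tendsto[of m \<omega>] have "fourier (limit_cfun m) \<omega> = prodinf P"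
    by (rule LIMSEQ_unique)
  then show ?thesis by (simp add: P_def[abs_def])
qed

lemma limit_fun_integral: "(LINT x|lborel. limit_fun m x) = 1"
proof -
  have "poly (cpoly (mask_poly k)) 1 = 1" for k
    using poly_cpoly_of_real[of "mask_poly k" 1] by (simp add: mask_poly_one)
  then have "fourier (limit_cfun m) 0 = 1" using fourier_limit_fun[of m 0] by simp
  then have "complex_of_real (LINT x|lborel. limit_fun m x) = 1"
    by (simp add: fourier_def)
  then show ?thesis by (simp only: of_real_eq_1_iff)
qed

lemma limit_cfun_L2: "limit_cfun m \<in> L2"
  using limit_fun_integrable limit_fun_nonneg limit_fun_le by (rule L2_of_real_bounded)

end

section \<open>Uniqueness of Fourier transforms\<close>

lemma real_distribution_density:
  assumes int: "integrable lborel p" and nonneg: "\<And>x. p x \<ge> (0::real)" and one: "(LINT x|lborel. p x) = 1"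
  shows "real_distribution (density lborel (\<lambda>x. ennreal (p x)))"
    and "char (density lborel (\<lambda>x. ennreal (p x))) t = fourier (\<lambda>x. complex_of_real (p x)) (- t)"
proof -
  have [measurable]: "p \<in> borel_measurable borel" using int by auto
  have "(\<integral>\<^sup>+ x. ennreal (p x) \<partial>lborel) = 1"
    using nn_integral_eq_integral[OF int] nonneg one by simp
  then show "real_distribution (density lborel (\<lambda>x. ennreal (p x)))"
    by (auto simp: real_distribution_def real_distribution_axioms_def emeasure_density
        intro!: prob_spaceI)
  have [measurable]: "(\<lambda>x. iexp (t * x)) \<in> borel_measurable borel"
    by (intro borel_measurable_continuous_onI continuous_intros)
  have "char (density lborel (\<lambda>x. ennreal (p x))) t = (LINT x|lborel. p x *\<^sub>R iexp (t * x))"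
    unfolding char_def by (subst integral_density) (auto simp: nonneg)
  then show "char (density lborel (\<lambda>x. ennreal (p x))) t = fourier (\<lambda>x. complex_of_real (p x)) (- t)"
    by (simp add: fourier_def cis_conv_exp scaleR_conv_of_real)
qed

text \<open>The positive and the negative part have the same Fourier transform. After normalisation they are densities with the
  same characteristic function, so they agree by Levy's uniqueness theorem.\<close>

lemma AE_zero_of_fourier_zero_real:
  assumes int: "integrable lborel g"
    and zero: "\<And>\<omega>. fourier (\<lambda>x. complex_of_real (g x)) \<omega> = 0"
  shows "AE x in lborel. g x = 0"
proof -
  define p where "p x = max 0 (g x)" for x
  define r where "r x = max 0 (- g x)" for x
  have g: "g x = p x - r x" and nonneg: "p x \<ge> 0" "r x \<ge> 0" for x
    by (auto simp: p_def r_def)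
  have ip: "integrable lborel p" and ir: "integrable lborel r"
    unfolding p_def r_def using int by auto
  have eq: "fourier (\<lambda>x. complex_of_real (p x)) \<omega> = fourier (\<lambda>x. complex_of_real (r x)) \<omega>" for \<omega>
  proof -
    have "integrable lborel (\<lambda>x. complex_of_real (p x) * cis (- (\<omega> * x)))"
      "integrable lborel (\<lambda>x. complex_of_real (r x) * cis (- (\<omega> * x)))"
      using ip ir by (auto intro!: fourier_integrable)
    then have "fourier (\<lambda>x. complex_of_real (p x)) \<omega> - fourier (\<lambda>x. complex_of_real (r x)) \<omega>
        = fourier (\<lambda>x. complex_of_real (g x)) \<omega>"
      by (simp add: fourier_def g left_diff_distrib)
    then show ?thesis using zero by simp
  qed
  define c where "c = (LINT x|lborel. p x)"
  have "complex_of_real (LINT x|lborel. p x) = complex_of_real (LINT x|lborel. r x)"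
    using eq[of 0] by (simp add: fourier_def)
  then have c': "c = (LINT x|lborel. r x)" by (simp only: of_real_eq_iff c_def)
  have "AE x in lborel. p x = r x"
  proof (cases "c = 0")
    case True
    have "AE x in lborel. p x = 0" "AE x in lborel. r x = 0"
      using True c' nonneg integral_nonneg_eq_0_iff_AE[OF ip] integral_nonneg_eq_0_iff_AE[OF ir]
      by (auto simp: c_def)
    then show ?thesis by eventually_elim simp
  next
    case False
    have "c \<ge> 0" unfolding c_def using nonneg by (intro Bochner_Integration.integral_nonneg)
    with False have c: "c > 0" by simp
    define p1 where "p1 x = p x / c" for x
    define r1 where "r1 x = r x / c" for x
    have p1: "integrable lborel p1" "p1 x \<ge> 0" "(LINT x|lborel. p1 x) = 1" for x
      using ip nonneg c by (auto simp: p1_def[abs_def] c_def)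
    have r1: "integrable lborel r1" "r1 x \<ge> 0" "(LINT x|lborel. r1 x) = 1" for x
      using ir nonneg c c' by (auto simp: r1_def[abs_def])
    have "fourier (\<lambda>x. complex_of_real (p1 x)) \<omega> = fourier (\<lambda>x. complex_of_real (r1 x)) \<omega>" for \<omega>
      using eq[of \<omega>] by (simp add: p1_def r1_def fourier_def)
    then have "density lborel (\<lambda>x. ennreal (p1 x)) = density lborel (\<lambda>x. ennreal (r1 x))"
      using real_distribution_density[OF p1] real_distribution_density[OF r1]
      by (intro Levy_uniqueness) auto
    moreover have "p1 \<in> borel_measurable lborel" "r1 \<in> borel_measurable lborel"
      using p1(1) r1(1) by auto
    ultimately have "AE x in lborel. ennreal (p1 x) = ennreal (r1 x)"
      by (subst sigma_finite_measure.density_unique_iff[OF lborel.sigma_finite_measure_axioms, symmetric])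
         simp_all
    then show ?thesis
      by eventually_elim (use p1(2) r1(2) c in \<open>simp add: p1_def r1_def\<close>)
  qed
  then show ?thesis by eventually_elim (simp add: g)
qed

lemma fourier_Re:
  assumes "integrable lborel f"
  shows "fourier (\<lambda>x. complex_of_real (Re (f x))) \<omega> = (fourier f \<omega> + cnj (fourier f (- \<omega>))) / 2"
proof -
  have int: "integrable lborel (\<lambda>x. f x * cis (- (\<omega> * x)))" for \<omega>
    by (rule fourier_integrable[OF assms])
  have cint: "integrable lborel (\<lambda>x. cnj (f x) * cis (- (\<omega> * x)))"
    using assms by (intro fourier_integrable) simp
  have "cnj (fourier f (- \<omega>)) = (LINT x|lborel. cnj (f x) * cis (- (\<omega> * x)))"
    unfolding fourier_def by (subst Bochner_Integration.integral_cnj[symmetric]) (simp add: cis_cnj)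
  then have "fourier f \<omega> + cnj (fourier f (- \<omega>)) = (LINT x|lborel. (f x + cnj (f x)) * cis (- (\<omega> * x)))"
    using int[of \<omega>] cint by (simp add: fourier_def distrib_right)
  also have "\<dots> = 2 * fourier (\<lambda>x. complex_of_real (Re (f x))) \<omega>"
    by (simp add: complex_add_cnj fourier_def mult.assoc flip: integral_mult_right_zero)
  finally show ?thesis by simp
qed

lemma AE_zero_of_fourier_zero:
  assumes int: "integrable lborel f" and zero: "\<And>\<omega>. fourier f \<omega> = 0"
  shows "AE x in lborel. f x = 0"
proof -
  have Re: "AE x in lborel. Re (f x) = 0"
    using int zero by (intro AE_zero_of_fourier_zero_real) (auto simp: fourier_Re)
  have Im_eq: "Im (f x) = Re (- \<i> * f x)" for x by simp
  have int': "integrable lborel (\<lambda>x. - \<i> * f x)" using int by (intro integrable_mult_right)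
  have "fourier (\<lambda>x. - \<i> * f x) \<omega> = - \<i> * fourier f \<omega>" for \<omega>
    unfolding fourier_def mult.assoc by (rule integral_mult_right_zero)
  then have zero': "fourier (\<lambda>x. - \<i> * f x) \<omega> = 0" for \<omega>
    using zero by simp
  have "AE x in lborel. Im (f x) = 0"
    unfolding Im_eq using int' zero'
    by (intro AE_zero_of_fourier_zero_real) (auto simp only: fourier_Re, auto)
  with Re show ?thesis by eventually_elim (simp add: complex_eq_iff)
qed

lemma AE_eq_of_fourier_eq:
  assumes f: "integrable lborel f" and g: "integrable lborel g" and eq: "\<And>\<omega>. fourier f \<omega> = fourier g \<omega>"
  shows "AE x in lborel. f x = g x"
proof -
  have "fourier (\<lambda>x. f x - g x) \<omega> = 0" for \<omega>
    using fourier_integrable[OF f, of \<omega>] fourier_integrable[OF g, of \<omega>] eq[of \<omega>]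
    by (simp add: fourier_def left_diff_distrib)
  then have "AE x in lborel. f x - g x = 0"
    using f g by (intro AE_zero_of_fourier_zero) auto
  then show ?thesis by simp
qed

section \<open>Essential supports\<close>

lemma ess_support_iff:
  "x \<in> ess_support f \<longleftrightarrow>
    (\<forall>U. open U \<longrightarrow> x \<in> U \<longrightarrow> \<not> (AE y in lborel. y \<in> U \<longrightarrow> f y = 0))"
  by (auto simp: ess_support_def)

lemma closed_ess_support: "closed (ess_support f)"
  by (auto simp: ess_support_def)

text \<open>The essential support is defined by removing possibly uncountably many open sets; by Lindelof's theorem countably many
  suffice.\<close>

lemma AE_zero_outside_ess_support: "AE x in lborel. x \<notin> ess_support f \<longrightarrow> f x = 0"
proof -
  define \<U> where "\<U> = {U. open U \<and> (AE x in lborel. x \<in> U \<longrightarrow> f x = 0)}"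
  obtain \<U>' where \<U>': "\<U>' \<subseteq> \<U>" "countable \<U>'" "\<Union>\<U>' = \<Union>\<U>"
    using Lindelof[of \<U>] by (auto simp: \<U>_def)
  then have "\<forall>U\<in>\<U>'. AE x in lborel. x \<in> U \<longrightarrow> f x = 0"
    by (auto simp: \<U>_def)
  with \<U>'(2) have "AE x in lborel. \<forall>U\<in>\<U>'. x \<in> U \<longrightarrow> f x = 0"
    by (subst AE_ball_countable) auto
  then show ?thesis
    by eventually_elim (use \<U>' in \<open>auto simp: ess_support_def \<U>_def\<close>)
qed

lemma ess_support_cong_AE:
  assumes "AE x in lborel. f x = g x"
  shows "ess_support f = ess_support g"
proof -
  have "(AE x in lborel. x \<in> U \<longrightarrow> f x = 0) \<longleftrightarrow> (AE x in lborel. x \<in> U \<longrightarrow> g x = 0)" for U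
  proof
    assume "AE x in lborel. x \<in> U \<longrightarrow> f x = 0"
    with assms show "AE x in lborel. x \<in> U \<longrightarrow> g x = 0" by eventually_elim auto
  next
    assume "AE x in lborel. x \<in> U \<longrightarrow> g x = 0"
    with assms show "AE x in lborel. x \<in> U \<longrightarrow> f x = 0" by eventually_elim auto
  qed
  then show ?thesis by (simp add: ess_support_def)
qed

lemma ess_support_subset:
  assumes "closed K" "\<And>x. x \<notin> K \<Longrightarrow> f x = 0"
  shows "ess_support f \<subseteq> K"
proof
  fix x assume x: "x \<in> ess_support f"
  show "x \<in> K"
  proof (rule ccontr)
    assume "x \<notin> K"
    with assms(1) x have "\<not> (AE y in lborel. y \<in> - K \<longrightarrow> f y = 0)"
      unfolding ess_support_iff by blast
    then show False using assms(2) by simp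
  qed
qed

text \<open>Pointwise bounded support makes every sum over translates locally finite. Each square-integrable function with compact
  essential support agrees almost everywhere with such a function.\<close>

definition compact_L2 :: "(real \<Rightarrow> complex) set" where
  "compact_L2 = {f \<in> L2. \<exists>R. \<forall>x. \<bar>x\<bar> > R \<longrightarrow> f x = 0}"

lemma compact_L2_L2: "f \<in> compact_L2 \<Longrightarrow> f \<in> L2"
  by (simp add: compact_L2_def)

lemma compact_L2_representative:
  assumes f: "f \<in> L2" and K: "compact (ess_support f)"
  obtains g where "g \<in> compact_L2" "AE x in lborel. f x = g x"
proof
  define g where "g x = indicator (ess_support f) x * f x" for x
  have [measurable]: "ess_support f \<in> sets borel" "f \<in> borel_measurable borel"
    using closed_ess_support f by (auto simp: L2_measurable)
  obtain R where R: "\<And>x. x \<in> ess_support f \<Longrightarrow> norm x \<le> R"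
    using compact_imp_bounded[OF K] by (auto simp: bounded_iff)
  have [measurable]: "g \<in> borel_measurable borel" unfolding g_def by measurable
  have "integrable lborel (\<lambda>x. (cmod (g x))\<^sup>2)"
    by (rule integrable_dominated[OF L2_square_integrable[OF f]]) (auto simp: g_def indicator_def)
  moreover have "g x = 0" if "\<bar>x\<bar> > R" for x
    using R[of x] that by (auto simp: g_def indicator_def)
  ultimately show "g \<in> compact_L2" by (auto simp: compact_L2_def L2_def)
  show "AE x in lborel. f x = g x"
    using AE_zero_outside_ess_support[of f] by eventually_elim (auto simp: g_def indicator_def)
qed

lemma compact_L2_compact_ess_support:
  assumes "f \<in> compact_L2"
  shows "compact (ess_support f)"
proof -
  obtain R where R: "\<And>x. \<bar>x\<bar> > R \<Longrightarrow> f x = 0" using assms by (auto simp: compact_L2_def)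
  then have "ess_support f \<subseteq> {-R..R}" by (intro ess_support_subset) auto
  then show ?thesis using closed_ess_support[of f]
    by (meson bounded_subset bounded_closed_interval compact_eq_bounded_closed)
qed

lemma compact_L2_integrable:
  assumes "f \<in> compact_L2"
  shows "integrable lborel f"
proof -
  obtain R where R: "\<And>x. \<bar>x\<bar> > R \<Longrightarrow> f x = 0" using assms by (auto simp: compact_L2_def)
  have f: "f \<in> L2" using assms by (rule compact_L2_L2)
  show ?thesis
  proof (rule integrable_dominated)
    show "integrable lborel (\<lambda>x. (cmod (f x))\<^sup>2 + indicat_real {-R..R} x)"
      using L2_square_integrable[OF f] by (auto simp: emeasure_lborel_Icc_eq)
    show "f \<in> borel_measurable borel" using f by (rule L2_measurable)
    fix x
    show "cmod (f x) \<le> (cmod (f x))\<^sup>2 + indicat_real {-R..R} x"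
    proof (cases "f x = 0")
      case False
      then have "\<bar>x\<bar> \<le> R" using R[of x] by linarith
      then have "x \<in> {-R..R}" by auto
      moreover have "cmod (f x) \<le> (cmod (f x))\<^sup>2 + 1"
        using sum_squares_bound[of "cmod (f x)" 1] norm_ge_zero[of "f x"] by (simp del: norm_ge_zero)
      ultimately show ?thesis by simp
    qed simp
  qed
qed

lemma compact_L2_add:
  assumes "f \<in> compact_L2" "g \<in> compact_L2"
  shows "(\<lambda>x. f x + g x) \<in> compact_L2"
proof -
  obtain R S where "\<And>x. \<bar>x\<bar> > R \<Longrightarrow> f x = 0" "\<And>x. \<bar>x\<bar> > S \<Longrightarrow> g x = 0"
    using assms by (auto simp: compact_L2_def)
  then have "\<forall>x. \<bar>x\<bar> > max R S \<longrightarrow> f x + g x = 0" by auto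
  then have "\<exists>R. \<forall>x. \<bar>x\<bar> > R \<longrightarrow> f x + g x = 0" by blast
  then show ?thesis using L2_add[OF assms[THEN compact_L2_L2]] by (simp add: compact_L2_def)
qed

lemma compact_L2_cmult: "f \<in> compact_L2 \<Longrightarrow> (\<lambda>x. c * f x) \<in> compact_L2"
  unfolding compact_L2_def by (auto intro: L2_cmult)

lemma compact_L2_zero: "(\<lambda>x. 0) \<in> compact_L2"
  by (simp add: compact_L2_def L2_zero)

lemma compact_L2_diff: "f \<in> compact_L2 \<Longrightarrow> g \<in> compact_L2 \<Longrightarrow> (\<lambda>x. f x - g x) \<in> compact_L2"
  using compact_L2_add[OF _ compact_L2_cmult[of g "-1"], of f] by simp

lemma compact_L2_sum: "(\<And>i. i \<in> I \<Longrightarrow> f i \<in> compact_L2) \<Longrightarrow> (\<lambda>x. \<Sum>i\<in>I. f i x) \<in> compact_L2"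
  by (induction I rule: infinite_finite_induct) (auto simp: compact_L2_zero compact_L2_add)

lemma compact_L2_translate:
  assumes "f \<in> compact_L2"
  shows "translate s f \<in> compact_L2"
proof -
  obtain R where R: "\<And>x. \<bar>x\<bar> > R \<Longrightarrow> f x = 0" using assms by (auto simp: compact_L2_def)
  have "\<forall>x. \<bar>x\<bar> > R + \<bar>s\<bar> \<longrightarrow> translate s f x = 0" using R by auto
  then show ?thesis using assms L2_translate[of f s] by (auto simp: compact_L2_def)
qed

lemma compact_L2_shift_poly:
  assumes "f \<in> compact_L2"
  shows "shift_poly s p f \<in> compact_L2"
proof -
  have "(\<lambda>x. f (x - t)) \<in> compact_L2" for t using compact_L2_translate[OF assms, of t] by (simp add: translate_def)
  then show ?thesis unfolding shift_poly_def by (intro compact_L2_sum compact_L2_cmult)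
qed

section \<open>The masks and their cascade limits\<close>

lemma cpoly_mult: "cpoly (p * r) = cpoly p * cpoly r"
  by (simp add: poly_eq_iff coeff_map_poly coeff_mult)

text \<open>A root that is not real would have real part \<open>- b / 2\<close>, and then the real part of the equation forces
  \<open>b\<^sup>2 < 4\<close>.\<close>

lemma quadratic_negative_roots:
  fixes z :: complex
  assumes b: "b \<ge> 2" and z: "1 + of_real b * z + z\<^sup>2 = 0"
  shows "Im z = 0 \<and> Re z < 0"
proof -
  obtain x y where z_eq: "z = Complex x y" by (cases z)
  have re: "1 + b * x + x\<^sup>2 - y\<^sup>2 = 0" and im: "b * y + 2 * x * y = 0"
    using z by (auto simp: z_eq complex_eq_iff power2_eq_square)
  have y: "y = 0"
  proof (rule ccontr)
    assume "y \<noteq> 0"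
    then have "b + 2 * x = 0" using im by (metis mult_eq_0_iff ring_class.ring_distribs(2))
    then have x: "x = - b / 2" by simp
    have "b\<^sup>2 \<ge> 4" using b power_mono[of 2 b 2] by simp
    moreover have "1 - b\<^sup>2 / 4 - y\<^sup>2 = 0"
      using re by (simp add: x power2_eq_square field_simps)
    moreover have "y\<^sup>2 > 0" using \<open>y \<noteq> 0\<close> by simp
    ultimately show False by simp
  qed
  have "x < 0"
  proof (rule ccontr)
    assume "\<not> x < 0"
    then have "1 + b * x + x\<^sup>2 > 0" using b by (intro add_pos_nonneg) auto
    then show False using re y by simp
  qed
  with y show ?thesis by (simp add: z_eq)
qed

text \<open>The mask of level \<open>k > 0\<close> has the symbol
  \<open>2\<^sup>-\<^sup>(\<^sup>n\<^sup>+\<^sup>1\<^sup>+\<^sup>t\<^sup>) (1 + z)\<^sup>n\<^sup>-\<^sup>1 (1 + (4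
  \<cdot> 2\<^sup>t - 2) z + z\<^sup>2)\<close> with \<open>t = k\<^sup>-\<^sup>\<mu>\<close>; one factor \<open>(1 +
  z) / 2\<close> is removed. For \<open>k = 0\<close> nothing else remains.\<close>

definition mask_factor :: "real \<Rightarrow> nat \<Rightarrow> nat \<Rightarrow> real poly" where
  "mask_factor \<mu> n k = (if k = 0 then 1 else
     smult (1 / 2 powr (real n + real k powr - \<mu>))
       ([:1, 1:] ^ (n - 2) * [:1, 4 * 2 powr (real k powr - \<mu>) - 2, 1:]))"

lemma hurwitz_masks_mask_factor:
  assumes n: "n \<ge> 2"
  shows "hurwitz_masks (mask_factor \<mu> n) n"
proof
  fix k i :: nat and z :: complex
  define t where "t = real k powr - \<mu>"
  define b where "b = 4 * 2 powr t - 2"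
  have "2 powr t \<ge> 1" by (simp add: t_def ge_one_powr_ge_zero)
  then have b: "b \<ge> 2" by (simp add: b_def)
  have qk: "mask_factor \<mu> n k = smult (1 / 2 powr (real n + t)) ([:1, 1:] ^ (n - 2) * [:1, b, 1:])" if "k \<noteq> 0"
    using that by (simp add: mask_factor_def b_def t_def)
  have lin: "coeff ([:1, 1:] :: real poly) i \<ge> 0" for i
    by (auto simp: coeff_pCons split: nat.split)
  have pow: "coeff ([:1, 1:] ^ j :: real poly) i \<ge> 0" for i j
  proof (induction j arbitrary: i)
    case (Suc j)
    then show ?case using lin by (simp add: poly_nonneg_coeffs_mult del: mult_pCons_left)
  qed (auto simp: coeff_pCons one_pCons split: nat.split)
  have quad: "coeff [:1, b, 1:] i \<ge> 0" for i
    using b by (auto simp: coeff_pCons split: nat.split)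
  show "coeff (mask_factor \<mu> n k) i \<ge> 0"
  proof (cases "k = 0")
    case False
    show ?thesis
      unfolding qk[OF False] coeff_smult
      using poly_nonneg_coeffs_mult[OF pow quad] by (intro mult_nonneg_nonneg) simp_all
  qed (simp add: mask_factor_def one_pCons coeff_pCons split: nat.split)
  show "poly (mask_factor \<mu> n k) 1 = 1"
  proof (cases "k = 0")
    case False
    have "poly (mask_factor \<mu> n k) 1 = 1 / 2 powr (real n + t) * (2 ^ (n - 2) * (2 + b))"
      by (simp add: qk[OF False] poly_power algebra_simps)
    also have "2 powr (real n + t) = 2 ^ (n - 2) * (4 * 2 powr t)"
    proof -
      have "2 ^ n = (2::real) ^ (n - 2) * 2 ^ 2"
        using n power_add[of "2::real" "n - 2" 2] by (simp only: le_add_diff_inverse2)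
      then show ?thesis by (simp add: powr_add powr_realpow)
    qed
    also have "2 + b = 4 * 2 powr t" by (simp add: b_def)
    finally show ?thesis by simp
  qed (simp add: mask_factor_def)
  show "degree (mask_factor \<mu> n k) \<le> n"
  proof (cases "k = 0")
    case False
    have "degree ([:1, 1:] ^ (n - 2) * [:1, b, 1:]) \<le> degree ([:1, 1 :: real:] ^ (n - 2)) + degree [:1, b, 1:]"
      by (rule degree_mult_le)
    also have "degree ([:1, 1 :: real:] ^ (n - 2)) \<le> degree [:1, 1 :: real:] * (n - 2)"
      by (rule degree_power_le)
    finally have "degree ([:1, 1:] ^ (n - 2) * [:1, b, 1:]) \<le> n" using n by simp
    then show ?thesis
      unfolding qk[OF False] by (rule order_trans[OF degree_smult_le])
  qed (simp add: mask_factor_def)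
  show "Im z = 0 \<and> Re z < 0" if root: "poly (cpoly (mask_factor \<mu> n k)) z = 0"
  proof (cases "k = 0")
    case False
    have smult: "cpoly (smult c p) = smult (of_real c) (cpoly p)" for c p
      by (simp add: poly_eq_iff coeff_map_poly)
    have power: "cpoly (p ^ j) = cpoly p ^ j" for p j
      by (induction j) (simp_all add: cpoly_mult)
    have "poly (cpoly (mask_factor \<mu> n k)) z =
        of_real (1 / 2 powr (real n + t)) * ((1 + z) ^ (n - 2) * (1 + of_real b * z + z\<^sup>2))"
      by (simp add: qk[OF False] smult cpoly_mult power poly_power map_poly_pCons power2_eq_square algebra_simps
            del: mult_pCons_left mult_pCons_right)
    then have "1 + z = 0 \<or> 1 + of_real b * z + z\<^sup>2 = 0" using root by auto
    then show ?thesis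
    proof
      assume "1 + z = 0"
      then have "z = - 1" by (simp add: eq_neg_iff_add_eq_0 add.commute)
      then show ?thesis by simp
    qed (use b in \<open>rule quadratic_negative_roots\<close>)
  qed (use root in \<open>simp add: mask_factor_def\<close>)
qed

lemma binomial_sum_extended:
  fixes z :: complex
  assumes "p \<le> M"
  shows "(\<Sum>\<alpha>\<le>M. of_nat (p choose \<alpha>) * z ^ \<alpha>) = (1 + z) ^ p"
proof -
  have "(1 + z) ^ p = (\<Sum>\<alpha>\<le>p. of_nat (p choose \<alpha>) * z ^ \<alpha>)"
    using binomial_ring[of z 1 p] by (simp add: add.commute)
  also have "\<dots> = (\<Sum>\<alpha>\<le>M. of_nat (p choose \<alpha>) * z ^ \<alpha>)"
    using assms by (intro sum.mono_neutral_left) (auto simp: binomial_eq_0)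
  finally show ?thesis ..
qed

lemma mask_symbol_eq:
  assumes n: "n \<ge> 2"
  shows "mask_symbol \<mu> n k z = poly (cpoly (hurwitz_masks.mask_poly (mask_factor \<mu> n) k)) z"
proof -
  interpret hurwitz_masks "mask_factor \<mu> n" n using n by (rule hurwitz_masks_mask_factor)
  have factor: "poly (cpoly (mask_poly k)) z = (1 + z) / 2 * poly (cpoly (mask_factor \<mu> n k)) z"
    unfolding mask_poly_def cpoly_mult poly_mult by (simp add: map_poly_pCons field_simps)
  show ?thesis
  proof (cases "k = 0")
    case True
    have "mask_symbol \<mu> n k z = (\<Sum>\<alpha>\<le>1. of_real (mask \<mu> n k \<alpha>) * z ^ \<alpha>)"
      unfolding mask_symbol_def by (intro sum.mono_neutral_right) (auto simp: mask_def True)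
    also have "\<dots> = (1 + z) / 2" by (simp add: mask_def True field_simps)
    finally show ?thesis unfolding factor by (simp add: True mask_factor_def)
  next
    case False
    define t where "t = real k powr - \<mu>"
    define c where "c = 1 / 2 powr (real n + 1 + t)"
    define d where "d = 4 * (2 powr t - 1)"
    have "mask_symbol \<mu> n k z =
       (\<Sum>\<alpha>\<le>n + 1. of_real c * (of_nat ((n + 1) choose \<alpha>) * z ^ \<alpha>
          + of_real d * ((if \<alpha> = 0 then 0 else of_nat ((n - 1) choose (\<alpha> - 1))) * z ^ \<alpha>)))"
      unfolding mask_symbol_def using False
      by (intro sum.cong) (auto simp: mask_def c_def d_def t_def algebra_simps)
    also have "\<dots> = of_real c * ((1 + z) ^ (n + 1) +
        of_real d * (\<Sum>\<alpha>\<le>n + 1. (if \<alpha> = 0 then 0 else of_nat ((n - 1) choose (\<alpha> - 1))) * z ^ \<alpha>))"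
      unfolding sum_distrib_left[symmetric] sum.distrib by (simp add: binomial_sum_extended del: sum.atMost_Suc)
    also have "(\<Sum>\<alpha>\<le>n + 1. (if \<alpha> = 0 then 0 else of_nat ((n - 1) choose (\<alpha> - 1))) * z ^ \<alpha>)
        = z * (\<Sum>\<alpha>\<le>n. of_nat ((n - 1) choose \<alpha>) * z ^ \<alpha>)"
      by (simp add: sum.atMost_Suc_shift sum_distrib_left algebra_simps del: sum.atMost_Suc)
    also have "(\<Sum>\<alpha>\<le>n. of_nat ((n - 1) choose \<alpha>) * z ^ \<alpha>) = (1 + z) ^ (n - 1)"
      by (rule binomial_sum_extended) simp
    also have "of_real c * ((1 + z) ^ (n + 1) + of_real d * (z * (1 + z) ^ (n - 1)))
        = (1 + z) / 2 * poly (cpoly (mask_factor \<mu> n k)) z"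
    proof -
      obtain j where j: "n = Suc (Suc j)" using n by (metis Suc_le_D numeral_2_eq_2 Suc_le_mono le_Suc_ex add_2_eq_Suc)
      have smult: "cpoly (smult c p) = smult (of_real c) (cpoly p)" for c p
        by (simp add: poly_eq_iff coeff_map_poly)
      have power: "cpoly (p ^ j) = cpoly p ^ j" for p j
        by (induction j) (simp_all add: cpoly_mult)
      have "1 / 2 powr (real n + t) = 2 * c"
        by (simp add: c_def powr_add)
      moreover have "4 * 2 powr t - 2 = 2 + d" by (simp add: d_def)
      ultimately have "mask_factor \<mu> n k = smult (2 * c) ([:1, 1:] ^ j * [:1, 2 + d, 1:])"
        using False by (simp only: mask_factor_def t_def j if_False diff_Suc_Suc diff_0 numeral_2_eq_2 minus_nat.diff_0)
      then have "poly (cpoly (mask_factor \<mu> n k)) z = 2 * of_real c * ((1 + z) ^ j * (1 + z * (2 + of_real d + z)))"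
        by (simp add: smult cpoly_mult power poly_power map_poly_pCons del: mult_pCons_left mult_pCons_right)
      then show ?thesis by (simp add: j field_simps power2_eq_square)
    qed
    finally show ?thesis unfolding factor .
  qed
qed

text \<open>Compact support makes both functions integrable, so their equal Fourier transforms determine them.\<close>

lemma refinable_function_eq_cascade_limit:
  assumes n: "n \<ge> 2" and f: "refinable_function \<mu> n k f"
  shows "AE x in lborel. f x = complex_of_real (hurwitz_masks.limit_fun (mask_factor \<mu> n) k x)"
proof -
  interpret hurwitz_masks "mask_factor \<mu> n" n using n by (rule hurwitz_masks_mask_factor)
  have "f \<in> L2" "compact (ess_support f)" using f by (auto simp: refinable_function_def)
  then obtain g where g: "g \<in> compact_L2" "AE x in lborel. f x = g x" by (rule compact_L2_representative)
  have "fourier g \<omega> = fourier (limit_cfun k) \<omega>" for \<omega>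
  proof -
    have [measurable]: "(\<lambda>x. cis (- (\<omega> * x))) \<in> borel_measurable borel"
      by (intro borel_measurable_continuous_onI continuous_intros)
    have [measurable]: "f \<in> borel_measurable borel" "g \<in> borel_measurable borel"
      using \<open>f \<in> L2\<close> g(1) by (auto intro: L2_measurable compact_L2_L2)
    have "fourier g \<omega> = fourier f \<omega>"
      unfolding fourier_def
    proof (rule integral_cong_AE)
      show "AE x in lborel. g x * cis (- (\<omega> * x)) = f x * cis (- (\<omega> * x))"
        using g(2) by eventually_elim simp
    qed simp_all
    also have "\<dots> = fourier (limit_cfun k) \<omega>"
      using f by (simp add: refinable_function_def mask_symbol_eq[OF n] fourier_limit_fun)
    finally show ?thesis .
  qed
  then have "AE x in lborel. g x = limit_cfun k x"
    using compact_L2_integrable[OF g(1)] limit_fun_integrable by (intro AE_eq_of_fourier_eq) auto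
  with g(2) show ?thesis by eventually_elim simp
qed

lemma (in hurwitz_masks) limit_cfun_compact_L2: "limit_cfun m \<in> compact_L2"
proof -
  have "limit_fun m x = 0" if "\<bar>x\<bar> > real (N + 1) / 2 ^ m" for x
    using that by (intro limit_fun_support) auto
  then show ?thesis using limit_cfun_L2 by (auto simp: compact_L2_def)
qed

section \<open>Laurent polynomials of correlation sequences\<close>

lemma finite_int_support_bound:
  fixes c :: "int \<Rightarrow> complex"
  assumes "finite {k. c k \<noteq> 0}"
  shows "\<exists>M::nat. \<forall>k. \<bar>k\<bar> > int M \<longrightarrow> c k = 0"
proof -
  define M where "M = (\<Sum>k | c k \<noteq> 0. nat \<bar>k\<bar>)"
  have "nat \<bar>k\<bar> \<le> M" if "c k \<noteq> 0" for k
    unfolding M_def using assms that by (intro member_le_sum) auto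
  then show ?thesis by (intro exI[of _ M]) (auto simp: not_le[symmetric] nat_le_iff)
qed

definition laurent :: "(int \<Rightarrow> complex) \<Rightarrow> complex \<Rightarrow> complex" where
  "laurent c z = (\<Sum>k | c k \<noteq> 0. c k * z powi k)"

lemma laurent_superset:
  assumes "finite A" "\<And>k. k \<notin> A \<Longrightarrow> c k = 0"
  shows "laurent c z = (\<Sum>k\<in>A. c k * z powi k)"
  unfolding laurent_def using assms by (intro sum.mono_neutral_left) auto

lemma laurent_add:
  assumes "finite {k. c k \<noteq> 0}" "finite {k. d k \<noteq> 0}"
  shows "laurent (\<lambda>k. c k + d k) z = laurent c z + laurent d z"
proof -
  define A where "A = {k. c k \<noteq> 0} \<union> {k. d k \<noteq> 0}"
  have "finite A" using assms by (simp add: A_def)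
  then show ?thesis
    by (subst (1 2 3) laurent_superset[of A]) (auto simp: A_def distrib_right sum.distrib)
qed

lemma laurent_cmult: "laurent (\<lambda>k. a * c k) z = a * laurent c z"
  by (cases "a = 0") (auto simp: laurent_def sum_distrib_left mult.assoc)

lemma laurent_shift:
  assumes "z \<noteq> 0"
  shows "laurent (\<lambda>k. c (k + j)) z = laurent c z / z powi j"
proof -
  have "laurent c z = (\<Sum>k | c (k + j) \<noteq> 0. c (k + j) * z powi (k + j))"
    unfolding laurent_def
    by (rule sum.reindex_bij_witness[of _ "\<lambda>k. k + j" "\<lambda>k. k - j"]) auto
  also have "\<dots> = laurent (\<lambda>k. c (k + j)) z * z powi j"
    using assms by (simp add: laurent_def sum_distrib_right power_int_add mult.assoc)
  finally show ?thesis using assms by simp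
qed

text \<open>The terms of odd index cancel between the two square roots of the argument.\<close>

lemma laurent_decimate:
  assumes fin: "finite {k. c k \<noteq> 0}" and z: "z \<noteq> 0"
  shows "laurent (\<lambda>k. c (2 * k)) (z\<^sup>2) = (laurent c z + laurent c (- z)) / 2"
proof -
  define A where "A = {k. c k \<noteq> 0}"
  have odd_even: "(- z) powi k = (if even k then z powi k else - (z powi k))" for k :: int
    by (auto simp: power_int_minus_left)
  have "laurent c z + laurent c (- z) = (\<Sum>k\<in>A. c k * z powi k + c k * (- z) powi k)"
    by (simp add: laurent_def A_def sum.distrib)
  also have "\<dots> = (\<Sum>k\<in>A. if even k then 2 * (c k * z powi k) else 0)"
    by (intro sum.cong) (auto simp: odd_even)
  also have "\<dots> = (\<Sum>k\<in>{k\<in>A. even k}. 2 * (c k * z powi k))"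
    by (rule sum.inter_filter[symmetric]) (use fin in \<open>simp add: A_def\<close>)
  also have "\<dots> = (\<Sum>k | c (2 * k) \<noteq> 0. 2 * (c (2 * k) * z powi (2 * k)))"
    by (rule sum.reindex_bij_witness[of _ "\<lambda>k. 2 * k" "\<lambda>k. k div 2"]) (auto simp: A_def)
  also have "\<dots> = 2 * laurent (\<lambda>k. c (2 * k)) (z\<^sup>2)"
    by (simp add: laurent_def sum_distrib_left power_int_mult)
  finally show ?thesis by simp
qed

text \<open>The symbol of a sequence supported in \<open>{- M..M}\<close>, multiplied by \<open>z\<^sup>M\<close> to become a
  polynomial.\<close>

definition laurent_poly :: "nat \<Rightarrow> (int \<Rightarrow> complex) \<Rightarrow> complex poly" where
  "laurent_poly M c = (\<Sum>i\<le>2 * M. monom (c (int i - int M)) i)"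

lemma coeff_laurent_poly: "coeff (laurent_poly M c) i = (if i \<le> 2 * M then c (int i - int M) else 0)"
  by (simp add: laurent_poly_def coeff_sum)

lemma degree_laurent_poly: "degree (laurent_poly M c) \<le> 2 * M"
  by (rule degree_le) (simp add: coeff_laurent_poly)

lemma sum_symmetric_int:
  fixes F :: "int \<Rightarrow> 'a::comm_monoid_add"
  shows "(\<Sum>k\<in>{- int M..int M}. F k) = (\<Sum>i\<le>2 * M. F (int i - int M))"
  by (rule sum.reindex_bij_witness[of _ "\<lambda>i. int i - int M" "\<lambda>k. nat (k + int M)"]) auto

lemma poly_laurent_poly:
  assumes c: "\<And>k. \<bar>k\<bar> > int M \<Longrightarrow> c k = 0" and z: "z \<noteq> 0"
  shows "poly (laurent_poly M c) z = laurent c z * z ^ M"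
proof -
  have "laurent c z = (\<Sum>k\<in>{- int M..int M}. c k * z powi k)"
    using c by (intro laurent_superset) auto
  then show ?thesis
    using z by (simp add: sum_symmetric_int laurent_poly_def poly_sum poly_monom sum_distrib_right power_int_diff)
qed

lemma shift_poly_laurent_poly:
  "shift_poly s (laurent_poly M c) f (x + real M * s) = (\<Sum>k\<in>{- int M..int M}. c k * f (x - of_int k * s))"
  unfolding shift_poly_altdef[OF degree_laurent_poly] sum_symmetric_int
  by (intro sum.cong) (auto simp: coeff_laurent_poly algebra_simps)

definition correlation :: "real \<Rightarrow> (real \<Rightarrow> complex) \<Rightarrow> (real \<Rightarrow> complex) \<Rightarrow> int \<Rightarrow> complex" where
  "correlation h f g k = (LINT x|lborel. f x * g (x + of_int k * h))"

lemma correlation_integrable: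
  assumes "f \<in> compact_L2" "g \<in> compact_L2"
  shows "integrable lborel (\<lambda>x. f x * g (x + t))"
proof -
  have "(\<lambda>x. cnj (g (x + t))) \<in> L2"
    using L2_translate[OF compact_L2_L2[OF assms(2)], of "-t"] by (auto simp: L2_def translate_def)
  from L2_inner_integrable[OF compact_L2_L2[OF assms(1)] this] show ?thesis by simp
qed

lemma correlation_finite:
  assumes f: "f \<in> compact_L2" and g: "g \<in> compact_L2" and h: "h > 0"
  shows "finite {k. correlation h f g k \<noteq> 0}"
proof -
  obtain R S where R: "\<And>x. \<bar>x\<bar> > R \<Longrightarrow> f x = 0" and S: "\<And>x. \<bar>x\<bar> > S \<Longrightarrow> g x = 0"
    using f g by (auto simp: compact_L2_def)
  define M where "M = \<lceil>(R + S) / h\<rceil>"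
  have "correlation h f g k = 0" if "\<bar>k\<bar> > M" for k
  proof -
    have "real_of_int \<bar>k\<bar> > (R + S) / h" using that unfolding M_def by linarith
    then have big: "real_of_int \<bar>k\<bar> * h > R + S" using h by (simp add: field_simps)
    have "(\<lambda>x. f x * g (x + of_int k * h)) = (\<lambda>x. 0)"
    proof (rule ext, rule ccontr)
      fix x assume "f x * g (x + of_int k * h) \<noteq> 0"
      then have "\<bar>x\<bar> \<le> R" "\<bar>x + of_int k * h\<bar> \<le> S" using R S by (force simp: not_less)+
      then have "\<bar>of_int k * h\<bar> \<le> R + S" by linarith
      then show False using big h by (simp add: abs_mult)
    qed
    then show ?thesis unfolding correlation_def by simp
  qed
  then have "k \<in> {-M..M}" if "correlation h f g k \<noteq> 0" for k
    using that by (metis abs_le_iff atLeastAtMost_iff minus_le_iff not_le)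
  then have "{k. correlation h f g k \<noteq> 0} \<subseteq> {-M..M}" by blast
  then show ?thesis by (rule finite_subset) simp
qed

lemma correlation_translate_left: "correlation h (translate h f) g k = correlation h f g (k + 1)"
proof -
  have "correlation h (translate h f) g k = (LINT x|lborel. f (x - h) * g (x - h + of_int (k + 1) * h))"
    by (simp add: correlation_def algebra_simps)
  also have "\<dots> = correlation h f g (k + 1)"
    unfolding correlation_def by (rule integral_shift)
  finally show ?thesis .
qed

lemma correlation_swap: "correlation h f g k = correlation h g f (- k)"
proof -
  have "correlation h f g k = (LINT x|lborel. f (x - of_int k * h) * g (x - of_int k * h + of_int k * h))"
    unfolding correlation_def by (rule integral_shift[symmetric])
  then show ?thesis by (simp add: correlation_def mult.commute)
qed

lemma laurent_reflect: "laurent (\<lambda>k. c (- k)) z = laurent c (1 / z)"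
  unfolding laurent_def
  by (rule sum.reindex_bij_witness[of _ uminus uminus]) (auto simp: power_int_minus power_int_divide_distrib field_simps)

lemma shift_poly_pCons_fun: "shift_poly s (pCons a p) f = (\<lambda>x. a * f x + translate s (shift_poly s p f) x)"
  by (simp add: fun_eq_iff shift_poly_pCons)

text \<open>A translation of the first function is undone by a translation of the second in the opposite direction, which is why
  the reciprocal argument appears.\<close>

lemma laurent_correlation_shift_poly_left:
  assumes f: "f \<in> compact_L2" and g: "g \<in> compact_L2" and h: "h > 0" and z: "z \<noteq> 0"
  shows "laurent (correlation h (shift_poly h p f) g) z = poly p (1 / z) * laurent (correlation h f g) z"
proof (induction p)
  case 0
  then show ?case by (simp add: laurent_def correlation_def)
next
  case (pCons a p)
  have "correlation h (shift_poly h (pCons a p) f) g = (\<lambda>k. a * correlation h f g k + correlation h (shift_poly h p f) g (k + 1))"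
  proof
    fix k
    have "correlation h (shift_poly h (pCons a p) f) g k =
       (LINT x|lborel. a * (f x * g (x + of_int k * h)) + translate h (shift_poly h p f) x * g (x + of_int k * h))"
      by (simp add: correlation_def shift_poly_pCons_fun algebra_simps)
    also have "\<dots> = a * correlation h f g k + correlation h (translate h (shift_poly h p f)) g k"
      unfolding correlation_def
      using correlation_integrable[OF f g] correlation_integrable[OF compact_L2_translate[OF compact_L2_shift_poly[OF f]] g]
      by (subst Bochner_Integration.integral_add) (auto simp del: translate_apply)
    finally show "correlation h (shift_poly h (pCons a p) f) g k = a * correlation h f g k + correlation h (shift_poly h p f) g (k + 1)"
      by (simp only: correlation_translate_left)
  qed
  moreover have "finite {k. a * correlation h f g k \<noteq> 0}"
    by (rule finite_subset[OF _ correlation_finite[OF f g h]]) auto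
  moreover have "finite {k. correlation h (shift_poly h p f) g (k + 1) \<noteq> 0}"
  proof -
    have "finite {k. correlation h (translate h (shift_poly h p f)) g k \<noteq> 0}"
      using compact_L2_translate[OF compact_L2_shift_poly[OF f]] g h by (rule correlation_finite)
    then show ?thesis by (simp only: correlation_translate_left)
  qed
  ultimately have "laurent (correlation h (shift_poly h (pCons a p) f) g) z =
      a * laurent (correlation h f g) z + laurent (correlation h (shift_poly h p f) g) z / z"
    using laurent_shift[OF z, of "correlation h (shift_poly h p f) g" 1] by (simp add: laurent_add laurent_cmult)
  then show ?case using pCons.IH by (simp add: field_simps)
qed

lemma laurent_correlation_shift_poly_right:
  assumes f: "f \<in> compact_L2" and g: "g \<in> compact_L2" and h: "h > 0" and z: "z \<noteq> 0"
  shows "laurent (correlation h f (shift_poly h p g)) z = poly p z * laurent (correlation h f g) z"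
proof -
  have "laurent (correlation h f (shift_poly h p g)) z = laurent (correlation h (shift_poly h p g) f) (1 / z)"
    unfolding laurent_reflect[symmetric] correlation_swap[symmetric] ..
  also have "\<dots> = poly p z * laurent (correlation h g f) (1 / z)"
    using laurent_correlation_shift_poly_left[OF g f h, of "1 / z"] z by simp
  also have "laurent (correlation h g f) (1 / z) = laurent (correlation h f g) z"
    unfolding laurent_reflect[symmetric] correlation_swap[symmetric] ..
  finally show ?thesis .
qed

section \<open>Polynomials with nonpositive real roots\<close>

lemma complex_poly_induct [case_names const root]:
  fixes p :: "complex poly"
  assumes const: "\<And>c. P [:c:]" and root: "\<And>r p. P p \<Longrightarrow> P ([:- r, 1:] * p)"
  shows "P p"
proof (induction "degree p" arbitrary: p rule: less_induct)
  case less
  show ?case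
  proof (cases "degree p = 0")
    case True
    then show ?thesis using const by (metis degree_eq_zeroE)
  next
    case False
    then have "\<not> constant (poly p)" by (simp add: constant_degree)
    then obtain r where "poly p r = 0" using fundamental_theorem_of_algebra by blast
    then obtain s where s: "p = [:- r, 1:] * s" by (auto simp: poly_eq_0_iff_dvd)
    have "s \<noteq> 0" using s False by auto
    then have "degree p = Suc (degree s)" unfolding s by (subst degree_mult_eq) auto
    then have "P s" by (intro less) simp
    then have "P ([:- r, 1:] * s)" by (rule root)
    with s show ?thesis by simp
  qed
qed

text \<open>Each linear factor \<open>z - r\<close> with \<open>r \<le> 0\<close> is at least as large at \<open>w\<close> as at
  the reflected point \<open>- w\<close>.\<close>

lemma nonpos_roots_compare:
  fixes p :: "complex poly"
  assumes roots: "\<And>z. poly p z = 0 \<Longrightarrow> z \<in> \<real>\<^sub>\<le>\<^sub>0" and w: "Re w > 0"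
  shows "cmod (poly p (- w)) \<le> cmod (poly p w)"
  using roots
proof (induction p rule: complex_poly_induct)
  case (root r p)
  have "r \<in> \<real>\<^sub>\<le>\<^sub>0" using root.prems[of r] by simp
  then have r: "Re r \<le> 0" "Im r = 0" by (auto simp: complex_nonpos_Reals_iff)
  have "(Re w + Re r)\<^sup>2 \<le> (Re w - Re r)\<^sup>2"
    using mult_nonneg_nonpos[of "Re w" "Re r"] r w by (simp add: power2_eq_square algebra_simps)
  then have "cmod (- w - r) \<le> cmod (w - r)"
    using r by (simp add: cmod_def power2_eq_square algebra_simps)
  moreover have "cmod (poly p (- w)) \<le> cmod (poly p w)"
    using root.prems by (intro root.IH) simp
  ultimately have "cmod (- w - r) * cmod (poly p (- w)) \<le> cmod (w - r) * cmod (poly p w)"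
    by (intro mult_mono) auto
  then show ?case by (simp add: algebra_simps flip: norm_mult)
qed simp

text \<open>The factor depends only on \<open>z\<close> and the degree, so no root can appear at \<open>z\<close> in a limit of
  polynomials with nonpositive roots and bounded degree. This replaces Hurwitz's theorem.\<close>

lemma nonpos_roots_lower_bound:
  fixes z :: complex
  assumes z: "z \<notin> \<real>\<^sub>\<le>\<^sub>0"
  shows "\<exists>\<kappa>. 0 < \<kappa> \<and> \<kappa> \<le> 1 \<and>
    (\<forall>p. (\<forall>u. poly p u = 0 \<longrightarrow> u \<in> \<real>\<^sub>\<le>\<^sub>0) \<longrightarrow>
      \<kappa> ^ degree p * cmod (poly p 1) \<le> cmod (poly p z))"
proof -
  obtain \<delta> where \<delta>: "\<delta> > 0" "ball z \<delta> \<subseteq> - \<real>\<^sub>\<le>\<^sub>0"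
    using z open_Compl[OF closed_nonpos_Reals_complex] by (meson Compl_iff openE)
  define \<kappa> where "\<kappa> = 1 / (1 + (1 + cmod z) / \<delta>)"
  have denom: "1 + (1 + cmod z) / \<delta> > 0" using \<delta> by (intro add_pos_nonneg) auto
  have pos: "0 < \<kappa>" "\<kappa> \<le> 1" using \<delta> denom by (auto simp: \<kappa>_def)
  have "\<kappa> ^ degree p * cmod (poly p 1) \<le> cmod (poly p z)"
    if "\<And>u. poly p u = 0 \<Longrightarrow> u \<in> \<real>\<^sub>\<le>\<^sub>0" for p
    using that
  proof (induction p rule: complex_poly_induct)
    case (root r p)
    show ?case
    proof (cases "p = 0")
      case False
      have r: "r \<in> \<real>\<^sub>\<le>\<^sub>0" using root.prems[of r] by simp
      then have "\<delta> \<le> cmod (z - r)" using \<delta>(2) by (auto simp: dist_norm subset_iff not_less[symmetric])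
      then have "(1 + cmod z) \<le> (1 + cmod z) / \<delta> * cmod (z - r)"
        using \<delta>(1) mult_left_mono[of \<delta> "cmod (z - r)" "1 + cmod z"] by (simp add: field_simps)
      moreover have "cmod (1 - r) \<le> 1 + cmod z + cmod (z - r)"
        using norm_triangle_ineq4[of 1 r] norm_triangle_ineq4[of z "z - r"] by simp
      ultimately have "cmod (1 - r) \<le> (1 + (1 + cmod z) / \<delta>) * cmod (z - r)"
        by (simp add: distrib_right)
      then have "\<kappa> * cmod (1 - r) \<le> cmod (z - r)"
        using denom by (simp add: \<kappa>_def divide_le_eq mult.commute)
      moreover have "\<kappa> ^ degree p * cmod (poly p 1) \<le> cmod (poly p z)"
        using root.prems by (intro root.IH) simp
      ultimately have "(\<kappa> * cmod (1 - r)) * (\<kappa> ^ degree p * cmod (poly p 1)) \<le> cmod (z - r) * cmod (poly p z)"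
        using pos by (intro mult_mono) auto
      moreover have "degree ([:- r, 1:] * p) = Suc (degree p)"
        using False by (subst degree_mult_eq) auto
      moreover have "poly ([:- r, 1:] * p) 1 = (1 - r) * poly p 1"
        "poly ([:- r, 1:] * p) z = (z - r) * poly p z" by (simp_all add: algebra_simps)
      ultimately show ?thesis by (simp only: norm_mult power_Suc mult_ac)
    qed simp
  qed simp
  with pos show ?thesis by blast
qed

section \<open>Roots of the autocorrelation symbols\<close>

context hurwitz_masks
begin

abbreviation cascade_autocorr :: "nat \<Rightarrow> nat \<Rightarrow> complex \<Rightarrow> complex" where
  "cascade_autocorr j m \<equiv> laurent (correlation (1 / 2 ^ m) (cascade_cfun j m) (cascade_cfun j m))"

abbreviation limit_autocorr :: "nat \<Rightarrow> complex \<Rightarrow> complex" where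
  "limit_autocorr m \<equiv> laurent (correlation (1 / 2 ^ m) (limit_cfun m) (limit_cfun m))"

lemma cascade_cfun_compact_L2: "cascade_cfun j m \<in> compact_L2"
proof -
  have "cascade_fun j m x = 0" if "\<bar>x\<bar> > real (N + 1) / 2 ^ m" for x
    using that by (intro cascade_fun_support) auto
  moreover have "cascade_cfun j m \<in> L2"
    using cascade_fun_integrable cascade_fun_nonneg cascade_fun_le by (rule L2_of_real_bounded)
  ultimately show ?thesis by (auto simp: compact_L2_def)
qed

lemma correlation_support:
  assumes f: "\<And>x. x \<notin> {0..<real (N + 1) / 2 ^ m} \<Longrightarrow> f x = 0" and k: "\<bar>k\<bar> > int (N + 1)"
  shows "f x * f (x + of_int k * (1 / 2 ^ m)) = (0 :: 'a::mult_zero)"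
proof (rule ccontr)
  assume "f x * f (x + of_int k * (1 / 2 ^ m)) \<noteq> 0"
  then have "f x \<noteq> 0" "f (x + of_int k * (1 / 2 ^ m)) \<noteq> 0" by auto
  then have "x \<in> {0..<real (N + 1) / 2 ^ m}" "x + of_int k * (1 / 2 ^ m) \<in> {0..<real (N + 1) / 2 ^ m}"
    using f by blast+
  then have "\<bar>of_int k * (1 / 2 ^ m)\<bar> < real (N + 1) / 2 ^ m"
    by (simp only: atLeastLessThan_iff) linarith
  then have "real_of_int \<bar>k\<bar> < real (N + 1)"
    by (simp add: abs_mult divide_less_cancel)
  with k show False by linarith
qed

lemma correlation_cascade_fun_support: "\<bar>k\<bar> > int (N + 1) \<Longrightarrow> correlation (1 / 2 ^ m) (cascade_cfun j m) (cascade_cfun j m) k = 0"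
  unfolding correlation_def by (subst correlation_support) (auto simp: cascade_fun_support)

lemma correlation_limit_fun_support: "\<bar>k\<bar> > int (N + 1) \<Longrightarrow> correlation (1 / 2 ^ m) (limit_cfun m) (limit_cfun m) k = 0"
  unfolding correlation_def by (subst correlation_support) (auto simp: limit_fun_support)

lemma mask_poly_roots:
  assumes "poly (cpoly (mask_poly k)) z = 0"
  shows "Im z = 0 \<and> Re z < 0"
proof -
  have "poly (cpoly (mask_poly k)) z = (1 + z) / 2 * poly (cpoly (q k)) z"
    unfolding mask_poly_def cpoly_mult poly_mult by (simp add: map_poly_pCons field_simps)
  then have "z = - 1 \<or> poly (cpoly (q k)) z = 0"
    using assms by (auto simp: add_eq_0_iff)
  then show ?thesis using q_roots by auto
qed

lemma mask_poly_minus_1: "poly (cpoly (mask_poly k)) (- 1) = 0"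
  unfolding mask_poly_def cpoly_mult poly_mult by (simp add: map_poly_pCons)

lemma mask_poly_nonpos_roots: "poly (cpoly (mask_poly k)) z = 0 \<Longrightarrow> z \<in> \<real>\<^sub>\<le>\<^sub>0"
  using mask_poly_roots[of k z] by (auto simp: complex_nonpos_Reals_iff)

text \<open>The factor \<open>(1 + z) / 2\<close> makes the comparison of \<open>w\<close> with \<open>- w\<close> strict.\<close>

lemma mask_poly_strict_compare:
  assumes w: "Re w > 0"
  shows "cmod (poly (cpoly (mask_poly k)) (- w)) < cmod (poly (cpoly (mask_poly k)) w)"
proof -
  have factor: "poly (cpoly (mask_poly k)) z = (1 + z) / 2 * poly (cpoly (q k)) z" for z
    unfolding mask_poly_def cpoly_mult poly_mult by (simp add: map_poly_pCons field_simps)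
  have "poly (cpoly (q k)) w \<noteq> 0" using q_roots[of k w] w by auto
  moreover have "cmod (poly (cpoly (q k)) (- w)) \<le> cmod (poly (cpoly (q k)) w)"
    using q_roots w by (intro nonpos_roots_compare) (auto simp: complex_nonpos_Reals_iff less_imp_le)
  moreover have "cmod (1 - w) < cmod (1 + w)"
    using w by (simp add: cmod_def power2_eq_square algebra_simps)
  ultimately have "cmod (1 - w) * cmod (poly (cpoly (q k)) (- w)) < cmod (1 + w) * cmod (poly (cpoly (q k)) w)"
    by (meson mult_left_mono mult_strict_right_mono norm_ge_zero order.strict_trans1 zero_less_norm_iff)
  then show ?thesis by (simp add: factor norm_mult norm_divide)
qed

text \<open>On the fine grid both refinements contribute one mask factor; the coarse grid then selects the even indices.\<close>

lemma cascade_autocorr_refine: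
  assumes z: "z \<noteq> 0"
  shows "cascade_autocorr (Suc j) m (z\<^sup>2) =
    (poly (cpoly (mask_poly m)) (1 / z) * poly (cpoly (mask_poly m)) z * cascade_autocorr j (Suc m) z +
     poly (cpoly (mask_poly m)) (1 / (- z)) * poly (cpoly (mask_poly m)) (- z) * cascade_autocorr j (Suc m) (- z)) / 2"
proof -
  define h :: real where "h = 1 / 2 ^ Suc m"
  have h: "h > 0" by (simp add: h_def)
  let ?F = "cascade_cfun (Suc j) m" and ?G = "cascade_cfun j (Suc m)" and ?A = "cpoly (mask_poly m)"
  have FG: "?F = shift_poly h ?A ?G" unfolding h_def by (rule cascade_cfun_refine)
  have two_h: "(1::real) / 2 ^ m = 2 * h" by (simp add: h_def)
  have "correlation (1 / 2 ^ m) ?F ?F = (\<lambda>k. correlation h ?F ?F (2 * k))"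
    by (simp add: fun_eq_iff correlation_def two_h algebra_simps)
  moreover have symbol: "laurent (correlation h ?F ?F) u = poly ?A (1 / u) * poly ?A u * laurent (correlation h ?G ?G) u"
    if "u \<noteq> 0" for u
    unfolding FG using that h cascade_cfun_compact_L2[of j "Suc m"]
    by (subst laurent_correlation_shift_poly_left; (subst laurent_correlation_shift_poly_right)?) (auto intro: compact_L2_shift_poly)
  ultimately have "cascade_autocorr (Suc j) m (z\<^sup>2) = (laurent (correlation h ?F ?F) z + laurent (correlation h ?F ?F) (- z)) / 2"
    using laurent_decimate[OF correlation_finite[OF cascade_cfun_compact_L2 cascade_cfun_compact_L2 h] z, of "Suc j" m "Suc j" m] by (simp only:)
  then show ?thesis using z by (subst (asm) (1 2) symbol) (simp_all add: h_def)
qed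

text \<open>A Hermite--Biehler argument. For \<open>z = w\<^sup>2\<close> with \<open>Re w > 0\<close> each of the three factors
  at \<open>w\<close> dominates its counterpart at \<open>- w\<close>, the mask factor strictly, so the average over
  \<open>w\<close> and \<open>- w\<close> does not vanish. The induction starts with the constant symbol of the box
  function.\<close>

lemma cascade_autocorr_nonzero: "z \<notin> \<real>\<^sub>\<le>\<^sub>0 \<Longrightarrow> cascade_autocorr j m z \<noteq> 0"
proof (induction j arbitrary: m z)
  case 0
  have "correlation (1 / 2 ^ m) (cascade_cfun 0 m) (cascade_cfun 0 m) k = (if k = 0 then 2 ^ m else 0)" for k
  proof (cases "k = 0")
    case True
    have "(\<lambda>x. cascade_cfun 0 m x * cascade_cfun 0 m (x + of_int 0 * (1 / 2 ^ m))) =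
        (\<lambda>x. complex_of_real (2 ^ m * cascade_fun 0 m x))"
      by (auto simp: cascade_fun_0 indicator_def)
    then have "correlation (1 / 2 ^ m) (cascade_cfun 0 m) (cascade_cfun 0 m) 0 = complex_of_real (LINT x|lborel. 2 ^ m * cascade_fun 0 m x)"
      unfolding correlation_def by (simp only: integral_complex_of_real)
    then show ?thesis using True by (simp add: cascade_fun_0_integral)
  next
    case False
    have "(\<lambda>x. cascade_cfun 0 m x * cascade_cfun 0 m (x + of_int k * (1 / 2 ^ m))) = (\<lambda>x. 0)"
    proof (rule ext, rule ccontr)
      fix x assume "cascade_cfun 0 m x * cascade_cfun 0 m (x + of_int k * (1 / 2 ^ m)) \<noteq> 0"
      then have "x \<in> {0..<1 / 2 ^ m}" "x + of_int k * (1 / 2 ^ m) \<in> {0..<1 / 2 ^ m}"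
        by (auto simp: cascade_fun_0 indicator_def split: if_splits)
      then have "\<bar>of_int k * (1 / 2 ^ m)\<bar> < (1::real) / 2 ^ m"
        by (simp only: atLeastLessThan_iff) linarith
      then have "real_of_int \<bar>k\<bar> < 1" by (simp add: abs_mult divide_less_cancel)
      with False show False by linarith
    qed
    then show ?thesis using False unfolding correlation_def by simp
  qed
  note c = this
  have "cascade_autocorr 0 m z = (\<Sum>k\<in>{0}. correlation (1 / 2 ^ m) (cascade_cfun 0 m) (cascade_cfun 0 m) k * z powi k)"
    by (rule laurent_superset) (auto simp: c)
  also have "\<dots> = 2 ^ m" by (simp add: c)
  finally show ?case by simp
next
  case (Suc j)
  define w where "w = csqrt z"
  have z: "z = w\<^sup>2" by (simp add: w_def)
  have "Re w \<noteq> 0"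
  proof
    assume "Re w = 0"
    then have "z \<in> \<real>\<^sub>\<le>\<^sub>0" by (simp add: z complex_nonpos_Reals_iff power2_eq_square)
    with Suc.prems show False by simp
  qed
  then have w: "Re w > 0" using csqrt_principal[of z] by (auto simp: w_def)
  then have w0: "w \<noteq> 0" and wn: "w \<notin> \<real>\<^sub>\<le>\<^sub>0" by (auto simp: complex_nonpos_Reals_iff)
  let ?A = "poly (cpoly (mask_poly m))" and ?\<Phi> = "cascade_autocorr j (Suc m)"
  define p where "p = laurent_poly (N + 1) (correlation (1 / 2 ^ Suc m) (cascade_cfun j (Suc m)) (cascade_cfun j (Suc m)))"
  have p: "poly p z = ?\<Phi> z * z ^ (N + 1)" if "z \<noteq> 0" for z
    unfolding p_def using that correlation_cascade_fun_support by (intro poly_laurent_poly)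
  have p_roots: "u \<in> \<real>\<^sub>\<le>\<^sub>0" if "poly p u = 0" for u
    using that p[of u] Suc.IH[of u "Suc m"] by (cases "u = 0") auto
  have "cmod (poly p (- w)) \<le> cmod (poly p w)"
    using p_roots w by (rule nonpos_roots_compare)
  then have \<Phi>: "cmod (?\<Phi> (- w)) \<le> cmod (?\<Phi> w)"
    using w0 by (simp add: p norm_mult norm_power mult_le_cancel_right)
  have inv: "Re (1 / w) > 0" 
  proof -
    have "(Re w)\<^sup>2 + (Im w)\<^sup>2 > 0" using w by (intro add_pos_nonneg) auto
    then show ?thesis using w by (simp add: Re_divide)
  qed
  have A1: "cmod (?A (- w)) < cmod (?A w)" using w by (rule mask_poly_strict_compare)
  have A2: "cmod (?A (1 / (- w))) \<le> cmod (?A (1 / w))"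
    using mask_poly_strict_compare[OF inv, of m] by simp
  have pos: "cmod (?A (1 / w)) > 0" "cmod (?\<Phi> w) > 0"
    using mask_poly_roots[of m "1 / w"] inv Suc.IH[OF wn, of "Suc m"] by auto
  have "cmod (?A (1 / (- w)) * ?A (- w) * ?\<Phi> (- w)) < cmod (?A (1 / w) * ?A w * ?\<Phi> w)"
  proof -
    have "cmod (?A (1 / (- w))) * cmod (?A (- w)) \<le> cmod (?A (1 / w)) * cmod (?A (- w))"
      using A2 by (intro mult_right_mono) auto
    also have "\<dots> < cmod (?A (1 / w)) * cmod (?A w)"
      using A1 pos(1) by (rule mult_strict_left_mono)
    finally have "cmod (?A (1 / (- w))) * cmod (?A (- w)) * cmod (?\<Phi> (- w)) < cmod (?A (1 / w)) * cmod (?A w) * cmod (?\<Phi> w)"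
      using \<Phi> pos(2)
      by (meson mult_left_mono mult_strict_right_mono mult_nonneg_nonneg norm_ge_zero order.strict_trans1)
    then show ?thesis by (simp only: norm_mult)
  qed
  then have "?A (1 / w) * ?A w * ?\<Phi> w + ?A (1 / (- w)) * ?A (- w) * ?\<Phi> (- w) \<noteq> 0"
    by (metis add_eq_0_iff norm_minus_cancel less_irrefl)
  then show ?case unfolding z cascade_autocorr_refine[OF w0] by simp
qed

lemma cascade_autocorr_tendsto: "(\<lambda>j. cascade_autocorr j m z) \<longlonglongrightarrow> limit_autocorr m z"
proof -
  have correlation: "(\<lambda>j. correlation (1 / 2 ^ m) (cascade_cfun j m) (cascade_cfun j m) k) \<longlonglongrightarrow> correlation (1 / 2 ^ m) (limit_cfun m) (limit_cfun m) k" for k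
    unfolding correlation_def
  proof (rule integral_dominated_convergence)
    let ?t = "of_int k * (1 / 2 ^ m) :: real"
    have [measurable]: "(\<lambda>x. f (x + ?t)) \<in> borel_measurable borel"
      if "f \<in> borel_measurable borel" for f :: "real \<Rightarrow> real"
      using borel_measurable_translate[OF that, of "- ?t"] by (simp add: translate_def)
    show "integrable lborel (\<lambda>x. 2 ^ m * cascade_bound m x)"
      using cascade_bound_integrable by (rule integrable_mult_right)
    show "(\<lambda>x. limit_cfun m x * limit_cfun m (x + ?t)) \<in> borel_measurable lborel" by simp
    show "(\<lambda>x. cascade_cfun j m x * cascade_cfun j m (x + ?t)) \<in> borel_measurable lborel" for j by simp
    show "AE x in lborel. (\<lambda>j. cascade_cfun j m x * cascade_cfun j m (x + ?t)) \<longlonglongrightarrow> limit_cfun m x * limit_cfun m (x + ?t)"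
      by (intro AE_I2 tendsto_intros cascade_fun_tendsto)
    show "AE x in lborel. cmod (cascade_cfun j m x * cascade_cfun j m (x + ?t)) \<le> 2 ^ m * cascade_bound m x" for j
    proof (intro AE_I2)
      fix x
      have "\<bar>cascade_fun j m (x + ?t)\<bar> * \<bar>cascade_fun j m x\<bar> \<le> 2 ^ m * cascade_bound m x"
        using cascade_fun_bound[of j m x] cascade_fun_le[of j m "x + ?t"] cascade_fun_nonneg[of j m "x + ?t"]
        by (intro mult_mono) auto
      then show "cmod (cascade_cfun j m x * cascade_cfun j m (x + ?t)) \<le> 2 ^ m * cascade_bound m x"
        by (simp add: norm_mult mult.commute)
    qed
  qed
  let ?A = "{- int (N + 1)..int (N + 1)}"
  have "cascade_autocorr j m z = (\<Sum>k\<in>?A. correlation (1 / 2 ^ m) (cascade_cfun j m) (cascade_cfun j m) k * z powi k)" for j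
    by (rule laurent_superset) (auto intro!: correlation_cascade_fun_support)
  moreover have "limit_autocorr m z = (\<Sum>k\<in>?A. correlation (1 / 2 ^ m) (limit_cfun m) (limit_cfun m) k * z powi k)"
    by (rule laurent_superset) (auto intro!: correlation_limit_fun_support)
  ultimately show ?thesis by (simp only:) (intro tendsto_intros correlation)
qed

text \<open>All correlations are nonnegative, and the one at \<open>0\<close> is positive because the limit function has integral
  \<open>1\<close>.\<close>

lemma limit_autocorr_1_nonzero: "limit_autocorr m 1 \<noteq> 0"
proof -
  let ?c = "\<lambda>k. LINT x|lborel. limit_fun m x * limit_fun m (x + of_int k * (1 / 2 ^ m))"
  have c: "correlation (1 / 2 ^ m) (limit_cfun m) (limit_cfun m) k = complex_of_real (?c k)" for k
    unfolding correlation_def by (simp flip: of_real_mult)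
  have nonneg: "?c k \<ge> 0" for k
    by (intro Bochner_Integration.integral_nonneg mult_nonneg_nonneg limit_fun_nonneg)
  have "?c 0 \<noteq> 0"
  proof
    assume zero: "?c 0 = 0"
    have "integrable lborel (\<lambda>x. limit_fun m x * limit_fun m (x + of_int 0 * (1 / 2 ^ m)))"
      using correlation_integrable[OF limit_cfun_compact_L2 limit_cfun_compact_L2, of m m 0]
      by (simp only: of_real_mult[symmetric] complex_of_real_integrable_eq) simp
    from integral_nonneg_eq_0_iff_AE[OF this] zero have "AE x in lborel. limit_fun m x = 0"
      by (simp add: limit_fun_nonneg)
    then have "(LINT x|lborel. limit_fun m x) = 0"
      by (rule integral_eq_zero_AE)
    then show False by (simp add: limit_fun_integral)
  qed
  then have "?c 0 > 0" using nonneg[of 0] by linarith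
  let ?A = "{- int (N + 1)..int (N + 1)}"
  have "limit_autocorr m 1 = (\<Sum>k\<in>?A. correlation (1 / 2 ^ m) (limit_cfun m) (limit_cfun m) k * 1 powi k)"
    by (rule laurent_superset) (auto intro!: correlation_limit_fun_support)
  also have "\<dots> = complex_of_real (\<Sum>k\<in>?A. ?c k)" by (simp add: c)
  finally have "limit_autocorr m 1 = complex_of_real (\<Sum>k\<in>?A. ?c k)" .
  moreover have "?c 0 \<le> (\<Sum>k\<in>?A. ?c k)"
  proof (rule member_le_sum)
    show "?c k \<ge> 0" if "k \<in> ?A - {0}" for k by (rule nonneg)
  qed auto
  ultimately show ?thesis using \<open>?c 0 > 0\<close> by (simp del: of_real_sum)
qed

text \<open>The lower bound for polynomials with nonpositive roots survives the limit of the cascade, and its right hand side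
  stays positive.\<close>

lemma limit_autocorr_nonzero:
  assumes z: "z \<notin> \<real>\<^sub>\<le>\<^sub>0"
  shows "limit_autocorr m z \<noteq> 0"
proof -
  have z0: "z \<noteq> 0" using z by auto
  obtain \<kappa> where \<kappa>: "0 < \<kappa>" "\<kappa> \<le> 1" and
    bound: "\<forall>p. (\<forall>u. poly p u = 0 \<longrightarrow> u \<in> \<real>\<^sub>\<le>\<^sub>0) \<longrightarrow>
      \<kappa> ^ degree p * cmod (poly p 1) \<le> cmod (poly p z)"
    using nonpos_roots_lower_bound[OF z] by blast
  have "\<kappa> ^ (2 * (N + 1)) * cmod (cascade_autocorr j m 1) \<le> cmod (cascade_autocorr j m z) * cmod z ^ (N + 1)" for j
  proof -
    define p where "p = laurent_poly (N + 1) (correlation (1 / 2 ^ m) (cascade_cfun j m) (cascade_cfun j m))"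
    have p: "degree p \<le> 2 * (N + 1)" "\<And>z. z \<noteq> 0 \<Longrightarrow> poly p z = cascade_autocorr j m z * z ^ (N + 1)"
      unfolding p_def by (rule degree_laurent_poly) (rule poly_laurent_poly[OF correlation_cascade_fun_support])
    have p_roots: "u \<in> \<real>\<^sub>\<le>\<^sub>0" if "poly p u = 0" for u
      using that p(2)[of u] cascade_autocorr_nonzero[of u m j] by (cases "u = 0") auto
    have "\<kappa> ^ (2 * (N + 1)) * cmod (poly p 1) \<le> \<kappa> ^ degree p * cmod (poly p 1)"
      using \<kappa> p(1) by (intro mult_right_mono power_decreasing) auto
    also have "\<dots> \<le> cmod (poly p z)" using bound p_roots by blast
    finally show ?thesis using z0 by (simp add: p(2) norm_mult norm_power)
  qed
  then have "\<kappa> ^ (2 * (N + 1)) * cmod (limit_autocorr m 1) \<le> cmod (limit_autocorr m z) * cmod z ^ (N + 1)"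
    by (intro LIMSEQ_le[of "\<lambda>j. \<kappa> ^ (2 * (N + 1)) * cmod (cascade_autocorr j m 1)" _
          "\<lambda>j. cmod (cascade_autocorr j m z) * cmod z ^ (N + 1)"] tendsto_intros cascade_autocorr_tendsto) auto
  moreover have "\<kappa> ^ (2 * (N + 1)) * cmod (limit_autocorr m 1) > 0"
    using \<kappa>(1) limit_autocorr_1_nonzero by simp
  ultimately show ?thesis by auto
qed

lemma cross_correlation_roots:
  assumes z: "z \<noteq> 0" and root: "laurent (correlation (1 / 2 ^ Suc m) (limit_cfun m) (limit_cfun (Suc m))) z = 0"
  shows "z \<in> \<real>\<^sub>\<le>\<^sub>0"
proof -
  have "laurent (correlation (1 / 2 ^ Suc m) (limit_cfun m) (limit_cfun (Suc m))) z =
      poly (cpoly (mask_poly m)) (1 / z) * limit_autocorr (Suc m) z"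
    using z limit_cfun_compact_L2 by (subst limit_cfun_refine[of m], subst laurent_correlation_shift_poly_left) auto
  with root have "poly (cpoly (mask_poly m)) (1 / z) = 0 \<or> limit_autocorr (Suc m) z = 0" by simp
  then show ?thesis
  proof
    assume "poly (cpoly (mask_poly m)) (1 / z) = 0"
    then have "1 / z \<in> \<real>\<^sub>\<le>\<^sub>0" by (rule mask_poly_nonpos_roots)
    then have "inverse (1 / z) \<in> \<real>\<^sub>\<le>\<^sub>0" by (rule nonpos_Reals_inverse_I)
    then show ?thesis by simp
  qed (use limit_autocorr_nonzero in blast)
qed

end

section \<open>Divisibility by linear factors in a translation operator\<close>

text \<open>Divisibility of \<open>f\<close> by \<open>T - c\<close> within the compactly supported functions, regarded as a
  module over the polynomials in the translation \<open>T\<close> by \<open>s\<close>.\<close>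

definition shift_divisible :: "real \<Rightarrow> complex \<Rightarrow> (real \<Rightarrow> complex) \<Rightarrow> bool" where
  "shift_divisible s c f \<longleftrightarrow> (\<exists>u\<in>compact_L2. AE x in lborel. f x = u (x - s) - c * u x)"

lemma shift_divisible_AE_zero:
  assumes "AE x in lborel. f x = 0"
  shows "shift_divisible s c f"
  unfolding shift_divisible_def using assms by (intro bexI[OF _ compact_L2_zero]) simp

text \<open>Iterating the equation \<open>T v = c v\<close> leads from any point out of the support, so \<open>T - c\<close> has
  no compactly supported kernel.\<close>

lemma shift_eigenfunction_zero:
  assumes v: "v \<in> compact_L2" and s: "s > 0" and c: "c \<noteq> 0"
    and eq: "AE x in lborel. v (x - s) = c * v x"
  shows "AE x in lborel. v x = 0"
proof -
  have "AE x in lborel. v (x - real k * s) = c ^ k * v x" for k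
  proof (induction k)
    case (Suc k)
    have "AE x in lborel. v (x - real k * s - s) = c * v (x - real k * s)"
      using AE_shift[OF eq, of "real k * s"] .
    with Suc show ?case by eventually_elim (simp add: algebra_simps)
  qed simp
  then have iterate: "AE x in lborel. \<forall>k. v (x - real k * s) = c ^ k * v x"
    by (simp add: AE_all_countable)
  obtain R where R: "\<And>x. \<bar>x\<bar> > R \<Longrightarrow> v x = 0" using v by (auto simp: compact_L2_def)
  from iterate show ?thesis
  proof eventually_elim
    case (elim x)
    obtain k where "R + \<bar>x\<bar> < real k * s" using reals_Archimedean3[OF s] by blast
    then have "\<bar>x - real k * s\<bar> > R" by linarith
    then have "c ^ k * v x = 0" using R elim by metis
    then show ?case using c by simp
  qed
qed

lemma shift_poly_linear_factor: "shift_poly s ([:- c, 1:] * p) f x = shift_poly s p f (x - s) - c * shift_poly s p f x"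
  by (simp only: shift_poly_mult shift_poly_shift_left)

text \<open>The remainder of \<open>p\<close> modulo \<open>X - c\<close> is the nonzero constant \<open>p(c)\<close>.\<close>

lemma shift_divisible_of_shift_poly:
  assumes f: "f \<in> compact_L2" and div: "shift_divisible s c (shift_poly s p f)" and nz: "poly p c \<noteq> 0"
  shows "shift_divisible s c f"
proof -
  obtain u where u: "u \<in> compact_L2" "AE x in lborel. shift_poly s p f x = u (x - s) - c * u x"
    using div by (auto simp: shift_divisible_def)
  define p1 where "p1 = synthetic_div p c"
  have p: "p = [:- c, 1:] * p1 + [:poly p c:]"
    unfolding p1_def by (rule synthetic_div_correct'[symmetric])
  define v where "v = shift_poly s p1 f"
  have v: "v \<in> compact_L2" unfolding v_def using f by (rule compact_L2_shift_poly)
  have remainder: "shift_poly s p f x = v (x - s) - c * v x + poly p c * f x" for x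
    by (subst p) (simp only: shift_poly_add shift_poly_linear_factor v_def shift_poly_const)
  define w where "w x = 1 / poly p c * (u x - v x)" for x
  have "w \<in> compact_L2" unfolding w_def[abs_def] using u v by (intro compact_L2_cmult compact_L2_diff)
  moreover have "AE x in lborel. f x = w (x - s) - c * w x"
    using u(2)
  proof eventually_elim
    case (elim x)
    then have "poly p c * f x = (u (x - s) - v (x - s)) - c * (u x - v x)"
      using remainder[of x] by (simp add: algebra_simps)
    then have "f x = ((u (x - s) - v (x - s)) - c * (u x - v x)) / poly p c"
      using nz by (simp add: eq_divide_eq mult.commute)
    then show ?case by (simp add: w_def diff_divide_distrib right_diff_distrib)
  qed
  ultimately show ?thesis by (auto simp: shift_divisible_def)
qed

text \<open>\<open>T\<^sup>2 - c\<^sup>2 = (T - c)(T + c)\<close>.\<close>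

lemma shift_divisible_square:
  assumes "shift_divisible (2 * s) (c\<^sup>2) f"
  shows "shift_divisible s c f"
proof -
  obtain u where u: "u \<in> compact_L2" "AE x in lborel. f x = u (x - 2 * s) - c\<^sup>2 * u x"
    using assms by (auto simp: shift_divisible_def)
  have "(\<lambda>x. translate s u x + c * u x) \<in> compact_L2" using u by (intro compact_L2_add compact_L2_translate compact_L2_cmult)
  moreover have "AE x in lborel. f x = (translate s u (x - s) + c * u (x - s)) - c * (translate s u x + c * u x)"
    using u(2) by eventually_elim (simp add: algebra_simps power2_eq_square)
  ultimately show ?thesis unfolding shift_divisible_def
    by (intro bexI[where x = "\<lambda>x. translate s u x + c * u x"])
qed

text \<open>Divide a relation \<open>p(T) h = r(T) f\<close> by one root \<open>c \<noteq> 0\<close> of \<open>p\<close> at a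
  time. The left hand side is divisible by \<open>T - c\<close>; since \<open>f\<close> is not, \<open>c\<close> is a
  root of \<open>r\<close>, and the common factor cancels because it has no compactly supported kernel. A root
  \<open>0\<close> only translates \<open>h\<close>.\<close>

lemma compactly_supported_multiple:
  assumes f: "f \<in> compact_L2" and s: "s > 0" and ndiv: "\<And>c. c \<noteq> 0 \<Longrightarrow> \<not> shift_divisible s c f"
  shows "p \<noteq> 0 \<Longrightarrow> h \<in> compact_L2 \<Longrightarrow> AE x in lborel. shift_poly s p h x = shift_poly s r f x \<Longrightarrow>
    \<exists>k d. AE x in lborel. h (x - real k * s) = shift_poly s d f x"
proof (induction p arbitrary: h r rule: complex_poly_induct)
  case (const c)
  then have c: "c \<noteq> 0" by auto
  from const(3) have "AE x in lborel. h (x - real 0 * s) = shift_poly s (smult (1 / c) r) f x"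
    by eventually_elim (use c in \<open>simp add: shift_poly_smult field_simps\<close>)
  then show ?case by blast
next
  case (root c p)
  have p: "p \<noteq> 0" using root.prems(1) by auto
  show ?case
  proof (cases "c = 0")
    case True
    have "shift_poly s ([:- c, 1:] * p) h = shift_poly s p (translate s h)"
      unfolding fun_eq_iff shift_poly_linear_factor True by (simp add: shift_poly_translate)
    then have "AE x in lborel. shift_poly s p (translate s h) x = shift_poly s r f x"
      using root.prems(3) by simp
    from root.IH[OF p compact_L2_translate[OF root.prems(2)] this] obtain k d
      where "AE x in lborel. translate s h (x - real k * s) = shift_poly s d f x" by blast
    then have "AE x in lborel. h (x - real (Suc k) * s) = shift_poly s d f x"
      by (simp add: algebra_simps)
    then show ?thesis by blast
  next
    case False
    have u: "shift_poly s p h \<in> compact_L2" using root.prems(2) by (rule compact_L2_shift_poly)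
    have eq: "AE x in lborel. shift_poly s r f x = shift_poly s p h (x - s) - c * shift_poly s p h x"
      using root.prems(3) by eventually_elim (simp only: shift_poly_linear_factor)
    then have "shift_divisible s c (shift_poly s r f)" using u by (auto simp: shift_divisible_def)
    then have "poly r c = 0" using shift_divisible_of_shift_poly[OF f] ndiv[OF False] by blast
    then obtain r' where r': "r = [:- c, 1:] * r'" by (auto simp: poly_eq_0_iff_dvd)
    define v where "v x = shift_poly s p h x - shift_poly s r' f x" for x
    have "v \<in> compact_L2" unfolding v_def[abs_def] by (intro compact_L2_diff compact_L2_shift_poly f root.prems(2))
    moreover have "AE x in lborel. v (x - s) = c * v x"
      using eq by eventually_elim (simp only: r' shift_poly_linear_factor v_def, simp add: algebra_simps)
    ultimately have "AE x in lborel. v x = 0"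
      using s False by (intro shift_eigenfunction_zero)
    then have "AE x in lborel. shift_poly s p h x = shift_poly s r' f x" by (simp add: v_def)
    from root.IH[OF p root.prems(2) this] show ?thesis .
  qed
qed

lemma poly_even_odd_parts:
  fixes p :: "complex poly"
  shows "\<exists>pe po. p = pcompose pe (monom 1 2) + [:0, 1:] * pcompose po (monom 1 2)"
proof (induction p)
  case (pCons a p)
  then obtain pe po where p: "p = pcompose pe (monom 1 2) + [:0, 1:] * pcompose po (monom 1 2)"
    by blast
  have "pCons a p = pcompose (pCons a po) (monom 1 2) + [:0, 1:] * pcompose pe (monom 1 2)"
    by (subst p) (simp add: pcompose_pCons monom_altdef power2_eq_square algebra_simps)
  then show ?case by blast
qed (rule exI[of _ 0], rule exI[of _ 0], simp)

lemma shift_poly_even_odd_parts: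
  assumes "p = pcompose pe (monom 1 2) + [:0, 1:] * pcompose po (monom 1 2)"
  shows "shift_poly s p f x = shift_poly (2 * s) pe f x + shift_poly (2 * s) po (translate s f) x"
  unfolding assms shift_poly_add shift_poly_mult by (simp add: shift_poly_pCons shift_poly_pcompose_square shift_poly_translate)

lemma poly_even_odd_parts_eval:
  fixes p :: "complex poly"
  assumes "p = pcompose pe (monom 1 2) + [:0, 1:] * pcompose po (monom 1 2)"
  shows "poly p z = poly pe (z\<^sup>2) + z * poly po (z\<^sup>2)"
  unfolding assms by (simp add: poly_pcompose poly_monom)

section \<open>Dividing inside closed invariant subspaces\<close>

lemma closed_span_shift_poly:
  assumes S: "S \<subseteq> L2" and inv: "\<And>g. g \<in> S \<Longrightarrow> translate s g \<in> S" and f: "f \<in> closed_span S"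
  shows "shift_poly s p f \<in> closed_span S"
proof (induction p)
  case 0
  then show ?case by (simp add: closed_span_zero)
next
  case (pCons a p)
  then show ?case unfolding shift_poly_pCons_fun
    by (intro closed_span_add S closed_span_cmult f closed_span_translate inv)
qed

lemma cmod_sum_disjoint:
  assumes "finite J" "\<And>i j. i \<in> J \<Longrightarrow> j \<in> J \<Longrightarrow> i \<noteq> j \<Longrightarrow> a i = 0 \<or> a j = (0::complex)"
  shows "(cmod (\<Sum>j\<in>J. a j))\<^sup>2 = (\<Sum>j\<in>J. (cmod (a j))\<^sup>2)"
  using assms
proof (induction J)
  case (insert i J)
  show ?case
  proof (cases "a i = 0")
    case True
    then show ?thesis using insert by simp
  next
    case False
    then have "a j = 0" if "j \<in> J" for j using insert.prems[of i j] insert.hyps that by auto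
    then show ?thesis using insert.hyps by simp
  qed
qed simp

text \<open>Modulo the closed span, \<open>u\<close> equals every \<open>c\<^sup>-\<^sup>k T\<^sup>k u\<close>. As
  \<open>\<bar>c\<bar> \<ge> 1\<close>, these functions do not grow, and for widely spaced \<open>k\<close> their
  supports are disjoint. The average of \<open>M\<close> of them therefore has squared norm at most \<open>1 /
  M\<close> times that of \<open>u\<close>, and \<open>u\<close> is a limit of elements of the closed span. This
  covers \<open>\<bar>c\<bar> = 1\<close>, where \<open>T - c\<close> has no bounded inverse.\<close>

lemma closed_span_divide_expanding:
  assumes S: "S \<subseteq> L2" and inv: "\<And>g. g \<in> S \<Longrightarrow> translate t g \<in> S" and t: "t \<noteq> 0" and u: "u \<in> compact_L2"
    and c: "cmod c \<ge> 1" and div: "(\<lambda>x. u (x - t) - c * u x) \<in> closed_span S"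
  shows "u \<in> closed_span S"
proof -
  define v where "v k = (\<lambda>x. (1 / c) ^ k * translate (real k * t) u x)" for k
  have c0: "c \<noteq> 0" using c by auto
  have shk: "translate (real k * t) g \<in> S" if "g \<in> S" for g k
    using that
  proof (induction k)
    case (Suc k)
    have "translate t (translate (real k * t) g) \<in> S" by (rule inv[OF Suc.IH[OF Suc.prems]])
    moreover have "translate t (translate (real k * t) g) = translate (real (Suc k) * t) g"
      by (simp add: fun_eq_iff algebra_simps)
    ultimately show ?case by (simp only:)
  qed simp
  have uL: "u \<in> L2" using u by (rule compact_L2_L2)
  have vL: "v k \<in> L2" for k unfolding v_def using uL by (intro L2_cmult L2_translate)
  have step: "(\<lambda>x. v k x - v (Suc k) x) \<in> closed_span S" for k
  proof -
    have "(\<lambda>x. - ((1 / c) ^ Suc k) * translate (real k * t) (\<lambda>x. u (x - t) - c * u x) x) \<in> closed_span S"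
      by (intro closed_span_cmult closed_span_translate div shk)
    moreover have "(\<lambda>x. - ((1 / c) ^ Suc k) * translate (real k * t) (\<lambda>x. u (x - t) - c * u x) x)
        = (\<lambda>x. v k x - v (Suc k) x)"
      using c0 by (auto simp: v_def fun_eq_iff algebra_simps)
    ultimately show ?thesis by simp
  qed
  have diff: "(\<lambda>x. u x - v k x) \<in> closed_span S" for k
  proof (induction k)
    case 0
    then show ?case by (simp add: v_def closed_span_zero)
  next
    case (Suc k)
    from closed_span_add[OF S this step[of k]] show ?case by simp
  qed
  obtain R where R: "\<And>x. \<bar>x\<bar> > R \<Longrightarrow> u x = 0" using u by (auto simp: compact_L2_def)
  \<comment> \<open>Translates of \<open>u\<close> by different multiples of \<open>K t\<close> have disjoint supports.\<close>
  obtain K where K: "2 * \<bar>R\<bar> < real K * \<bar>t\<bar>" using reals_Archimedean3[of "\<bar>t\<bar>"] t by auto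
  have disjoint: "v (i * K) x = 0 \<or> v (j * K) x = 0" if "i \<noteq> j" for i j x
  proof (rule ccontr)
    assume "\<not> (v (i * K) x = 0 \<or> v (j * K) x = 0)"
    then have "u (x - real (i * K) * t) \<noteq> 0" "u (x - real (j * K) * t) \<noteq> 0" by (auto simp: v_def)
    then have "\<bar>x - real (i * K) * t\<bar> \<le> R" "\<bar>x - real (j * K) * t\<bar> \<le> R"
      using R by (meson not_le)+
    then have "\<bar>(real i - real j) * (real K * t)\<bar> \<le> 2 * \<bar>R\<bar>" by (simp add: algebra_simps)
    moreover have "\<bar>real i - real j\<bar> \<ge> 1" using that by linarith
    then have "\<bar>(real i - real j) * (real K * t)\<bar> \<ge> 1 * (real K * \<bar>t\<bar>)"
      unfolding abs_mult[of "real i - real j"] by (intro mult_mono) (auto simp: abs_mult)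
    ultimately show False using K by simp
  qed
  define avg where "avg M = (\<lambda>x. 1 / of_nat (Suc M) * (\<Sum>j\<le>M. v (j * K) x))" for M
  have avg_mem: "(\<lambda>x. u x - avg M x) \<in> closed_span S" for M
  proof -
    have "(\<lambda>x. 1 / of_nat (Suc M) * (\<Sum>j\<le>M. u x - v (j * K) x)) \<in> closed_span S"
      by (intro closed_span_cmult closed_span_sum S diff)
    moreover have "(\<lambda>x. 1 / of_nat (Suc M) * (\<Sum>j\<le>M. u x - v (j * K) x)) = (\<lambda>x. u x - avg M x)"
      by (simp add: avg_def sum_subtractf fun_eq_iff field_simps del: of_nat_Suc)
    ultimately show ?thesis by simp
  qed
  have avgL: "avg M \<in> L2" for M unfolding avg_def by (intro L2_cmult L2_sum vL)
  have v_norm: "norm_sq (v k) \<le> norm_sq u" for k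
  proof -
    have "cmod (1 / c) ^ k \<le> 1" using c c0 by (intro power_le_one) (auto simp: norm_divide divide_le_eq_1)
    then have "(cmod ((1 / c) ^ k))\<^sup>2 \<le> 1" by (simp add: norm_power power_le_one)
    then have "(cmod ((1 / c) ^ k))\<^sup>2 * norm_sq u \<le> 1 * norm_sq u" by (intro mult_right_mono) auto
    then show ?thesis unfolding v_def norm_sq_cmult norm_sq_translate by simp
  qed
  have avg_norm: "norm_sq (avg M) \<le> norm_sq u / real (Suc M)" for M
  proof -
    have "norm_sq (\<lambda>x. \<Sum>j\<le>M. v (j * K) x) = (LINT x|lborel. (\<Sum>j\<le>M. (cmod (v (j * K) x))\<^sup>2))"
      unfolding norm_sq_def using disjoint by (subst cmod_sum_disjoint) auto
    also have "\<dots> = (\<Sum>j\<le>M. norm_sq (v (j * K)))"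
      unfolding norm_sq_def using L2_square_integrable[OF vL] by (intro Bochner_Integration.integral_sum) auto
    also have "\<dots> \<le> (\<Sum>j\<le>M. norm_sq u)" by (intro sum_mono v_norm)
    finally have "norm_sq (\<lambda>x. \<Sum>j\<le>M. v (j * K) x) \<le> real (Suc M) * norm_sq u" by simp
    then have "(1 / real (Suc M))\<^sup>2 * norm_sq (\<lambda>x. \<Sum>j\<le>M. v (j * K) x)
        \<le> (1 / real (Suc M))\<^sup>2 * (real (Suc M) * norm_sq u)"
      by (intro mult_left_mono) auto
    also have "\<dots> = norm_sq u / real (Suc M)" by (simp add: power2_eq_square del: of_nat_Suc)
    finally show ?thesis unfolding avg_def norm_sq_cmult by (simp add: norm_divide del: of_nat_Suc)
  qed
  show ?thesis
  proof (rule closed_span_limit[OF S uL])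
    fix \<epsilon> :: real assume e: "\<epsilon> > 0"
    obtain M where "norm_sq u / \<epsilon> < real M" using reals_Archimedean2 by blast
    then have "norm_sq u < \<epsilon> * real (Suc M)" using e by (simp add: field_simps)
    then have "norm_sq u / real (Suc M) < \<epsilon>" by (simp add: field_simps)
    then have "norm_sq (avg M) < \<epsilon>" using avg_norm[of M] by linarith
    then show "\<exists>g\<in>closed_span S. norm_sq (\<lambda>x. u x - g x) < \<epsilon>"
      by (intro bexI[OF _ avg_mem[of M]]) simp
  qed
qed

text \<open>For \<open>0 < \<bar>c\<bar> < 1\<close> replace \<open>T - c\<close> by a multiple of \<open>T\<^sup>-\<^sup>1 -
  c\<^sup>-\<^sup>1\<close>.\<close>

lemma closed_span_divide:
  assumes S: "S \<subseteq> L2" and inv: "\<And>g. g \<in> S \<Longrightarrow> translate t g \<in> S" "\<And>g. g \<in> S \<Longrightarrow> translate (- t) g \<in> S"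
    and t: "t \<noteq> 0" and u: "u \<in> compact_L2"
    and div: "(\<lambda>x. u (x - t) - c * u x) \<in> closed_span S"
  shows "u \<in> closed_span S"
proof -
  have bwd: "translate (- t) (\<lambda>x. u (x - t) - c * u x) \<in> closed_span S"
    using div inv(2) by (rule closed_span_translate)
  consider "c = 0" | "cmod c \<ge> 1" | "c \<noteq> 0" "cmod c < 1" by linarith
  then show ?thesis
  proof cases
    case 1
    then show ?thesis using bwd by (simp add: translate_def)
  next
    case 2
    show ?thesis by (rule closed_span_divide_expanding[OF S inv(1) t u 2 div])
  next
    case 3
    have "(\<lambda>x. - (1 / c) * translate (- t) (\<lambda>x. u (x - t) - c * u x) x) \<in> closed_span S"
      by (rule closed_span_cmult[OF bwd])
    moreover have "(\<lambda>x. - (1 / c) * translate (- t) (\<lambda>x. u (x - t) - c * u x) x) = (\<lambda>x. u (x - - t) - 1 / c * u x)"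
      using 3 by (simp add: fun_eq_iff field_simps)
    ultimately have div': "(\<lambda>x. u (x - - t) - 1 / c * u x) \<in> closed_span S" by simp
    have "cmod (1 / c) \<ge> 1" using 3 by (simp add: norm_divide)
    from closed_span_divide_expanding[OF S inv(2) _ u this div'] t show ?thesis by simp
  qed
qed

lemma closed_span_divide_shift_poly:
  assumes S: "S \<subseteq> L2" and inv: "\<And>g. g \<in> S \<Longrightarrow> translate t g \<in> S" "\<And>g. g \<in> S \<Longrightarrow> translate (- t) g \<in> S"
    and t: "t \<noteq> 0" and u: "u \<in> compact_L2"
  shows "p \<noteq> 0 \<Longrightarrow> shift_poly t p u \<in> closed_span S \<Longrightarrow> u \<in> closed_span S"
proof (induction p rule: complex_poly_induct)
  case (const c)
  then have "c \<noteq> 0" by auto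
  from closed_span_cmult[OF const(2), of "1 / c"] show ?case using \<open>c \<noteq> 0\<close> by simp
next
  case (root c p)
  have step: "(\<lambda>x. shift_poly t p u (x - t) - c * shift_poly t p u x) \<in> closed_span S"
    using root.prems(2) by (simp only: shift_poly_linear_factor[symmetric])
  have "shift_poly t p u \<in> closed_span S"
    by (rule closed_span_divide[OF S inv t compact_L2_shift_poly[OF u] step])
  moreover have "p \<noteq> 0" using root.prems(1) by auto
  ultimately show ?case by (intro root.IH)
qed

section \<open>Linear independence of the translates of the cascade limits\<close>

lemma floor_weight_integrable:
  assumes u: "u \<in> compact_L2" and h: "h > 0"
  shows "integrable lborel (\<lambda>x. u x * w powi \<lfloor>x / h\<rfloor>)"
proof -
  obtain R where R: "\<And>x. \<bar>x\<bar> > R \<Longrightarrow> u x = 0" using u by (auto simp: compact_L2_def)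
  define J where "J = {\<lfloor>- R / h\<rfloor>..\<lfloor>R / h\<rfloor>}"
  define C where "C = (\<Sum>j\<in>J. cmod (w powi j))"
  have [measurable]: "(\<lambda>x. w powi \<lfloor>x / h\<rfloor>) \<in> borel_measurable borel"
    by measurable
  have [measurable]: "u \<in> borel_measurable borel" using u by (intro L2_measurable compact_L2_L2)
  show ?thesis
  proof (rule integrable_dominated)
    show "integrable lborel (\<lambda>x. cmod (u x) * C)" using compact_L2_integrable[OF u] by simp
    fix x
    show "cmod (u x * w powi \<lfloor>x / h\<rfloor>) \<le> cmod (u x) * C"
    proof (cases "u x = 0")
      case False
      then have "\<bar>x\<bar> \<le> R" using R[of x] by linarith
      then have "- R / h \<le> x / h" "x / h \<le> R / h"
        using h divide_right_mono[of "- R" x h] divide_right_mono[of x R h] by linarith+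
      then have "\<lfloor>x / h\<rfloor> \<in> J" unfolding J_def atLeastAtMost_iff by (intro conjI floor_mono)
      then have "cmod (w powi \<lfloor>x / h\<rfloor>) \<le> C" unfolding C_def by (intro member_le_sum) (auto simp: J_def)
      then show ?thesis by (simp add: norm_mult mult_left_mono)
    qed simp
  qed simp
qed

text \<open>The functional \<open>f \<mapsto> \<integral> f(x) w\<^bsup>\<lfloor>x / h\<rfloor>\<^esup> dx\<close> turns the
  translation by \<open>h\<close> into the multiplication by \<open>w\<close>, so it vanishes on the range of \<open>T
  - w\<close>.\<close>

lemma floor_weight_annihilates:
  assumes f: "f \<in> compact_L2" and h: "h > 0" and w: "w \<noteq> 0" and div: "shift_divisible h w f"
  shows "(LINT x|lborel. f x * w powi \<lfloor>x / h\<rfloor>) = 0"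
proof -
  obtain u where u: "u \<in> compact_L2" "AE x in lborel. f x = u (x - h) - w * u x"
    using div by (auto simp: shift_divisible_def)
  have shifted: "u (x - h) * w powi \<lfloor>x / h\<rfloor> = w * (u (x - h) * w powi \<lfloor>(x - h) / h\<rfloor>)" for x
  proof -
    have "\<lfloor>(x - h) / h\<rfloor> = \<lfloor>x / h\<rfloor> - 1" using h by (simp add: diff_divide_distrib)
    then have "w powi \<lfloor>x / h\<rfloor> = w powi \<lfloor>(x - h) / h\<rfloor> * w"
      using w by (simp add: power_int_minus_mult)
    then show ?thesis by simp
  qed
  have int: "integrable lborel (\<lambda>x. u x * w powi \<lfloor>x / h\<rfloor>)"
    using u(1) h by (rule floor_weight_integrable)
  have int': "integrable lborel (\<lambda>x. u (x - h) * w powi \<lfloor>(x - h) / h\<rfloor>)"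
    using int integrable_shift[of "\<lambda>x. u x * w powi \<lfloor>x / h\<rfloor>" h] by simp
  have [measurable]: "f \<in> borel_measurable borel" "u \<in> borel_measurable borel"
    using f u by (auto intro: L2_measurable compact_L2_L2)
  have [measurable]: "(\<lambda>x. u (x - h)) \<in> borel_measurable borel"
    using borel_measurable_translate[of u h] by (simp add: translate_def)
  have "(LINT x|lborel. f x * w powi \<lfloor>x / h\<rfloor>) = (LINT x|lborel. (u (x - h) - w * u x) * w powi \<lfloor>x / h\<rfloor>)"
  proof (rule integral_cong_AE)
    show "AE x in lborel. f x * w powi \<lfloor>x / h\<rfloor> = (u (x - h) - w * u x) * w powi \<lfloor>x / h\<rfloor>"
      using u(2) by eventually_elim simp
  qed measurable
  also have "\<dots> = (LINT x|lborel. w * (u (x - h) * w powi \<lfloor>(x - h) / h\<rfloor>) - w * (u x * w powi \<lfloor>x / h\<rfloor>))"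
    by (simp only: left_diff_distrib shifted mult.assoc)
  also have "\<dots> = w * (LINT x|lborel. u (x - h) * w powi \<lfloor>(x - h) / h\<rfloor>) - w * (LINT x|lborel. u x * w powi \<lfloor>x / h\<rfloor>)"
    using int int' by simp
  also have "(LINT x|lborel. u (x - h) * w powi \<lfloor>(x - h) / h\<rfloor>) = (LINT x|lborel. u x * w powi \<lfloor>x / h\<rfloor>)"
    by (rule integral_shift)
  finally show ?thesis by simp
qed

context hurwitz_masks
begin

text \<open>On the next finer level \<open>T\<^sup>2 - w\<^sup>2\<close> divides \<open>A(T) f\<close>, where \<open>f\<close> is
  the finer generator. The mask \<open>A\<close> has no root in the closed right half-plane, so \<open>T - w\<close>
  divides \<open>f\<close>.\<close>

lemma shift_divisible_refine:
  assumes div: "shift_divisible (1 / 2 ^ m) (w\<^sup>2) (limit_cfun m)" and w: "Re w \<ge> 0"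
  shows "shift_divisible (1 / 2 ^ Suc m) w (limit_cfun (Suc m))"
proof -
  define h :: real where "h = 1 / 2 ^ Suc m"
  have "(1::real) / 2 ^ m = 2 * h" by (simp add: h_def)
  with div have "shift_divisible (2 * h) (w\<^sup>2) (limit_cfun m)" by simp
  then have "shift_divisible h w (limit_cfun m)" by (rule shift_divisible_square)
  then have "shift_divisible h w (shift_poly h (cpoly (mask_poly m)) (limit_cfun (Suc m)))"
    unfolding h_def limit_cfun_refine[of m] .
  moreover have "poly (cpoly (mask_poly m)) w \<noteq> 0" using mask_poly_roots[of m w] w by auto
  ultimately show ?thesis unfolding h_def[symmetric] by (rule shift_divisible_of_shift_poly[OF limit_cfun_compact_L2])
qed

text \<open>Divisibility is inherited by finer levels with \<open>z\<close> replaced by its principal \<open>2\<^sup>k\<close>-th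
  root \<open>w\<close>. For large \<open>k\<close> the powers \<open>w\<^sup>0, \<dots>, w\<^sup>N\<close> have
  positive real parts, so the functional \<open>\<integral> f(x) w\<^bsup>\<lfloor>x / h\<rfloor>\<^esup> dx\<close>,
  which annihilates multiples of \<open>T - w\<close>, is nonzero on the nonnegative generator.\<close>

lemma not_shift_divisible_limit_cfun:
  assumes z: "z \<noteq> 0"
  shows "\<not> shift_divisible (1 / 2 ^ m) z (limit_cfun m)"
proof
  assume div: "shift_divisible (1 / 2 ^ m) z (limit_cfun m)"
  define \<theta> where "\<theta> k = Ln z / 2 ^ k" for k
  have double: "(exp (\<theta> (Suc k)))\<^sup>2 = exp (\<theta> k)" for k
    by (simp add: \<theta>_def flip: exp_double)
  have Im_bound: "\<bar>Im (\<theta> k)\<bar> \<le> pi / 2 ^ k" for k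
  proof -
    have "\<bar>Im (Ln z)\<bar> \<le> pi" using Im_Ln_le_pi[OF z] mpi_less_Im_Ln[OF z] by auto
    moreover have "Im (\<theta> k) = Im (Ln z) / 2 ^ k"
      unfolding \<theta>_def by (metis Im_divide_of_real of_real_numeral of_real_power)
    ultimately show ?thesis by (simp add: abs_divide divide_right_mono)
  qed
  have div_k: "shift_divisible (1 / 2 ^ (m + k)) (exp (\<theta> k)) (limit_cfun (m + k))" for k
  proof (induction k)
    case 0
    then show ?case using div z by (simp add: \<theta>_def)
  next
    case (Suc k)
    have "\<bar>Im (\<theta> (Suc k))\<bar> \<le> pi / 2"
    proof -
      have "pi / 2 ^ Suc k \<le> pi / 2" by (intro divide_left_mono) auto
      then show ?thesis using Im_bound[of "Suc k"] by linarith
    qed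
    then have "cos (Im (\<theta> (Suc k))) \<ge> 0" by (intro cos_ge_zero) linarith+
    then have "Re (exp (\<theta> (Suc k))) \<ge> 0" by (simp add: Re_exp)
    moreover have "shift_divisible (1 / 2 ^ (m + k)) ((exp (\<theta> (Suc k)))\<^sup>2) (limit_cfun (m + k))"
      using Suc by (simp only: double)
    ultimately show ?case using shift_divisible_refine[of "m + k" "exp (\<theta> (Suc k))"] by simp
  qed
  \<comment> \<open>Now \<open>N\<close> times the argument of the \<open>2\<^sup>k\<close>-th root is less than \<open>\<pi> / 2\<close>.\<close>
  obtain k where k: "real (2 * N + 1) < 2 ^ k"
    using real_arch_pow[of 2 "real (2 * N + 1)"] by auto
  define M where "M = m + k"
  define w where "w = exp (\<theta> k)"
  define h :: real where "h = 1 / 2 ^ M"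
  have h: "h > 0" by (simp add: h_def)
  have w0: "w \<noteq> 0" by (simp add: w_def)
  have zero: "(LINT x|lborel. limit_cfun M x * w powi \<lfloor>x / h\<rfloor>) = 0"
    using limit_cfun_compact_L2 h w0 div_k[of k] unfolding h_def w_def M_def by (rule floor_weight_annihilates)
  have int: "integrable lborel (\<lambda>x. limit_cfun M x * w powi \<lfloor>x / h\<rfloor>)"
    using limit_cfun_compact_L2 h by (rule floor_weight_integrable)
  have Re_zero: "(LINT x|lborel. Re (limit_cfun M x * w powi \<lfloor>x / h\<rfloor>)) = 0"
    using integral_Re[OF int] zero by simp
  have pos: "Re (w powi \<lfloor>x / h\<rfloor>) > 0" if "x \<in> {0..<real (N + 1) / 2 ^ M}" for x
  proof -
    have "x / h < real (N + 1)" "x / h \<ge> 0" using that h by (auto simp: h_def field_simps)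
    then have "\<lfloor>x / h\<rfloor> \<ge> 0" "\<lfloor>x / h\<rfloor> < int (N + 1)" by (auto simp: floor_less_iff)
    then obtain i where i: "\<lfloor>x / h\<rfloor> = int i" "i \<le> N"
      by (metis add.commute nonneg_int_cases of_nat_less_iff plus_1_eq_Suc less_Suc_eq_le)
    have "w powi \<lfloor>x / h\<rfloor> = exp (of_nat i * \<theta> k)" by (simp add: i w_def exp_of_nat_mult)
    moreover have "\<bar>Im (of_nat i * \<theta> k)\<bar> < pi / 2"
    proof -
      have "\<bar>Im (of_nat i * \<theta> k)\<bar> = real i * \<bar>Im (\<theta> k)\<bar>" by (simp add: abs_mult)
      also have "\<dots> \<le> real N * (pi / 2 ^ k)" using Im_bound[of k] i by (intro mult_mono) auto
      also have "\<dots> < pi / 2"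
      proof -
        have "2 * real N < 2 ^ k" using k by simp
        then have "2 * real N * pi < 2 ^ k * pi" by simp
        then show ?thesis by (simp add: field_simps)
      qed
      finally show ?thesis .
    qed
    then have "cos (Im (of_nat i * \<theta> k)) > 0" by (intro cos_gt_zero_pi) linarith+
    ultimately show ?thesis by (simp only: Re_exp) (simp del: times_complex.sel)
  qed
  have nonneg: "Re (limit_cfun M x * w powi \<lfloor>x / h\<rfloor>) \<ge> 0" for x
    using pos[of x] limit_fun_support[of x M] limit_fun_nonneg[of M x]
    by (cases "x \<in> {0..<real (N + 1) / 2 ^ M}") (auto intro!: mult_nonneg_nonneg less_imp_le)
  have "AE x in lborel. Re (limit_cfun M x * w powi \<lfloor>x / h\<rfloor>) = 0"
    using integral_nonneg_eq_0_iff_AE[OF integrable_Re[OF int]] nonneg Re_zero by auto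
  then have "AE x in lborel. limit_fun M x = 0"
  proof eventually_elim
    case (elim x)
    show ?case
    proof (cases "x \<in> {0..<real (N + 1) / 2 ^ M}")
      case True
      then show ?thesis using elim pos[OF True] by simp
    qed (rule limit_fun_support)
  qed
  then have "(LINT x|lborel. limit_fun M x) = 0" by (rule integral_eq_zero_AE)
  then show False by (simp add: limit_fun_integral)
qed

end

section \<open>Lattices of translates\<close>

lemma shifts_iff: "g \<in> shifts m f \<longleftrightarrow> (\<exists>k::int. g = translate (of_int k / 2 ^ m) f)"
  by (auto simp: shifts_def translate_def)

lemma shifts_L2: "f \<in> L2 \<Longrightarrow> shifts m f \<subseteq> L2"
  by (auto simp: shifts_iff intro: L2_translate)

lemma shifts_translate:
  assumes "g \<in> shifts m f"
  shows "translate (of_int k / 2 ^ m) g \<in> shifts m f"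
proof -
  obtain j :: int where j: "g = translate (of_int j / 2 ^ m) f" using assms by (auto simp: shifts_iff)
  have "translate (of_int k / 2 ^ m) g = translate (of_int (k + j) / 2 ^ m) f"
    unfolding j translate_translate by (simp add: add_divide_distrib)
  then show ?thesis unfolding shifts_iff by blast
qed

lemma shifts_translate_unit:
  assumes "g \<in> shifts m f"
  shows "translate (1 / 2 ^ m) g \<in> shifts m f" "translate (- (1 / 2 ^ m)) g \<in> shifts m f"
  using shifts_translate[OF assms, of 1] shifts_translate[OF assms, of "-1"] by simp_all

lemma self_in_shifts: "f \<in> shifts m f"
  unfolding shifts_iff by (intro exI[of _ 0]) simp

lemma closed_span_shifts_cong_AE:
  assumes f: "f \<in> L2" and g: "g \<in> L2" and eq: "AE x in lborel. f x = g x"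
  shows "closed_span (shifts m f) \<subseteq> closed_span (shifts m g)"
proof (rule closed_span_mono[OF shifts_L2[OF f] shifts_L2[OF g]])
  show "shifts m f \<subseteq> closed_span (shifts m g)"
  proof
    fix u assume "u \<in> shifts m f"
    then obtain k :: int where k: "u = translate (of_int k / 2 ^ m) f" by (auto simp: shifts_iff)
    have "translate (of_int k / 2 ^ m) g \<in> closed_span (shifts m g)"
      using g by (intro closed_span_base L2_translate shifts_translate self_in_shifts)
    moreover have "AE x in lborel. translate (of_int k / 2 ^ m) g x = translate (of_int k / 2 ^ m) f x"
      using AE_shift[OF eq, of "of_int k / 2 ^ m"] by eventually_elim simp
    ultimately show "u \<in> closed_span (shifts m g)"
      unfolding k by (intro closed_span_cong_AE[OF shifts_L2[OF g] _ L2_translate[OF f]])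
  qed
qed

section \<open>Supports of finite combinations of translates\<close>

lemma ess_support_translate_iff: "x \<in> ess_support (translate a f) \<longleftrightarrow> x - a \<in> ess_support f"
proof -
  have transl: "y + b \<in> ess_support (translate b g)" if "y \<in> ess_support g" for y b and g :: "real \<Rightarrow> complex"
    unfolding ess_support_iff
  proof (intro allI impI notI)
    fix U assume U: "open U" "y + b \<in> U" "AE x in lborel. x \<in> U \<longrightarrow> translate b g x = 0"
    have "open ((\<lambda>x. x + b) -` U)" using U(1) by (intro open_vimage continuous_intros)
    moreover have "y \<in> (\<lambda>x. x + b) -` U" using U(2) by simp
    moreover have "AE x in lborel. x \<in> (\<lambda>x. x + b) -` U \<longrightarrow> g x = 0"
      using AE_shift[OF U(3), of "- b"] by simp
    ultimately show False using that unfolding ess_support_iff by blast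
  qed
  show ?thesis
    using transl[of "x - a" f a] transl[of x "translate a f" "- a"] by auto
qed

lemma ess_support_nonempty:
  assumes "\<not> (AE x in lborel. f x = 0)"
  shows "ess_support f \<noteq> {}"
  using AE_zero_outside_ess_support[of f] assms by auto

lemma diameter_compact_real:
  fixes S :: "real set"
  assumes "compact S" "S \<noteq> {}"
  shows "diameter S = Sup S - Inf S"
proof (rule antisym)
  have bdd: "bounded S" "bdd_above S" "bdd_below S"
    using compact_imp_bounded[OF assms(1)] by (auto simp: bounded_imp_bdd_above bounded_imp_bdd_below)
  show "diameter S \<le> Sup S - Inf S"
  proof (rule diameter_le)
    fix x y assume "x \<in> S" "y \<in> S"
    then have "Inf S \<le> x" "Inf S \<le> y" "x \<le> Sup S" "y \<le> Sup S"
      using bdd by (auto intro: cInf_lower cSup_upper)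
    then show "norm (x - y) \<le> Sup S - Inf S" by (simp add: abs_if)
  qed (use assms in simp)
  have "Sup S \<in> S" "Inf S \<in> S"
    using assms bdd by (auto intro!: closed_contains_Sup closed_contains_Inf compact_imp_closed)
  then have "dist (Sup S) (Inf S) \<le> diameter S"
    by (rule diameter_bounded_bound[OF bdd(1)])
  then show "Sup S - Inf S \<le> diameter S" by (simp add: dist_real_def)
qed

text \<open>Close to the left end of its support a combination of translates of \<open>f\<close> only sees the first translate,
  close to the right end only the last one, so nothing can cancel there.\<close>

lemma ess_support_shift_poly_ends:
  assumes K: "compact (ess_support f)" and nz: "ess_support f \<noteq> {}" and s: "s > 0"
    and p: "coeff p 0 \<noteq> 0"
  shows "Inf (ess_support f) \<in> ess_support (shift_poly s p f)"
    and "Sup (ess_support f) + real (degree p) * s \<in> ess_support (shift_poly s p f)"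
proof -
  define a where "a = Inf (ess_support f)"
  define b where "b = Sup (ess_support f)"
  define d where "d = degree p"
  have bdd: "bdd_above (ess_support f)" "bdd_below (ess_support f)"
    using compact_imp_bounded[OF K] by (auto simp: bounded_imp_bdd_above bounded_imp_bdd_below)
  have a: "a \<in> ess_support f" and b: "b \<in> ess_support f"
    using nz bdd closed_ess_support by (auto simp: a_def b_def intro!: closed_contains_Sup closed_contains_Inf)
  have "AE x in lborel. x \<notin> {a..b} \<longrightarrow> f x = 0"
    using AE_zero_outside_ess_support[of f]
  proof eventually_elim
    case (elim x)
    then show ?case using bdd by (auto simp: a_def b_def intro: cInf_lower cSup_upper)
  qed
  then have "AE x in lborel. x - real i * s \<notin> {a..b} \<longrightarrow> f (x - real i * s) = 0" for i
    by (rule AE_shift)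
  then have out: "AE x in lborel. \<forall>i. x - real i * s \<notin> {a..b} \<longrightarrow> f (x - real i * s) = 0"
    by (simp add: AE_all_countable)
  have lead: "coeff p d \<noteq> 0" using p by (auto simp: d_def)
  show "Inf (ess_support f) \<in> ess_support (shift_poly s p f)"
    unfolding ess_support_iff a_def[symmetric]
  proof (intro allI impI notI)
    fix U assume U: "open U" "a \<in> U" "AE x in lborel. x \<in> U \<longrightarrow> shift_poly s p f x = 0"
    have "AE x in lborel. x \<in> U \<inter> {..<a + s} \<longrightarrow> f x = 0"
      using U(3) out
    proof eventually_elim
      case (elim x)
      show ?case
      proof
        assume x: "x \<in> U \<inter> {..<a + s}"
        have "f (x - real i * s) = 0" if "i \<noteq> 0" for i
        proof -
          have "1 * s \<le> real i * s" using that s by (intro mult_right_mono) auto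
          then show ?thesis using elim(2) x by auto
        qed
        then have "shift_poly s p f x = (\<Sum>i\<in>{0}. coeff p i * f (x - real i * s))"
          unfolding shift_poly_def by (intro sum.mono_neutral_right) auto
        then show "f x = 0" using elim(1) x p by simp
      qed
    qed
    moreover have "open (U \<inter> {..<a + s})" "a \<in> U \<inter> {..<a + s}" using U s by auto
    ultimately show False using a unfolding ess_support_iff by blast
  qed
  show "Sup (ess_support f) + real (degree p) * s \<in> ess_support (shift_poly s p f)"
    unfolding ess_support_iff b_def[symmetric] d_def[symmetric]
  proof (intro allI impI notI)
    fix U assume U: "open U" "b + real d * s \<in> U" "AE x in lborel. x \<in> U \<longrightarrow> shift_poly s p f x = 0"
    let ?U = "(\<lambda>x. x + real d * s) -` (U \<inter> {b + (real d - 1) * s<..})"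
    have "AE x in lborel. x \<in> U \<inter> {b + (real d - 1) * s<..} \<longrightarrow> f (x - real d * s) = 0"
      using U(3) out
    proof eventually_elim
      case (elim x)
      show ?case
      proof
        assume x: "x \<in> U \<inter> {b + (real d - 1) * s<..}"
        have "f (x - real i * s) = 0" if "i < d" for i
        proof -
          have "real i * s \<le> (real d - 1) * s" using that s by (intro mult_right_mono) auto
          then show ?thesis using elim(2) x by auto
        qed
        then have "shift_poly s p f x = (\<Sum>i\<in>{d}. coeff p i * f (x - real i * s))"
          unfolding shift_poly_def d_def[symmetric] by (intro sum.mono_neutral_right) auto
        then show "f (x - real d * s) = 0" using elim(1) x lead by simp
      qed
    qed
    from AE_shift[OF this, of "- (real d * s)"] have "AE x in lborel. x \<in> ?U \<longrightarrow> f x = 0" by simp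
    moreover have "open ?U" using U(1) by (intro open_vimage continuous_intros open_Int open_greaterThan)
    moreover have "b \<in> ?U" using U(2) s by (simp add: algebra_simps)
    ultimately show False using b unfolding ess_support_iff by blast
  qed
qed

lemma diameter_ess_support_shift_poly:
  assumes f: "f \<in> compact_L2" and nz: "\<not> (AE x in lborel. f x = 0)" and s: "s > 0" and p: "coeff p 0 \<noteq> 0"
  shows "diameter (ess_support f) + real (degree p) * s \<le> diameter (ess_support (translate a (shift_poly s p f)))"
proof -
  have K: "compact (ess_support f)" using f by (rule compact_L2_compact_ess_support)
  have ne: "ess_support f \<noteq> {}" using nz by (rule ess_support_nonempty)
  have bdd: "bounded (ess_support (translate a (shift_poly s p f)))"
    using f by (intro compact_imp_bounded compact_L2_compact_ess_support compact_L2_translate compact_L2_shift_poly)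
  let ?l = "Inf (ess_support f)" and ?r = "Sup (ess_support f) + real (degree p) * s"
  have "?l + a \<in> ess_support (translate a (shift_poly s p f))" "?r + a \<in> ess_support (translate a (shift_poly s p f))"
    unfolding ess_support_translate_iff using ess_support_shift_poly_ends[OF K ne s p] by simp_all
  then have "dist (?r + a) (?l + a) \<le> diameter (ess_support (translate a (shift_poly s p f)))"
    by (intro diameter_bounded_bound[OF bdd])
  then show ?thesis unfolding diameter_compact_real[OF K ne] dist_real_def by linarith
qed

lemma shift_poly_normalize_constant_term:
  "p \<noteq> 0 \<Longrightarrow> \<exists>a p'. coeff p' 0 \<noteq> 0 \<and> shift_poly s p f = translate (real a * s) (shift_poly s p' f)"
proof (induction p)
  case (pCons c p)
  show ?case
  proof (cases "c = 0")
    case True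
    then have "p \<noteq> 0" using pCons.hyps by auto
    then obtain a p' where a: "coeff p' 0 \<noteq> 0" "shift_poly s p f = translate (real a * s) (shift_poly s p' f)"
      using pCons.IH by blast
    have "shift_poly s (pCons c p) f = translate (real (Suc a) * s) (shift_poly s p' f)"
      unfolding shift_poly_pCons_fun True a(2) by (simp add: fun_eq_iff algebra_simps)
    then show ?thesis using a(1) by blast
  next
    case False
    have "shift_poly s (pCons c p) f = translate (real 0 * s) (shift_poly s (pCons c p) f)" by simp
    then show ?thesis using False by (metis coeff_pCons_0)
  qed
qed simp

section \<open>Orthogonal complements between refinement levels\<close>

text \<open>The even and odd parts of the symbols \<open>A\<close> and \<open>B\<close> form a two-by-two system for
  \<open>f\<close> and its translate by \<open>h\<close>, with coefficients in the polynomials in the translation by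
  \<open>2 h\<close>. By Cramer's rule its determinant maps both functions into the closed span, and it can be divided
  out there. The hypothesis \<open>det\<close> says that its value at \<open>1\<close> is not zero.\<close>

lemma closed_span_fine_generators:
  assumes f: "f \<in> compact_L2" and S: "S \<subseteq> L2" and t: "t = 2 * h" "t > 0"
    and inv: "\<And>g. g \<in> S \<Longrightarrow> translate t g \<in> S" "\<And>g. g \<in> S \<Longrightarrow> translate (- t) g \<in> S"
    and A: "shift_poly h A f \<in> closed_span S" and B: "shift_poly h B f \<in> closed_span S"
    and det: "poly A 1 * poly B (- 1) \<noteq> poly A (- 1) * poly B 1"
  shows "f \<in> closed_span S" "translate h f \<in> closed_span S"
proof -
  obtain Ae Ao where Aeo: "A = pcompose Ae (monom 1 2) + [:0, 1:] * pcompose Ao (monom 1 2)"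
    using poly_even_odd_parts by blast
  obtain Be Bo where Beo: "B = pcompose Be (monom 1 2) + [:0, 1:] * pcompose Bo (monom 1 2)"
    using poly_even_odd_parts by blast
  define D where "D = Bo * Ae - Ao * Be"
  have "2 * poly D 1 = poly A (- 1) * poly B 1 - poly A 1 * poly B (- 1)"
    unfolding D_def poly_even_odd_parts_eval[OF Aeo] poly_even_odd_parts_eval[OF Beo]
    by (simp add: algebra_simps)
  then have D: "D \<noteq> 0" using det by auto
  have Af: "shift_poly h A f = (\<lambda>x. shift_poly t Ae f x + shift_poly t Ao (translate h f) x)"
    and Bf: "shift_poly h B f = (\<lambda>x. shift_poly t Be f x + shift_poly t Bo (translate h f) x)"
    unfolding fun_eq_iff t by (simp_all add: shift_poly_even_odd_parts[OF Aeo] shift_poly_even_odd_parts[OF Beo])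
  have comb: "(\<lambda>x. shift_poly t p (shift_poly h A f) x - shift_poly t r (shift_poly h B f) x) \<in> closed_span S" for p r
    by (intro closed_span_diff S closed_span_shift_poly inv A B)
  have "(\<lambda>x. shift_poly t Bo (shift_poly h A f) x - shift_poly t Ao (shift_poly h B f) x) = shift_poly t D f"
    unfolding Af Bf fun_eq_iff shift_poly_fun_add D_def shift_poly_diff shift_poly_mult[symmetric]
    by (simp add: mult.commute)
  with comb[of Bo Ao] have "shift_poly t D f \<in> closed_span S" by simp
  then show "f \<in> closed_span S"
    using t D by (intro closed_span_divide_shift_poly[OF S inv _ f]) auto
  have "(\<lambda>x. shift_poly t (- Be) (shift_poly h A f) x - shift_poly t (- Ae) (shift_poly h B f) x) = shift_poly t D (translate h f)"
    unfolding Af Bf fun_eq_iff shift_poly_fun_add D_def shift_poly_diff shift_poly_mult[symmetric]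
    by (simp add: mult.commute shift_poly_diff[of t 0, simplified] shift_poly_mult)
  with comb[of "- Be" "- Ae"] have "shift_poly t D (translate h f) \<in> closed_span S" by simp
  then show "translate h f \<in> closed_span S"
    using t D by (intro closed_span_divide_shift_poly[OF S inv _ compact_L2_translate[OF f]]) auto
qed

lemma norm_sq_diff_orthogonal:
  assumes "u \<in> L2" "a \<in> L2" "l2_inner u a = 0"
  shows "norm_sq (\<lambda>x. u x - a x) = norm_sq u + norm_sq a"
proof -
  have "l2_inner a u = 0" using l2_inner_cnj[of a u] assms(3) by simp
  then have "l2_inner (\<lambda>x. u x - a x) (\<lambda>x. u x - a x) = l2_inner u u + l2_inner a a"
    using assms by (simp add: l2_inner_diff_left l2_inner_diff_right L2_diff)
  then have "complex_of_real (norm_sq (\<lambda>x. u x - a x)) = complex_of_real (norm_sq u + norm_sq a)"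
    by (simp add: l2_inner_self)
  then show ?thesis by (simp only: of_real_eq_iff)
qed

text \<open>In an approximation of \<open>f\<close> by \<open>a + b\<close> the part \<open>a\<close> is orthogonal to both
  \<open>f\<close> and \<open>b\<close>; by Pythagoras, omitting it only improves the approximation.\<close>

lemma closed_span_orthogonal_part:
  assumes S: "S \<subseteq> L2" and T: "T \<subseteq> L2" and f: "f \<in> closed_span (S \<union> T)"
    and ST: "\<And>a b. a \<in> S \<Longrightarrow> b \<in> T \<Longrightarrow> l2_inner b a = 0"
    and fS: "\<And>a. a \<in> S \<Longrightarrow> l2_inner f a = 0"
  shows "f \<in> closed_span T"
  unfolding closed_span_iff
proof (intro conjI allI impI)
  show fL: "f \<in> L2" using f by (rule closed_span_L2)
  fix \<epsilon> :: real assume "\<epsilon> > 0"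
  then obtain g where g: "g \<in> cfun.span (S \<union> T)" "norm_sq (\<lambda>x. f x - g x) < \<epsilon>"
    using f unfolding closed_span_iff by blast
  then obtain a b where ab: "a \<in> cfun.span S" "b \<in> cfun.span T" "g = a + b"
    unfolding cfun.span_Un by auto
  have aL: "a \<in> L2" and bL: "b \<in> L2" using ab S T cfun_span_L2 by auto
  have span_closed: "u \<in> closed_span U" if "u \<in> cfun.span U" "U \<subseteq> L2" for u U
    unfolding closed_span_iff using that cfun_span_L2[OF that(2,1)]
    by (auto intro!: bexI[of _ u] simp: norm_sq_def)
  have "l2_inner f a = 0"
    by (rule orthogonal_closed_span[OF S fL fS span_closed[OF ab(1) S]])
  moreover have "l2_inner b a = 0"
  proof -
    have "l2_inner s b = 0" if "s \<in> S" for s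
    proof (rule orthogonal_closed_span[OF T _ _ span_closed[OF ab(2) T]])
      show "s \<in> L2" using that S by auto
      show "l2_inner s w = 0" if "w \<in> T" for w
        using ST[OF \<open>s \<in> S\<close> that] l2_inner_cnj[of s w] by simp
    qed
    then have "l2_inner b s = 0" if "s \<in> S" for s using that l2_inner_cnj[of b s] by simp
    then show ?thesis by (rule orthogonal_closed_span[OF S bL _ span_closed[OF ab(1) S]])
  qed
  ultimately have orth: "l2_inner (\<lambda>x. f x - b x) a = 0"
    using fL bL aL by (simp add: l2_inner_diff_left)
  have "norm_sq (\<lambda>x. f x - b x) \<le> norm_sq (\<lambda>x. f x - b x) + norm_sq a" by simp
  also have "\<dots> = norm_sq (\<lambda>x. (f x - b x) - a x)"
    using norm_sq_diff_orthogonal[OF L2_diff[OF fL bL] aL orth] by simp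
  also have "\<dots> < \<epsilon>" using g(2) by (simp add: ab(3) plus_fun_def algebra_simps)
  finally show "\<exists>g\<in>cfun.span T. norm_sq (\<lambda>x. f x - g x) < \<epsilon>" using ab(2) by blast
qed

section \<open>The wavelet\<close>

lemma neg_one_powi: "(- 1 :: complex) powi k = (if even k then 1 else - 1)"
  by (auto simp: power_int_minus_left)

lemma laurent_alternate:
  assumes z: "z \<noteq> 0"
  shows "laurent (\<lambda>k. (- 1) powi k * c (k - 1)) z = - z * laurent c (- z)"
proof -
  have "laurent (\<lambda>k. (- 1) powi k * c (k - 1)) z = laurent (\<lambda>k. c (k + - 1)) (- z)"
  proof -
    have "(- 1) powi k * c (k - 1) * z powi k = c (k + - 1) * (- z) powi k" for k
    proof -
      have "(- z) powi k = (- 1) powi k * z powi k"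
        using power_int_mult_distrib[of "- 1" z k] by simp
      then show ?thesis by simp
    qed
    then show ?thesis unfolding laurent_def by (intro sum.cong) (simp, blast)
  qed
  also have "\<dots> = laurent c (- z) / (- z) powi (- 1)"
    using z by (intro laurent_shift) simp
  finally show ?thesis using z by (simp add: power_int_minus field_simps)
qed

lemma psi_finite_sum:
  assumes "\<And>\<alpha>. \<bar>\<alpha>\<bar> > M \<Longrightarrow> gcoeff \<phi> m (\<alpha> - 1) = 0"
  shows "psi \<phi> m x = (\<Sum>\<alpha>\<in>{- M..M}. (- 1) powi \<alpha> * gcoeff \<phi> m (\<alpha> - 1) *
    \<phi> (m + 1) (x - of_int \<alpha> / 2 ^ (m + 1)))"
proof -
  have "psi \<phi> m x = infsum (\<lambda>\<alpha>. (- 1) powi \<alpha> * gcoeff \<phi> m (\<alpha> - 1) *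
    \<phi> (m + 1) (x - of_int \<alpha> / 2 ^ (m + 1))) {- M..M}"
    unfolding psi_def
  proof (rule infsum_cong_neutral)
    fix \<alpha> assume "\<alpha> \<in> UNIV - {- M..M}"
    then have "\<bar>\<alpha>\<bar> > M" by auto
    then show "(- 1) powi \<alpha> * gcoeff \<phi> m (\<alpha> - 1) * \<phi> (m + 1) (x - of_int \<alpha> / 2 ^ (m + 1)) = 0"
      using assms by simp
  qed auto
  then show ?thesis by simp
qed

context hurwitz_masks
begin

lemma gcoeff_eq_correlation: "gcoeff limit_cfun m = correlation (1 / 2 ^ Suc m) (limit_cfun m) (limit_cfun (Suc m))"
  by (simp add: fun_eq_iff gcoeff_def correlation_def)

text \<open>An even bound is chosen, because then \<open>psi\<close> differs from a polynomial in the fine translation by a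
  translation in the coarse lattice.\<close>

lemma gcoeff_bounded_support: "\<exists>J::nat. \<forall>\<alpha>. \<bar>\<alpha>\<bar> > int (2 * J) \<longrightarrow> gcoeff limit_cfun m (\<alpha> - 1) = 0"
proof -
  have "finite {k. gcoeff limit_cfun m k \<noteq> 0}"
    unfolding gcoeff_eq_correlation by (intro correlation_finite limit_cfun_compact_L2) simp
  then obtain M :: nat where M: "\<And>k. \<bar>k\<bar> > int M \<Longrightarrow> gcoeff limit_cfun m k = 0"
    using finite_int_support_bound by blast
  have "gcoeff limit_cfun m (\<alpha> - 1) = 0" if "\<bar>\<alpha>\<bar> > int (2 * (M + 1))" for \<alpha>
    using that by (intro M) (simp; linarith)
  then show ?thesis by blast
qed

text \<open>The symbol of \<open>psi\<close> is, up to a power of the variable, the alternated cross-correlation symbol of two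
  consecutive levels, whose roots are nonpositive; alternating the signs reflects them.\<close>

lemma psi_symbol:
  obtains B J where
    "psi limit_cfun m = translate (- (of_int (int J) / 2 ^ m)) (shift_poly (1 / 2 ^ Suc m) B (limit_cfun (Suc m)))"
    "\<And>w. w \<noteq> 0 \<Longrightarrow> poly B w = 0 \<Longrightarrow> - w \<in> \<real>\<^sub>\<le>\<^sub>0"
proof -
  obtain J where J: "\<And>\<alpha>. \<bar>\<alpha>\<bar> > int (2 * J) \<Longrightarrow> gcoeff limit_cfun m (\<alpha> - 1) = 0"
    using gcoeff_bounded_support by blast
  define c where "c \<alpha> = (- 1) powi \<alpha> * gcoeff limit_cfun m (\<alpha> - 1)" for \<alpha>
  define B where "B = laurent_poly (2 * J) c"
  have "psi limit_cfun m x = shift_poly (1 / 2 ^ Suc m) B (limit_cfun (Suc m)) (x + real J / 2 ^ m)" for x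
  proof -
    have "psi limit_cfun m x = (\<Sum>\<alpha>\<in>{- int (2 * J)..int (2 * J)}. c \<alpha> * limit_cfun (Suc m) (x - of_int \<alpha> * (1 / 2 ^ Suc m)))"
      by (subst psi_finite_sum[OF J]) (auto simp: c_def)
    also have "\<dots> = shift_poly (1 / 2 ^ Suc m) B (limit_cfun (Suc m)) (x + real (2 * J) * (1 / 2 ^ Suc m))"
      unfolding B_def by (rule shift_poly_laurent_poly[symmetric])
    finally show ?thesis by simp
  qed
  then have "psi limit_cfun m = translate (- (of_int (int J) / 2 ^ m)) (shift_poly (1 / 2 ^ Suc m) B (limit_cfun (Suc m)))"
    by (simp add: fun_eq_iff)
  moreover have "- w \<in> \<real>\<^sub>\<le>\<^sub>0" if w: "w \<noteq> 0" and root: "poly B w = 0" for w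
  proof -
    have "poly B w = laurent c w * w ^ (2 * J)"
      unfolding B_def using w J by (intro poly_laurent_poly) (auto simp: c_def)
    then have "laurent c w = 0" using w root by simp
    then have "laurent (gcoeff limit_cfun m) (- w) = 0"
      using laurent_alternate[OF w, of "gcoeff limit_cfun m"] w by (simp add: c_def[abs_def])
    then show ?thesis
      using w unfolding gcoeff_eq_correlation by (intro cross_correlation_roots) auto
  qed
  ultimately show ?thesis by (rule that)
qed

lemma psi_compact_L2: "psi limit_cfun m \<in> compact_L2"
proof -
  obtain B J where "psi limit_cfun m = translate (- (of_int (int J) / 2 ^ m)) (shift_poly (1 / 2 ^ Suc m) B (limit_cfun (Suc m)))"
    by (rule psi_symbol)
  then show ?thesis by (simp only: compact_L2_translate compact_L2_shift_poly limit_cfun_compact_L2)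
qed

text \<open>The reflection \<open>\<alpha> \<mapsto> 2\<beta> + 1 - \<alpha>\<close> interchanges the two correlation coefficients
  in each term of the inner product and changes its sign, so the terms cancel in pairs.\<close>

lemma psi_orthogonal:
  "l2_inner (psi limit_cfun m) (translate (of_int \<beta> / 2 ^ m) (limit_cfun m)) = 0"
proof -
  define h :: real where "h = 1 / 2 ^ Suc m"
  let ?g = "gcoeff limit_cfun m"
  obtain J where J: "\<And>\<alpha>. \<bar>\<alpha>\<bar> > int (2 * J) \<Longrightarrow> ?g (\<alpha> - 1) = 0"
    using gcoeff_bounded_support by blast
  let ?I = "{- int (2 * J)..int (2 * J)}"
  have psi: "psi limit_cfun m = (\<lambda>x. \<Sum>\<alpha>\<in>?I. ((- 1) powi \<alpha> * ?g (\<alpha> - 1)) * translate (of_int \<alpha> * h) (limit_cfun (Suc m)) x)"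
    unfolding fun_eq_iff by (subst psi_finite_sum[OF J]) (auto simp: h_def)
  have inner: "l2_inner (translate (of_int \<alpha> * h) (limit_cfun (Suc m))) (translate (of_int \<beta> / 2 ^ m) (limit_cfun m)) = ?g (2 * \<beta> - \<alpha>)" for \<alpha>
  proof -
    have two_h: "of_int \<beta> / 2 ^ m = of_int (2 * \<beta>) * h" by (simp add: h_def)
    have "l2_inner (translate (of_int \<alpha> * h) (limit_cfun (Suc m))) (translate (of_int \<beta> / 2 ^ m) (limit_cfun m)) =
      (LINT x|lborel. limit_cfun m (x - of_int (2 * \<beta>) * h) *
         limit_cfun (Suc m) (x - of_int (2 * \<beta>) * h + of_int (2 * \<beta> - \<alpha>) * h))"
      unfolding l2_inner_def two_h by (simp add: algebra_simps)
    also have "\<dots> = (LINT x|lborel. limit_cfun m x * limit_cfun (Suc m) (x + of_int (2 * \<beta> - \<alpha>) * h))"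
      by (rule integral_shift[of "\<lambda>x. limit_cfun m x * limit_cfun (Suc m) (x + of_int (2 * \<beta> - \<alpha>) * h)"])
    finally show ?thesis by (simp add: gcoeff_eq_correlation correlation_def h_def)
  qed
  define t where "t \<alpha> = (- 1) powi \<alpha> * ?g (\<alpha> - 1) * ?g (2 * \<beta> - \<alpha>)" for \<alpha>
  have "l2_inner (psi limit_cfun m) (translate (of_int \<beta> / 2 ^ m) (limit_cfun m)) = (\<Sum>\<alpha>\<in>?I. t \<alpha>)"
    unfolding psi
    by (subst l2_inner_sum_left) (simp_all only: L2_cmult L2_translate compact_L2_L2 limit_cfun_compact_L2 l2_inner_cmult_left inner t_def[abs_def])
  also have "\<dots> = (\<Sum>\<alpha> | t \<alpha> \<noteq> 0. t \<alpha>)"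
  proof (rule sum.mono_neutral_right)
    have "\<not> \<bar>\<alpha>\<bar> > int (2 * J)" if "t \<alpha> \<noteq> 0" for \<alpha> using J[of \<alpha>] that by (auto simp: t_def)
    then show "{\<alpha>. t \<alpha> \<noteq> 0} \<subseteq> ?I" by (auto simp: not_less abs_le_iff) (metis abs_le_iff minus_le_iff)+
  qed auto
  also have "\<dots> = 0"
  proof -
    have anti: "t (2 * \<beta> + 1 - \<alpha>) = - t \<alpha>" for \<alpha>
      by (simp add: t_def neg_one_powi algebra_simps)
    have "(\<Sum>\<alpha> | t \<alpha> \<noteq> 0. t \<alpha>) = (\<Sum>\<alpha> | t \<alpha> \<noteq> 0. - t \<alpha>)"
      by (rule sum.reindex_bij_witness[of _ "\<lambda>\<alpha>. 2 * \<beta> + 1 - \<alpha>" "\<lambda>\<alpha>. 2 * \<beta> + 1 - \<alpha>"]) (auto simp: anti)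
    then show ?thesis by (simp add: sum_negf)
  qed
  finally show ?thesis .
qed

lemma psi_orthogonal_shifts:
  assumes "a \<in> shifts m (limit_cfun m)" "b \<in> shifts m (psi limit_cfun m)"
  shows "l2_inner b a = 0"
proof -
  obtain i j :: int where a: "a = translate (of_int i / 2 ^ m) (limit_cfun m)" and b: "b = translate (of_int j / 2 ^ m) (psi limit_cfun m)"
    using assms by (auto simp: shifts_iff)
  have "a = translate (of_int j / 2 ^ m) (translate (of_int (i - j) / 2 ^ m) (limit_cfun m))"
    unfolding a translate_translate by (simp add: diff_divide_distrib)
  then show ?thesis unfolding b by (simp only: l2_inner_translate psi_orthogonal)
qed

text \<open>Divisibility by \<open>T\<^sup>2 - c\<close>, with \<open>T\<close> the fine translation, would make both square roots
  of \<open>c\<close> roots of the symbol, as the fine generator is divisible by neither factor. But the roots of the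
  symbol are positive.\<close>

lemma not_shift_divisible_psi:
  assumes c: "c \<noteq> 0"
  shows "\<not> shift_divisible (1 / 2 ^ m) c (psi limit_cfun m)"
proof
  assume div: "shift_divisible (1 / 2 ^ m) c (psi limit_cfun m)"
  define h :: real where "h = 1 / 2 ^ Suc m"
  obtain B J where psi: "psi limit_cfun m = translate (- (of_int (int J) / 2 ^ m)) (shift_poly h B (limit_cfun (Suc m)))"
    and roots: "\<And>w. w \<noteq> 0 \<Longrightarrow> poly B w = 0 \<Longrightarrow> - w \<in> \<real>\<^sub>\<le>\<^sub>0"
    unfolding h_def by (rule psi_symbol) blast
  define a where "a = of_int (int J) / (2 ^ m :: real)"
  obtain u where u: "u \<in> compact_L2" "AE x in lborel. psi limit_cfun m x = u (x - 1 / 2 ^ m) - c * u x"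
    using div by (auto simp: shift_divisible_def)
  have "AE x in lborel. shift_poly h B (limit_cfun (Suc m)) x = translate a u (x - 2 * h) - (csqrt c)\<^sup>2 * translate a u x"
    using AE_shift[OF u(2), of a]
  proof eventually_elim
    case (elim x)
    have "shift_poly h B (limit_cfun (Suc m)) x = psi limit_cfun m (x - a)" by (simp add: psi a_def)
    also have "\<dots> = translate a u (x - 2 * h) - (csqrt c)\<^sup>2 * translate a u x"
      unfolding elim by (simp add: h_def algebra_simps)
    finally show ?case .
  qed
  then have div2: "shift_divisible (2 * h) ((csqrt c)\<^sup>2) (shift_poly h B (limit_cfun (Suc m)))"
    unfolding shift_divisible_def using compact_L2_translate[OF u(1)] by blast
  have root: "poly B w = 0" if "w \<noteq> 0" "w\<^sup>2 = (csqrt c)\<^sup>2" for w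
  proof (rule ccontr)
    assume nz: "poly B w \<noteq> 0"
    have "shift_divisible h w (shift_poly h B (limit_cfun (Suc m)))" using div2 that by (intro shift_divisible_square[of h w]) simp
    then have "shift_divisible h w (limit_cfun (Suc m))" using nz by (rule shift_divisible_of_shift_poly[OF limit_cfun_compact_L2])
    then show False using not_shift_divisible_limit_cfun[OF that(1), of "Suc m"] unfolding h_def by blast
  qed
  have w: "csqrt c \<noteq> 0" using c by simp
  have "- csqrt c \<in> \<real>\<^sub>\<le>\<^sub>0" "csqrt c \<in> \<real>\<^sub>\<le>\<^sub>0"
    using roots[of "csqrt c"] roots[of "- csqrt c"] root[of "csqrt c"] root[of "- csqrt c"] w by auto
  then show False using w by (auto simp: complex_nonpos_Reals_iff complex_eq_iff)
qed

lemma psi_not_zero: "\<not> (AE x in lborel. psi limit_cfun m x = 0)"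
  using not_shift_divisible_psi[of 1 m] shift_divisible_AE_zero by auto

lemma shift_poly_in_shift_span:
  assumes "f \<in> L2"
  shows "shift_poly (1 / 2 ^ m) p f \<in> closed_span (shifts m f)"
  using assms by (intro closed_span_shift_poly shifts_L2 shifts_translate_unit closed_span_base self_in_shifts)

lemma psi_in_V: "psi limit_cfun m \<in> V limit_cfun (Suc m)"
proof -
  obtain B J where psi: "psi limit_cfun m = translate (- (of_int (int J) / 2 ^ m)) (shift_poly (1 / 2 ^ Suc m) B (limit_cfun (Suc m)))"
    by (rule psi_symbol)
  have "- (of_int (int J) / 2 ^ m) = of_int (- (2 * int J)) / (2 ^ Suc m :: real)" by simp
  then show ?thesis unfolding psi V_def
    using closed_span_translate[OF shift_poly_in_shift_span[OF limit_cfun_L2, of "Suc m" B] shifts_translate] by metis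
qed

lemma shifts_coarse_in_fine:
  assumes "f \<in> closed_span (shifts (Suc m) g)" "f \<in> L2" "g \<in> L2"
  shows "closed_span (shifts m f) \<subseteq> closed_span (shifts (Suc m) g)"
proof (rule closed_span_mono[OF shifts_L2[OF assms(2)] shifts_L2[OF assms(3)]])
  show "shifts m f \<subseteq> closed_span (shifts (Suc m) g)"
  proof
    fix u assume "u \<in> shifts m f"
    then obtain k :: int where "u = translate (of_int k / 2 ^ m) f" by (auto simp: shifts_iff)
    moreover have "of_int k / 2 ^ m = of_int (2 * k) / (2 ^ Suc m :: real)" by simp
    ultimately show "u \<in> closed_span (shifts (Suc m) g)"
      using closed_span_translate[OF assms(1) shifts_translate] by metis
  qed
qed

text \<open>At \<open>- 1\<close> the mask vanishes and the symbol of \<open>psi\<close> does not, so the determinant of the two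
  symbols is not zero. The closed span contains the fine generator and its translate by the fine lattice constant,
  whose coarse translates are all the fine translates.\<close>

lemma V_Suc_subset:
  "V limit_cfun (Suc m) \<subseteq> closed_span (shifts m (limit_cfun m) \<union> shifts m (psi limit_cfun m))"
proof -
  define S where "S = shifts m (limit_cfun m) \<union> shifts m (psi limit_cfun m)"
  define h :: real where "h = 1 / 2 ^ Suc m"
  define t :: real where "t = 1 / 2 ^ m"
  have t: "t = 2 * h" "t > 0" by (simp_all add: t_def h_def)
  have S: "S \<subseteq> L2"
    using shifts_L2[OF limit_cfun_L2] shifts_L2[OF compact_L2_L2[OF psi_compact_L2]] by (auto simp: S_def)
  have inv: "translate t g \<in> S" "translate (- t) g \<in> S" if "g \<in> S" for g
    using that shifts_translate_unit by (auto simp: S_def t_def)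
  have inv_int: "translate (of_int k / 2 ^ m) g \<in> S" if "g \<in> S" for g k
    using that shifts_translate by (auto simp: S_def)
  obtain B J where psi: "psi limit_cfun m = translate (- (of_int (int J) / 2 ^ m)) (shift_poly h B (limit_cfun (Suc m)))"
    and roots: "\<And>w. w \<noteq> 0 \<Longrightarrow> poly B w = 0 \<Longrightarrow> - w \<in> \<real>\<^sub>\<le>\<^sub>0"
    unfolding h_def by (rule psi_symbol) blast
  let ?A = "cpoly (mask_poly m)"
  have A: "shift_poly h ?A (limit_cfun (Suc m)) \<in> closed_span S"
  proof -
    have "limit_cfun m \<in> closed_span S"
      by (intro closed_span_base limit_cfun_L2) (simp add: S_def self_in_shifts)
    then show ?thesis unfolding h_def limit_cfun_refine[symmetric] .
  qed
  have B: "shift_poly h B (limit_cfun (Suc m)) \<in> closed_span S"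
  proof -
    have "shift_poly h B (limit_cfun (Suc m)) = translate (of_int (int J) / 2 ^ m) (psi limit_cfun m)"
      unfolding psi by simp
    moreover have "\<dots> \<in> S" using shifts_translate[OF self_in_shifts] by (auto simp: S_def simp del: of_int_of_nat_eq)
    ultimately show ?thesis using S by (intro closed_span_base) auto
  qed
  have "poly ?A 1 = 1" using poly_cpoly_of_real[of "mask_poly m" 1] by (simp add: mask_poly_one)
  moreover have "poly ?A (- 1) = 0" by (rule mask_poly_minus_1)
  moreover have "poly B (- 1) \<noteq> 0" using roots[of "- 1"] by (auto simp: complex_nonpos_Reals_iff)
  ultimately have det: "poly ?A 1 * poly B (- 1) \<noteq> poly ?A (- 1) * poly B 1" by simp
  note gens = closed_span_fine_generators[OF limit_cfun_compact_L2 S t inv A B det]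
  have "shifts (Suc m) (limit_cfun (Suc m)) \<subseteq> closed_span S"
  proof
    fix u assume "u \<in> shifts (Suc m) (limit_cfun (Suc m))"
    then obtain k :: int where k: "u = translate (of_int k / 2 ^ Suc m) (limit_cfun (Suc m))" by (auto simp: shifts_iff)
    show "u \<in> closed_span S"
    proof (cases "even k")
      case True
      then obtain j where "k = 2 * j" by (elim evenE)
      then have "of_int k / 2 ^ Suc m = of_int j / (2 ^ m :: real)" by simp
      then show ?thesis unfolding k using closed_span_translate[OF gens(1) inv_int] by metis
    next
      case False
      then obtain j where "k = 2 * j + 1" by (elim oddE)
      then have "u = translate (of_int j / 2 ^ m) (translate h (limit_cfun (Suc m)))"
        unfolding k translate_translate by (simp add: h_def add_divide_distrib)
      then show ?thesis using closed_span_translate[OF gens(2) inv_int] by metis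
    qed
  qed
  then show ?thesis unfolding V_def S_def[symmetric]
    by (intro closed_span_mono shifts_L2 limit_cfun_L2 S)
qed

lemma W_eq_closed_span: "W limit_cfun m = closed_span (shifts m (psi limit_cfun m))"
proof
  have psiL: "psi limit_cfun m \<in> L2" using psi_compact_L2 by (rule compact_L2_L2)
  show "W limit_cfun m \<subseteq> closed_span (shifts m (psi limit_cfun m))"
  proof
    fix f assume f: "f \<in> W limit_cfun m"
    then have "f \<in> closed_span (shifts m (limit_cfun m) \<union> shifts m (psi limit_cfun m))"
      using V_Suc_subset by (auto simp: W_def)
    moreover have "l2_inner f a = 0" if "a \<in> shifts m (limit_cfun m)" for a
    proof -
      have "a \<in> V limit_cfun m" unfolding V_def using that shifts_L2[OF limit_cfun_L2] by (intro closed_span_base) auto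
      then show ?thesis using f by (simp add: W_def)
    qed
    ultimately show "f \<in> closed_span (shifts m (psi limit_cfun m))"
      by (intro closed_span_orthogonal_part[OF shifts_L2[OF limit_cfun_L2] shifts_L2[OF psiL]])
         (auto intro: psi_orthogonal_shifts)
  qed
  show "closed_span (shifts m (psi limit_cfun m)) \<subseteq> W limit_cfun m"
  proof
    fix f assume f: "f \<in> closed_span (shifts m (psi limit_cfun m))"
    have "f \<in> V limit_cfun (m + 1)"
      using shifts_coarse_in_fine[OF psi_in_V[unfolded V_def] psiL limit_cfun_L2] f by (auto simp: V_def)
    moreover have "l2_inner f g = 0" if g: "g \<in> V limit_cfun m" for g
    proof (rule orthogonal_closed_span[OF shifts_L2[OF limit_cfun_L2] closed_span_L2[OF f] _ g[unfolded V_def]])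
      fix a assume a: "a \<in> shifts m (limit_cfun m)"
      have "l2_inner a f = 0"
      proof (rule orthogonal_closed_span[OF shifts_L2[OF psiL] _ _ f])
        show "a \<in> L2" using a shifts_L2[OF limit_cfun_L2] by auto
        show "l2_inner a b = 0" if "b \<in> shifts m (psi limit_cfun m)" for b
          using psi_orthogonal_shifts[OF a that] l2_inner_cnj[of a b] by simp
      qed
      then show "l2_inner f a = 0" using l2_inner_cnj[of f a] by simp
    qed
    ultimately show "f \<in> W limit_cfun m" by (simp add: W_def)
  qed
qed

end

section \<open>Compactly supported elements of the wavelet space\<close>

lemma l2_inner_translates_finite:
  assumes u: "u \<in> compact_L2" and v: "v \<in> compact_L2" and t: "t > 0"
  shows "finite {k::int. l2_inner u (translate (of_int k * t) v) \<noteq> 0}"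
proof -
  define w where "w = (\<lambda>x. cnj (v x))"
  have "w \<in> compact_L2" using v unfolding w_def compact_L2_def L2_def by auto
  have eq: "l2_inner u (translate (of_int k * t) v) = correlation t u w (- k)" for k
    by (simp add: l2_inner_def correlation_def w_def)
  have "{k. l2_inner u (translate (of_int k * t) v) \<noteq> 0} = uminus -` {k. correlation t u w k \<noteq> 0}"
    unfolding eq by auto
  then show ?thesis using finite_vimageI[OF correlation_finite[OF u \<open>w \<in> compact_L2\<close> t], of uminus] by simp
qed

lemma convolution_commute:
  fixes a b :: "int \<Rightarrow> complex"
  assumes A: "finite A" "\<And>k. k \<notin> A \<Longrightarrow> a k = 0" "\<And>k. k \<notin> A \<Longrightarrow> b k = 0"
  shows "(\<Sum>k\<in>A. a k * b (i - k)) = (\<Sum>k\<in>A. b k * a (i - k))"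
proof -
  have "(\<Sum>k\<in>A. a k * b (i - k)) = (\<Sum>k | a k * b (i - k) \<noteq> 0. a k * b (i - k))"
    using A by (intro sum.mono_neutral_right) auto
  also have "\<dots> = (\<Sum>k | b k * a (i - k) \<noteq> 0. b k * a (i - k))"
    by (rule sum.reindex_bij_witness[of _ "\<lambda>k. i - k" "\<lambda>k. i - k"]) auto
  also have "\<dots> = (\<Sum>k\<in>A. b k * a (i - k))"
    using A by (intro sum.mono_neutral_left) auto
  finally show ?thesis .
qed

text \<open>Both sides have the same inner products with all translates of \<open>f\<close>: these are the two orders of a
  convolution. Their difference lies in the closed span of these translates, so it vanishes.\<close>

lemma gram_relation:
  assumes f: "f \<in> compact_L2" and h: "h \<in> compact_L2" and hV: "h \<in> closed_span (shifts m f)"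
    and r: "\<And>k. \<bar>k\<bar> > int M \<Longrightarrow> l2_inner f (translate (of_int k / 2 ^ m) f) = 0"
    and q: "\<And>k. \<bar>k\<bar> > int M \<Longrightarrow> l2_inner h (translate (of_int k / 2 ^ m) f) = 0"
  shows "AE x in lborel.
    shift_poly (1 / 2 ^ m) (laurent_poly M (\<lambda>k. l2_inner f (translate (of_int k / 2 ^ m) f))) h x =
    shift_poly (1 / 2 ^ m) (laurent_poly M (\<lambda>k. l2_inner h (translate (of_int k / 2 ^ m) f))) f x"
proof -
  define s where "s k = of_int k / (2 ^ m :: real)" for k :: int
  define R where "R k = l2_inner f (translate (s k) f)" for k
  define Q where "Q k = l2_inner h (translate (s k) f)" for k
  let ?I = "{- int M..int M}"
  \<comment> \<open>The difference of the two sides of the claim, up to a translation by \<open>M\<close> lattice constants.\<close>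
  define d where "d x = (\<Sum>k\<in>?I. R k * translate (s k) h x) - (\<Sum>k\<in>?I. Q k * translate (s k) f x)" for x
  note fL = compact_L2_L2[OF f] and hL = compact_L2_L2[OF h]
  have S: "shifts m f \<subseteq> L2" using fL by (rule shifts_L2)
  have fV: "f \<in> closed_span (shifts m f)" using fL by (intro closed_span_base self_in_shifts)
  have shV: "translate (s k) g \<in> closed_span (shifts m f)" if "g \<in> closed_span (shifts m f)" for g k
    using that shifts_translate unfolding s_def by (rule closed_span_translate)
  have dV: "d \<in> closed_span (shifts m f)"
    unfolding d_def[abs_def] by (intro closed_span_diff closed_span_sum closed_span_cmult S shV hV fV)
  have translate: "l2_inner (translate (s k) u) (translate (s i) v) = l2_inner u (translate (s (i - k)) v)" for k i u v
  proof -
    have "translate (s i) v = translate (s k) (translate (s (i - k)) v)" by (simp add: s_def diff_divide_distrib)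
    then show ?thesis by (simp only: l2_inner_translate)
  qed
  have "l2_inner d (translate (s i) f) = 0" for i
  proof -
    have "l2_inner d (translate (s i) f) = (\<Sum>k\<in>?I. R k * Q (i - k)) - (\<Sum>k\<in>?I. Q k * R (i - k))"
      unfolding d_def[abs_def]
      by (subst l2_inner_diff_left; (subst l2_inner_sum_left)?)
         (simp_all only: L2_sum L2_cmult L2_translate fL hL l2_inner_cmult_left translate R_def Q_def,
          (subst l2_inner_sum_left; simp only: L2_sum L2_cmult L2_translate fL hL l2_inner_cmult_left translate)?)
    also have "\<dots> = 0"
      using r q by (subst convolution_commute) (auto simp: R_def Q_def s_def)
    finally show ?thesis .
  qed
  then have "AE x in lborel. d x = 0"
    by (intro closed_span_orthogonal_zero[OF S dV]) (auto simp: shifts_iff s_def)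
  from AE_shift[OF this, of "real M * (1 / 2 ^ m)"] show ?thesis
  proof eventually_elim
    case (elim x)
    let ?y = "x - real M * (1 / 2 ^ m)"
    have "shift_poly (1 / 2 ^ m) (laurent_poly M R) h (?y + real M * (1 / 2 ^ m)) =
          shift_poly (1 / 2 ^ m) (laurent_poly M Q) f (?y + real M * (1 / 2 ^ m))"
      unfolding shift_poly_laurent_poly using elim by (simp add: d_def s_def)
    then show ?case by (simp add: R_def[abs_def] Q_def[abs_def] s_def)
  qed
qed

lemma generating_wavelet_L2: "generating_wavelet \<phi> m f \<Longrightarrow> f \<in> L2"
  by (auto simp: generating_wavelet_def W_def V_def intro: closed_span_L2)

context hurwitz_masks
begin

lemma generating_psi: "generating_wavelet limit_cfun m (psi limit_cfun m)"
  unfolding generating_wavelet_def W_eq_closed_span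
  by (intro conjI refl closed_span_base self_in_shifts compact_L2_L2 psi_compact_L2)

text \<open>The polynomial on the left of the Gram relation is not zero because its middle coefficient is the squared norm of
  \<open>psi\<close>. As no linear factor divides \<open>psi\<close>, the relation can be solved for \<open>h\<close>.\<close>

lemma compactly_supported_wavelet_space_element:
  assumes hW: "h \<in> W limit_cfun m" and K: "compact (ess_support h)"
  obtains k :: int and c where "AE x in lborel. h x = translate (of_int k / 2 ^ m) (shift_poly (1 / 2 ^ m) c (psi limit_cfun m)) x"
proof -
  define t :: real where "t = 1 / 2 ^ m"
  have t: "t > 0" by (simp add: t_def)
  have st: "of_int k / 2 ^ m = of_int k * t" for k by (simp add: t_def)
  have hV: "h \<in> closed_span (shifts m (psi limit_cfun m))" using hW by (simp add: W_eq_closed_span)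
  then have hL: "h \<in> L2" by (rule closed_span_L2)
  then obtain g where g: "g \<in> compact_L2" "AE x in lborel. h x = g x" using K by (rule compact_L2_representative)
  have S: "shifts m (psi limit_cfun m) \<subseteq> L2" by (intro shifts_L2 compact_L2_L2 psi_compact_L2)
  have gV: "g \<in> closed_span (shifts m (psi limit_cfun m))"
    by (rule closed_span_cong_AE[OF S hV compact_L2_L2[OF g(1)] g(2)])
  obtain M1 where M1: "\<And>k. \<bar>k\<bar> > int M1 \<Longrightarrow> l2_inner (psi limit_cfun m) (translate (of_int k / 2 ^ m) (psi limit_cfun m)) = 0"
    using finite_int_support_bound[OF l2_inner_translates_finite[OF psi_compact_L2 psi_compact_L2 t, of m m]]
    unfolding st by blast
  obtain M2 where M2: "\<And>k. \<bar>k\<bar> > int M2 \<Longrightarrow> l2_inner g (translate (of_int k / 2 ^ m) (psi limit_cfun m)) = 0"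
    using finite_int_support_bound[OF l2_inner_translates_finite[OF g(1) psi_compact_L2 t, of m]]
    unfolding st by blast
  define M where "M = max M1 M2"
  define p where "p = laurent_poly M (\<lambda>k. l2_inner (psi limit_cfun m) (translate (of_int k / 2 ^ m) (psi limit_cfun m)))"
  define r where "r = laurent_poly M (\<lambda>k. l2_inner g (translate (of_int k / 2 ^ m) (psi limit_cfun m)))"
  have rel: "AE x in lborel. shift_poly t p g x = shift_poly t r (psi limit_cfun m) x"
    unfolding t_def p_def r_def
    by (rule gram_relation[OF psi_compact_L2 g(1) gV]) (auto simp: M_def intro: M1 M2)
  have "coeff p M = of_real (norm_sq (psi limit_cfun m))"
    by (simp add: p_def coeff_laurent_poly l2_inner_self)
  moreover have "norm_sq (psi limit_cfun m) \<noteq> 0"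
    using norm_sq_eq_0[OF compact_L2_L2[OF psi_compact_L2]] psi_not_zero by blast
  ultimately have "p \<noteq> 0" by auto
  then obtain k c where kc: "AE x in lborel. g (x - real k * t) = shift_poly t c (psi limit_cfun m) x"
    using compactly_supported_multiple[OF psi_compact_L2 t _ _ g(1) rel] not_shift_divisible_psi
    unfolding t_def by blast
  have "AE x in lborel. h x = translate (of_int (- int k) / 2 ^ m) (shift_poly (1 / 2 ^ m) c (psi limit_cfun m)) x"
    using g(2) AE_shift[OF kc, of "- (real k * t)"] by eventually_elim (simp add: t_def)
  then show ?thesis by (rule that)
qed

text \<open>Otherwise \<open>psi\<close> would lie in the closed span of null functions.\<close>

lemma generating_wavelet_not_zero:
  assumes gen: "generating_wavelet limit_cfun m h"
  shows "\<not> (AE x in lborel. h x = 0)"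
proof
  assume zero: "AE x in lborel. h x = 0"
  have hL: "h \<in> L2" using gen by (rule generating_wavelet_L2)
  have psi: "psi limit_cfun m \<in> closed_span (shifts m h)"
    using gen generating_psi[of m] unfolding generating_wavelet_def by blast
  have "AE x in lborel. psi limit_cfun m x = 0"
  proof (rule closed_span_orthogonal_zero[OF shifts_L2[OF hL] psi])
    fix g assume "g \<in> shifts m h"
    then obtain k :: int where g: "g = translate (of_int k / 2 ^ m) h" by (auto simp: shifts_iff)
    have "l2_inner (psi limit_cfun m) g = l2_inner (psi limit_cfun m) (\<lambda>x. 0)"
      unfolding g using AE_shift[OF zero, of "of_int k / 2 ^ m"]
      by (intro l2_inner_cong_AE L2_translate hL L2_zero compact_L2_L2 psi_compact_L2) auto
    then show "l2_inner (psi limit_cfun m) g = 0" by simp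
  qed
  then show False using psi_not_zero by blast
qed

lemma compact_generating_wavelet:
  assumes gen: "generating_wavelet limit_cfun m h" and K: "compact (ess_support h)"
  obtains k :: int and c where "coeff c 0 \<noteq> 0"
    "AE x in lborel. h x = translate (of_int k / 2 ^ m) (shift_poly (1 / 2 ^ m) c (psi limit_cfun m)) x"
proof -
  have "h \<in> W limit_cfun m" using gen unfolding generating_wavelet_def by blast
  then obtain k :: int and c where kc: "AE x in lborel. h x = translate (of_int k / 2 ^ m) (shift_poly (1 / 2 ^ m) c (psi limit_cfun m)) x"
    using K by (rule compactly_supported_wavelet_space_element)
  have "c \<noteq> 0"
  proof
    assume "c = 0"
    then have "AE x in lborel. h x = 0" using kc by simp
    then show False using generating_wavelet_not_zero[OF gen] by blast
  qed
  then obtain a c' where c': "coeff c' 0 \<noteq> 0"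
    "shift_poly (1 / 2 ^ m) c (psi limit_cfun m) = translate (real a * (1 / 2 ^ m)) (shift_poly (1 / 2 ^ m) c' (psi limit_cfun m))"
    using shift_poly_normalize_constant_term by blast
  have "translate (of_int k / 2 ^ m) (shift_poly (1 / 2 ^ m) c (psi limit_cfun m)) =
    translate (of_int (k + int a) / 2 ^ m) (shift_poly (1 / 2 ^ m) c' (psi limit_cfun m))"
    unfolding c'(2) translate_translate by (simp add: add_divide_distrib)
  with kc c'(1) show ?thesis using that by metis
qed

lemma diameter_compact_generating_wavelet:
  assumes "coeff c 0 \<noteq> 0" "AE x in lborel. h x = translate (of_int k / 2 ^ m) (shift_poly (1 / 2 ^ m) c (psi limit_cfun m)) x"
  shows "diameter (ess_support (psi limit_cfun m)) + real (degree c) / 2 ^ m \<le> diameter (ess_support h)"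
proof -
  have "ess_support h = ess_support (translate (of_int k / 2 ^ m) (shift_poly (1 / 2 ^ m) c (psi limit_cfun m)))"
    using assms(2) by (rule ess_support_cong_AE)
  then show ?thesis
    using diameter_ess_support_shift_poly[OF psi_compact_L2 psi_not_zero _ assms(1), of "1 / 2 ^ m" m "of_int k / 2 ^ m"]
    by simp
qed

lemma min_supported_psi: "min_supported_wavelet limit_cfun m (psi limit_cfun m)"
  unfolding min_supported_wavelet_def
proof (intro conjI allI impI generating_psi compact_L2_compact_ess_support psi_compact_L2)
  fix h assume "generating_wavelet limit_cfun m h \<and> compact (ess_support h)"
  then obtain k :: int and c where "coeff c 0 \<noteq> 0"
    "AE x in lborel. h x = translate (of_int k / 2 ^ m) (shift_poly (1 / 2 ^ m) c (psi limit_cfun m)) x"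
    using compact_generating_wavelet by blast
  from diameter_compact_generating_wavelet[OF this]
  show "diameter (ess_support (psi limit_cfun m)) \<le> diameter (ess_support h)"
    by (smt (verit) divide_nonneg_nonneg of_nat_0_le_iff zero_le_power)
qed

lemma min_supported_unique:
  assumes "min_supported_wavelet limit_cfun m f"
  shows "\<exists>c k. c \<noteq> 0 \<and> (AE x in lborel. f x = c * psi limit_cfun m (x - of_int (k::int) / 2 ^ m))"
proof -
  have f: "generating_wavelet limit_cfun m f" "compact (ess_support f)"
    and le: "diameter (ess_support f) \<le> diameter (ess_support (psi limit_cfun m))"
    using assms generating_psi compact_L2_compact_ess_support[OF psi_compact_L2] by (auto simp: min_supported_wavelet_def)
  obtain k :: int and c where c: "coeff c 0 \<noteq> 0"
    and eq: "AE x in lborel. f x = translate (of_int k / 2 ^ m) (shift_poly (1 / 2 ^ m) c (psi limit_cfun m)) x"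
    using f by (rule compact_generating_wavelet)
  have "real (degree c) / 2 ^ m \<le> 0"
    using diameter_compact_generating_wavelet[OF c eq] le by linarith
  then have "real (degree c) \<le> 0 * 2 ^ m" by (subst (asm) pos_divide_le_eq) simp_all
  then have "degree c = 0" by simp
  then obtain b where b: "c = [:b:]" by (rule degree_eq_zeroE)
  have "b \<noteq> 0" using c b by simp
  moreover have "AE x in lborel. f x = b * psi limit_cfun m (x - of_int k / 2 ^ m)"
    using eq by (simp add: b)
  ultimately show ?thesis by blast
qed

end

section \<open>Independence of the representatives\<close>

lemma min_supported_wavelet_cong_AE:
  assumes \<phi>: "\<And>k. \<phi> k \<in> L2" and g: "g \<in> L2" and eq: "AE x in lborel. f x = g x"
    and min: "min_supported_wavelet \<phi> m f"
  shows "min_supported_wavelet \<phi> m g"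
proof -
  have gen: "generating_wavelet \<phi> m f" using min by (simp add: min_supported_wavelet_def)
  then have f: "f \<in> L2" by (rule generating_wavelet_L2)
  have fW: "f \<in> closed_span (shifts (m + 1) (\<phi> (m + 1)))" "\<And>u. u \<in> V \<phi> m \<Longrightarrow> l2_inner f u = 0"
    using gen by (auto simp: generating_wavelet_def W_def V_def)
  have "g \<in> W \<phi> m"
    unfolding W_def mem_Collect_eq
  proof (intro conjI ballI)
    show "g \<in> V \<phi> (m + 1)"
      unfolding V_def using fW(1) g eq by (rule closed_span_cong_AE[OF shifts_L2[OF \<phi>]])
    fix u assume u: "u \<in> V \<phi> m"
    then have "u \<in> L2" unfolding V_def by (rule closed_span_L2)
    then have "l2_inner f u = l2_inner g u" using f g eq by (intro l2_inner_cong_AE) auto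
    with fW(2)[OF u] show "l2_inner g u = 0" by simp
  qed
  moreover have "closed_span (shifts m f) = closed_span (shifts m g)"
    using closed_span_shifts_cong_AE[OF f g eq, of m] closed_span_shifts_cong_AE[OF g f, of m] eq
    by (auto simp: eq_commute)
  ultimately have "generating_wavelet \<phi> m g"
    using gen by (simp add: generating_wavelet_def)
  then show ?thesis
    using min by (simp add: min_supported_wavelet_def ess_support_cong_AE[OF eq])
qed

lemma V_cong_AE:
  assumes "\<phi> k \<in> L2" "\<phi>' k \<in> L2" "AE x in lborel. \<phi> k x = \<phi>' k x"
  shows "V \<phi> k = V \<phi>' k"
  unfolding V_def
  using closed_span_shifts_cong_AE[OF assms, of k] closed_span_shifts_cong_AE[OF assms(2,1), of k] assms(3)
  by (auto simp: eq_commute)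

lemma gcoeff_cong_AE:
  assumes L: "\<And>k. \<phi> k \<in> L2" "\<And>k. \<phi>' k \<in> L2" and eq: "\<And>k. AE x in lborel. \<phi> k x = \<phi>' k x"
  shows "gcoeff \<phi> m \<alpha> = gcoeff \<phi>' m \<alpha>"
  unfolding gcoeff_def
proof (rule integral_cong_AE)
  let ?t = "of_int \<alpha> / 2 ^ (m + 1) :: real"
  have [measurable]: "(\<lambda>x. f (x + ?t)) \<in> borel_measurable borel"
    if "f \<in> borel_measurable borel" for f :: "real \<Rightarrow> complex"
    using borel_measurable_translate[OF that, of "- ?t"] by (simp add: translate_def)
  note [measurable] = L2_measurable[OF L(1)] L2_measurable[OF L(2)]
  show "(\<lambda>x. \<phi> m x * \<phi> (m + 1) (x + ?t)) \<in> borel_measurable lborel"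
    "(\<lambda>x. \<phi>' m x * \<phi>' (m + 1) (x + ?t)) \<in> borel_measurable lborel" by measurable
  show "AE x in lborel. \<phi> m x * \<phi> (m + 1) (x + ?t) = \<phi>' m x * \<phi>' (m + 1) (x + ?t)"
    using eq[of m] AE_shift[OF eq[of "m + 1"], of "- ?t"] by eventually_elim simp
qed

lemma psi_cong_AE:
  assumes L: "\<And>k. \<phi> k \<in> L2" "\<And>k. \<phi>' k \<in> L2" and eq: "\<And>k. AE x in lborel. \<phi> k x = \<phi>' k x"
    and fin: "\<And>\<alpha>. \<bar>\<alpha>\<bar> > M \<Longrightarrow> gcoeff \<phi>' m (\<alpha> - 1) = 0"
  shows "psi \<phi> m \<in> L2" "AE x in lborel. psi \<phi> m x = psi \<phi>' m x"
proof -
  note g = gcoeff_cong_AE[OF L eq]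
  have fin': "gcoeff \<phi> m (\<alpha> - 1) = 0" if "\<bar>\<alpha>\<bar> > M" for \<alpha> using fin[OF that] by (simp add: g)
  have psi: "psi \<phi> m = (\<lambda>x. \<Sum>\<alpha>\<in>{- M..M}. (- 1) powi \<alpha> * gcoeff \<phi>' m (\<alpha> - 1) *
      translate (of_int \<alpha> / 2 ^ (m + 1)) (\<phi> (m + 1)) x)"
    unfolding fun_eq_iff by (subst psi_finite_sum[OF fin']) (auto simp: g)
  show "psi \<phi> m \<in> L2" unfolding psi by (intro L2_sum L2_cmult L2_translate L)
  have "AE x in lborel. \<forall>\<alpha>\<in>{- M..M}. \<phi> (m + 1) (x - of_int \<alpha> / 2 ^ (m + 1)) = \<phi>' (m + 1) (x - of_int \<alpha> / 2 ^ (m + 1))"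
    using AE_shift[OF eq] by (intro AE_finite_allI) auto
  then show "AE x in lborel. psi \<phi> m x = psi \<phi>' m x"
  proof eventually_elim
    case (elim x)
    then show ?case unfolding psi by (subst psi_finite_sum[OF fin]) (auto intro!: sum.cong)
  qed
qed

theorem theorem5p2:
  fixes \<mu> :: real and n m :: nat and \<phi> :: "nat \<Rightarrow> real \<Rightarrow> complex"
  assumes "\<mu> > 1" and "n \<ge> 2"
    and "\<And>k. refinable_function \<mu> n k (\<phi> k)"
  shows "min_supported_wavelet \<phi> m (psi \<phi> m) \<and>
    (\<forall>f. min_supported_wavelet \<phi> m f \<longrightarrow>
       (\<exists>c k. c \<noteq> 0 \<and> (AE x in lborel. f x = c * psi \<phi> m (x - of_int (k::int) / 2 ^ m))))"
proof -
  interpret hurwitz_masks "mask_factor \<mu> n" n using \<open>n \<ge> 2\<close> by (rule hurwitz_masks_mask_factor)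
  have \<phi>: "\<phi> k \<in> L2" for k using assms(3) by (simp add: refinable_function_def)
  have eq: "AE x in lborel. \<phi> k x = limit_cfun k x" for k
    using refinable_function_eq_cascade_limit[OF \<open>n \<ge> 2\<close> assms(3)] .
  have "V \<phi> = V limit_cfun"
    by (intro ext V_cong_AE[of \<phi> _ limit_cfun] \<phi> limit_cfun_L2 eq)
  then have min_eq: "min_supported_wavelet \<phi> = min_supported_wavelet limit_cfun"
    by (simp add: fun_eq_iff min_supported_wavelet_def generating_wavelet_def W_def)
  obtain J where J: "\<And>\<alpha>. \<bar>\<alpha>\<bar> > int (2 * J) \<Longrightarrow> gcoeff limit_cfun m (\<alpha> - 1) = 0"
    using gcoeff_bounded_support by blast
  have psi: "psi \<phi> m \<in> L2" "AE x in lborel. psi \<phi> m x = psi limit_cfun m x"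
    by (rule psi_cong_AE[of \<phi> limit_cfun "int (2 * J)"]; (rule \<phi> limit_cfun_L2 eq J | assumption)+)+
  have psi_eq: "AE x in lborel. psi limit_cfun m x = psi \<phi> m x"
    using psi(2) by eventually_elim simp
  have "min_supported_wavelet \<phi> m (psi \<phi> m)"
    unfolding min_eq by (rule min_supported_wavelet_cong_AE[OF limit_cfun_L2 psi(1) psi_eq min_supported_psi])
  moreover have "\<exists>c k. c \<noteq> 0 \<and> (AE x in lborel. f x = c * psi \<phi> m (x - of_int (k::int) / 2 ^ m))"
    if f: "min_supported_wavelet \<phi> m f" for f
  proof -
    obtain c and k :: int where ck: "c \<noteq> 0" "AE x in lborel. f x = c * psi limit_cfun m (x - of_int k / 2 ^ m)"
      using min_supported_unique[OF f[unfolded min_eq]] by blast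
    have "AE x in lborel. f x = c * psi \<phi> m (x - of_int k / 2 ^ m)"
      using ck(2) AE_shift[OF psi_eq, of "of_int k / 2 ^ m"] by eventually_elim simp
    with ck(1) show ?thesis by blast
  qed
  ultimately show ?thesis by blast
qed

end
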